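(* Let $n\ge3$, $m\ge2$, $k\ge1$ be integers. For $\varepsilon>0$ sufficiently small, the perturbed system $(\mathrm{P})$ of the context has, up to the $k$th-order averaging, exactly $\ell$ limit cycles that can bifurcate from the origin if the semi-algebraic system $$\bar f_{k,1}(\boldsymbol{\eta})=\bar f_{k,3}(\boldsymbol{\eta})=\cdots=\bar f_{k,n}(\boldsymbol{\eta})=0,\qquad R>0,\quad \bar D_k(\boldsymbol{\eta})\neq0,\quad b\neq0$$ has exactly $\ell$ distinct real solutions with respect to the variables $\boldsymbol{\eta}=(R,X_3,\ldots,X_n)$. Here $\bar f_{k,j}=R^{\mu_{k,j}}f_{k,j}$, $j=1,3,\ldots,n$, are the polynomials in $\boldsymbol{\eta}$ obtained from the components of the $k$th-order averaged function $\boldsymbol{f}_k=(f_{k,1},f_{k,3},\ldots,f_{k,n})$ by multiplying with the smallest power $R^{\mu_{k,j}}$ ($\mu_{k,j}\geq 0$) making them polynomial, and $\bar D_k(\boldsymbol{\eta})$ is the numerator of $D_k(\boldsymbol{\eta})=\det J_{\boldsymbol{f}_k}(\boldsymbol{\eta})$, the determinant of the Jacobian matrix of $\boldsymbol{f}_k$ with respect to $(R,X_3,\ldots,X_n)$.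
   Context: Perturbed system $(\mathrm{P})$: $$\dot{x}_1=\sum_{j=1}^k a_j\varepsilon^j x_1-\Big(b+\sum_{j=1}^k b_j\varepsilon^j\Big)x_2+\sum_{i_1+\cdots+i_n=m}p_{1,i_1,\ldots,i_n}x_1^{i_1}\cdots x_n^{i_n},$$ $$\dot{x}_2=\Big(b+\sum_{j=1}^k b_j\varepsilon^j\Big)x_1+\sum_{j=1}^k a_j\varepsilon^j x_2+\sum_{i_1+\cdots+i_n=m}p_{2,i_1,\ldots,i_n}x_1^{i_1}\cdots x_n^{i_n},$$ $$\dot{x}_s=\sum_{j=1}^k c_{s,j}\varepsilon^j x_s+\sum_{i_1+\cdots+i_n=m}p_{s,i_1,\ldots,i_n}x_1^{i_1}\cdots x_n^{i_n},\quad s=3,\ldots,n,$$ with $p_{s,i_1,\ldots,i_n}=\sum_{j=1}^k\varepsilon^{j-1}p_{s,i_1,\ldots,i_n,j-1}$, where $b\ne 0$, $a_j,b_j,c_{s,j},p_{s,i_1,\ldots,i_n,j-1}$ are real parameters and $\varepsilon$ is the perturbation parameter. Standard form: after the changes $x_1=r\cos\theta$, $x_2=r\sin\theta$ ($r>0$), taking $\theta$ as independent variable, and $(r,x_3,\ldots,x_n)=\varepsilon^{1/(m-1)}(R,X_3,\ldots,X_n)$, the system becomes $$\frac{dR}{d\theta}=\frac{R\sum_{i=1}^k\varepsilon^iS_{i,1}}{bR+\sum_{i=1}^k\varepsilon^iS_{i,2}}=\sum_{i=1}^k\varepsilon^iF_{i,1}+\mathcal{O}(\varepsilon^{k+1}),\qquad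 \frac{dX_s}{d\theta}=\frac{R\sum_{i=1}^k\varepsilon^iS_{i,s}}{bR+\sum_{i=1}^k\varepsilon^iS_{i,2}}=\sum_{i=1}^k\varepsilon^iF_{i,s}+\mathcal{O}(\varepsilon^{k+1}),\quad s=3,\ldots,n,$$ where the $F_{i,j}(\theta,R,X_3,\ldots,X_n)$ are the Taylor coefficients in $\varepsilon$ at $\varepsilon=0$, and, with sums over $i_1+\cdots+i_n=m$, $$S_{i,1}=a_iR+\sum(p_{1,i_1,\ldots,i_n,i-1}\cos\theta+p_{2,i_1,\ldots,i_n,i-1}\sin\theta)(R\cos\theta)^{i_1}(R\sin\theta)^{i_2}X_3^{i_3}\cdots X_n^{i_n},$$ $$S_{i,2}=b_iR+\sum(p_{2,i_1,\ldots,i_n,i-1}\cos\theta-p_{1,i_1,\ldots,i_n,i-1}\sin\theta)(R\cos\theta)^{i_1}(R\sin\theta)^{i_2}X_3^{i_3}\cdots X_n^{i_n},$$ $$S_{i,s}=c_{s,i}X_s+\sum p_{s,i_1,\ldots,i_n,i-1}(R\cos\theta)^{i_1}(R\sin\theta)^{i_2}X_3^{i_3}\cdots X_n^{i_n},\quad s=3,\ldots,n.$$ Averaged functions: put $\boldsymbol{F}_i=(F_{i,1},F_{i,3},\ldots,F_{i,n})$ and define recursively $\boldsymbol{y}_1(\theta,\boldsymbol{\eta})=\int_0^\theta\boldsymbol{F}_1(\tau,\boldsymbol{\eta})\,d\tau$ and $$\boldsymbol{y}_i(\theta,\boldsymbol{\eta})=i!\int_0^\theta\Big(\boldsymbol{F}_i(\tau,\boldsymbol{\eta})+\sum_{\ell'=1}^{i-1}\sum_{S_{\ell'}}\frac{1}{\beta_1!\,\beta_2!\,2!^{\beta_2}\cdots\beta_{\ell'}!\,\ell'!^{\beta_{\ell'}}}\,\partial^L\boldsymbol{F}_{i-\ell'}(\tau,\boldsymbol{\eta})\bigodot_{j=1}^{\ell'}\boldsymbol{y}_j(\tau,\boldsymbol{\eta})^{\beta_j}\Big)d\tau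 ,$$ where $S_{\ell'}$ is the set of $\ell'$-tuples $[\beta_1,\ldots,\beta_{\ell'}]$ of nonnegative integers with $\beta_1+2\beta_2+\cdots+\ell'\beta_{\ell'}=\ell'$, $L=\beta_1+\cdots+\beta_{\ell'}$, $\partial^L\boldsymbol{F}$ is the $L$th Fréchet derivative with respect to $\boldsymbol{\eta}$, applied to the list in which each $\boldsymbol{y}_j$ appears $\beta_j$ times. The $i$th-order averaged function is $\boldsymbol{f}_i(\boldsymbol{\eta})=\boldsymbol{y}_i(2\pi,\boldsymbol{\eta})/i!$. Convention "up to the $k$th-order averaging": the parameter values are such that $\boldsymbol{f}_1\equiv\cdots\equiv\boldsymbol{f}_{k-1}\equiv0$ and $\boldsymbol{f}_k\not\equiv0$, and the limit cycles counted are those detected by $\boldsymbol{f}_k$ through the averaging theorem: each zero $\boldsymbol{\eta}^*$ of $\boldsymbol{f}_k$ with $R>0$ and $\det J_{\boldsymbol{f}_k}(\boldsymbol{\eta}^* )\ne0$ gives, for $\varepsilon>0$ small, a $2\pi$-periodic solution $\boldsymbol{\eta}(\theta,\varepsilon)$ of the standard form with $\boldsymbol{\eta}(0,\varepsilon)\to\boldsymbol{\eta}^*$ as $\varepsilon\to0$, hence (undoing the rescaling) a limit cycle of $(\mathrm{P})$ bifurcating from the origin at $\varepsilon=0$.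
   Formalization: "Limit cycle" means a closed orbit of (P) isolated among closed orbits coming from 2π-periodic solutions of the standard form, not among all closed orbits; with the latter meaning the claim fails when a simple zero of f_1 is a centre of the averaged system. *)

theory Defs
  imports "HOL-Analysis.Analysis"
begin

text \<open>
  The finite type \<^typ>\<open>'d\<close> indexes the equations \<open>s = 3, \<dots>, n\<close>, so \<open>n = CARD('d) + 2\<close>; as types
  are nonempty, \<open>n \<ge> 3\<close> holds automatically. A point \<open>(x\<^sub>1, \<dots>, x\<^sub>n)\<close> has type
  \<open>real ^ 'd coord\<close>, and \<open>\<eta> = (R, X\<^sub>3, \<dots>, X\<^sub>n)\<close> has type \<open>real ^ 'd option\<close> with
  \<open>\<eta> $ None = R\<close> and \<open>\<eta> $ Some s = X\<^sub>s\<close>.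
\<close>

datatype 'd coord = C1 | C2 | CS 'd

instance coord :: (finite) finite
proof
  have "(UNIV :: 'a coord set) = {C1, C2} \<union> range CS"
    using coord.exhaust by auto
  moreover have "finite ({C1, C2} \<union> range (CS :: 'a \<Rightarrow> 'a coord))"
    by simp
  ultimately show "finite (UNIV :: 'a coord set)"
    by (simp only:)
qed

text \<open>
  \<open>par_a S j\<close>, \<open>par_bj S j\<close> and \<open>par_c S s j\<close> are \<open>a\<^sub>j\<close>, \<open>b\<^sub>j\<close> and \<open>c\<^sub>s\<^sub>,\<^sub>j\<close> for \<open>1 \<le> j \<le> k\<close>;
  \<open>par_p S s \<alpha> j\<close>, for \<open>0 \<le> j < k\<close>, is the coefficient of \<open>\<epsilon>\<^sup>j\<close> in \<open>p\<^sub>s\<^sub>,\<^sub>\<alpha>\<close>. Values at other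
  indices \<open>j\<close>, and at multi-indices \<open>\<alpha>\<close> of total degree other than \<open>m\<close>, are never used.
\<close>

record 'd perturbed =
  par_m :: nat
  par_k :: nat
  par_b :: real
  par_a :: "nat \<Rightarrow> real"
  par_bj :: "nat \<Rightarrow> real"
  par_c :: "'d \<Rightarrow> nat \<Rightarrow> real"
  par_p :: "'d coord \<Rightarrow> ('d coord \<Rightarrow> nat) \<Rightarrow> nat \<Rightarrow> real"

definition multi_indices :: "nat \<Rightarrow> ('d::finite coord \<Rightarrow> nat) set" where
  "multi_indices m = {\<alpha>. (\<Sum>v\<in>UNIV. \<alpha> v) = m}"

definition monomial :: "('d::finite coord \<Rightarrow> nat) \<Rightarrow> real ^ 'd coord \<Rightarrow> real" where
  "monomial \<alpha> x = (\<Prod>v\<in>UNIV. (x $ v) ^ \<alpha> v)"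


subsection \<open>The perturbed system\<close>

definition eps_sum :: "'d perturbed \<Rightarrow> (nat \<Rightarrow> real) \<Rightarrow> real \<Rightarrow> real" where
  "eps_sum S u \<epsilon> = (\<Sum>j=1..par_k S. u j * \<epsilon> ^ j)"

definition nonlin :: "'d::finite perturbed \<Rightarrow> real \<Rightarrow> 'd coord \<Rightarrow> real ^ 'd coord \<Rightarrow> real" where
  "nonlin S \<epsilon> v x =
     (\<Sum>\<alpha>\<in>multi_indices (par_m S).
        (\<Sum>j=1..par_k S. \<epsilon> ^ (j - 1) * par_p S v \<alpha> (j - 1)) * monomial \<alpha> x)"

definition P_field :: "'d::finite perturbed \<Rightarrow> real \<Rightarrow> real ^ 'd coord \<Rightarrow> real ^ 'd coord" where
  "P_field S \<epsilon> x = (\<chi> v. case v of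
       C1 \<Rightarrow> eps_sum S (par_a S) \<epsilon> * x $ C1
              - (par_b S + eps_sum S (par_bj S) \<epsilon>) * x $ C2 + nonlin S \<epsilon> C1 x
     | C2 \<Rightarrow> (par_b S + eps_sum S (par_bj S) \<epsilon>) * x $ C1
              + eps_sum S (par_a S) \<epsilon> * x $ C2 + nonlin S \<epsilon> C2 x
     | CS s \<Rightarrow> eps_sum S (par_c S s) \<epsilon> * x $ CS s + nonlin S \<epsilon> (CS s) x)"


subsection \<open>The standard form\<close>

definition polar :: "real \<Rightarrow> real ^ 'd::finite option \<Rightarrow> real ^ 'd coord" where
  "polar \<theta> \<eta> = (\<chi> v. case v of
       C1 \<Rightarrow> \<eta> $ None * cos \<theta>
     | C2 \<Rightarrow> \<eta> $ None * sin \<theta>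
     | CS s \<Rightarrow> \<eta> $ Some s)"

text \<open>\<open>S_num S i \<theta> \<eta> None\<close> is \<open>S\<^sub>i\<^sub>,\<^sub>1\<close>, \<open>S_num S i \<theta> \<eta> (Some s)\<close> is \<open>S\<^sub>i\<^sub>,\<^sub>s\<close>, and \<open>S_den\<close> is \<open>S\<^sub>i\<^sub>,\<^sub>2\<close>.\<close>

definition S_num ::
    "'d::finite perturbed \<Rightarrow> nat \<Rightarrow> real \<Rightarrow> real ^ 'd option \<Rightarrow> 'd option \<Rightarrow> real" where
  "S_num S i \<theta> \<eta> j = (case j of
       None \<Rightarrow> par_a S i * \<eta> $ None
         + (\<Sum>\<alpha>\<in>multi_indices (par_m S).
              (par_p S C1 \<alpha> (i - 1) * cos \<theta> + par_p S C2 \<alpha> (i - 1) * sin \<theta>)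
                * monomial \<alpha> (polar \<theta> \<eta>))
     | Some s \<Rightarrow> par_c S s i * \<eta> $ Some s
         + (\<Sum>\<alpha>\<in>multi_indices (par_m S).
              par_p S (CS s) \<alpha> (i - 1) * monomial \<alpha> (polar \<theta> \<eta>)))"

definition S_den :: "'d::finite perturbed \<Rightarrow> nat \<Rightarrow> real \<Rightarrow> real ^ 'd option \<Rightarrow> real" where
  "S_den S i \<theta> \<eta> = par_bj S i * \<eta> $ None
     + (\<Sum>\<alpha>\<in>multi_indices (par_m S).
          (par_p S C2 \<alpha> (i - 1) * cos \<theta> - par_p S C1 \<alpha> (i - 1) * sin \<theta>)
            * monomial \<alpha> (polar \<theta> \<eta>))"

definition std_den :: "'d::finite perturbed \<Rightarrow> real \<Rightarrow> real \<Rightarrow> real ^ 'd option \<Rightarrow> real" where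
  "std_den S \<epsilon> \<theta> \<eta> = par_b S * \<eta> $ None + (\<Sum>i=1..par_k S. \<epsilon> ^ i * S_den S i \<theta> \<eta>)"

definition std_rhs ::
    "'d::finite perturbed \<Rightarrow> real \<Rightarrow> real \<Rightarrow> real ^ 'd option \<Rightarrow> real ^ 'd option" where
  "std_rhs S \<epsilon> \<theta> \<eta> =
     (\<chi> j. \<eta> $ None * (\<Sum>i=1..par_k S. \<epsilon> ^ i * S_num S i \<theta> \<eta> j) / std_den S \<epsilon> \<theta> \<eta>)"

definition F_coeff ::
    "'d::finite perturbed \<Rightarrow> nat \<Rightarrow> real \<Rightarrow> real ^ 'd option \<Rightarrow> real ^ 'd option" where
  "F_coeff S i \<theta> \<eta> = (\<chi> j. (deriv ^^ i) (\<lambda>\<epsilon>. std_rhs S \<epsilon> \<theta> \<eta> $ j) 0 / fact i)"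


subsection \<open>Averaged functions\<close>

text \<open>
  The Frechet derivative of order \<open>length vs\<close>, as a multilinear map, evaluated at the list \<open>vs\<close>.
\<close>

fun frechet_iter ::
    "('a::real_normed_vector \<Rightarrow> 'b::real_normed_vector) \<Rightarrow> 'a list \<Rightarrow> 'a \<Rightarrow> 'b" where
  "frechet_iter f [] x = f x"
| "frechet_iter f (v # vs) x = frechet_derivative (frechet_iter f vs) (at x) v"

text \<open>The tuples \<open>[\<beta>\<^sub>1, \<dots>, \<beta>\<^sub>l]\<close> are functions vanishing outside \<open>{1..l}\<close>.\<close>

definition beta_tuples :: "nat \<Rightarrow> (nat \<Rightarrow> nat) set" where
  "beta_tuples l = {\<beta>. (\<forall>j. j \<notin> {1..l} \<longrightarrow> \<beta> j = 0) \<and> (\<Sum>j=1..l. j * \<beta> j) = l}"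

text \<open>Only values at \<open>\<theta> \<ge> 0\<close> matter, so the unoriented integral over \<open>{0..\<theta>}\<close> suffices.\<close>

function y_avg ::
    "'d::finite perturbed \<Rightarrow> nat \<Rightarrow> real \<Rightarrow> real ^ 'd option \<Rightarrow> real ^ 'd option" where
  "y_avg S i \<theta> \<eta> = fact i *\<^sub>R integral {0..\<theta>} (\<lambda>\<tau>. F_coeff S i \<tau> \<eta>
     + (\<Sum>l=1..i-1. \<Sum>\<beta>\<in>beta_tuples l.
          (1 / (\<Prod>j=1..l. fact (\<beta> j) * fact j ^ \<beta> j)) *\<^sub>R
            frechet_iter (F_coeff S (i - l) \<tau>)
              (concat (map (\<lambda>j. replicate (\<beta> j) (y_avg S j \<tau> \<eta>)) [1..<Suc l])) \<eta>))"
  by pat_completeness auto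
termination
  by (relation "Wellfounded.measure (\<lambda>(S, i, \<theta>, \<eta>). i)") auto

declare y_avg.simps [simp del]

definition f_avg :: "'d::finite perturbed \<Rightarrow> nat \<Rightarrow> real ^ 'd option \<Rightarrow> real ^ 'd option" where
  "f_avg S i \<eta> = y_avg S i (2 * pi) \<eta> /\<^sub>R fact i"

definition D_avg :: "'d::finite perturbed \<Rightarrow> real ^ 'd option \<Rightarrow> real" where
  "D_avg S \<eta> = det (jacobian (f_avg S (par_k S)) (at \<eta>))"


subsection \<open>The semi-algebraic system\<close>

text \<open>
  The averaged functions are only meaningful for \<open>R > 0\<close>, and a polynomial is determined by its
  values there. So \<open>p = R\<^sup>\<mu> g\<close> as rational functions is expressed on the half-space \<open>R > 0\<close>.
\<close>

definition poly_multiple ::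
    "nat \<Rightarrow> (real ^ 'd::finite option \<Rightarrow> real) \<Rightarrow> (real ^ 'd option \<Rightarrow> real) \<Rightarrow> bool" where
  "poly_multiple \<mu> p g \<longleftrightarrow>
     real_polynomial_function p \<and> (\<forall>\<eta>. \<eta> $ None > 0 \<longrightarrow> p \<eta> = (\<eta> $ None) ^ \<mu> * g \<eta>)"

definition least_poly_multiple ::
    "nat \<Rightarrow> (real ^ 'd::finite option \<Rightarrow> real) \<Rightarrow> (real ^ 'd option \<Rightarrow> real) \<Rightarrow> bool" where
  "least_poly_multiple \<mu> p g \<longleftrightarrow>
     poly_multiple \<mu> p g \<and> (\<forall>\<nu><\<mu>. \<not> (\<exists>q. poly_multiple \<nu> q g))"

definition coprime_polys ::
    "('a::real_normed_vector \<Rightarrow> real) \<Rightarrow> ('a \<Rightarrow> real) \<Rightarrow> bool" where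
  "coprime_polys p q \<longleftrightarrow>
     (\<forall>h u v. real_polynomial_function h \<and> real_polynomial_function u \<and> real_polynomial_function v
        \<and> p = (\<lambda>x. h x * u x) \<and> q = (\<lambda>x. h x * v x) \<longrightarrow> (\<exists>c. h = (\<lambda>_. c)))"

text \<open>
  \<open>N\<close> is the numerator of the rational function \<open>g\<close> written in lowest terms. It is unique up to a
  nonzero constant factor, which is irrelevant for the condition \<open>N \<eta> \<noteq> 0\<close>. The functions \<open>g\<close>
  considered here have a power of \<open>R\<close> as reduced denominator, which does not vanish for \<open>R > 0\<close>.
\<close>

definition is_numerator ::
    "(real ^ 'd::finite option \<Rightarrow> real) \<Rightarrow> (real ^ 'd option \<Rightarrow> real) \<Rightarrow> bool" where
  "is_numerator N g \<longleftrightarrow> real_polynomial_function N \<and>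
     (\<exists>Q. real_polynomial_function Q \<and> coprime_polys N Q \<and>
        (\<forall>\<eta>. \<eta> $ None > 0 \<longrightarrow> Q \<eta> \<noteq> 0 \<and> g \<eta> = N \<eta> / Q \<eta>))"

definition semialg_solutions ::
    "'d::finite perturbed \<Rightarrow> ('d option \<Rightarrow> real ^ 'd option \<Rightarrow> real) \<Rightarrow> (real ^ 'd option \<Rightarrow> real)
       \<Rightarrow> (real ^ 'd option) set" where
  "semialg_solutions S fbar Dbar =
     {\<eta>. (\<forall>j. fbar j \<eta> = 0) \<and> \<eta> $ None > 0 \<and> Dbar \<eta> \<noteq> 0 \<and> par_b S \<noteq> 0}"


subsection \<open>Limit cycles bifurcating from the origin\<close>

definition closed_orbit :: "('a::real_normed_vector \<Rightarrow> 'a) \<Rightarrow> 'a set \<Rightarrow> bool" where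
  "closed_orbit V \<Gamma> \<longleftrightarrow>
     (\<exists>\<gamma> T. T > 0 \<and> (\<forall>t. (\<gamma> has_vector_derivative V (\<gamma> t)) (at t)) \<and>
        (\<forall>t. \<gamma> (t + T) = \<gamma> t) \<and> (\<exists>t. \<gamma> t \<noteq> \<gamma> 0) \<and> \<Gamma> = range \<gamma>)"

definition std_periodic ::
    "'d::finite perturbed \<Rightarrow> real \<Rightarrow> (real \<Rightarrow> real ^ 'd option) \<Rightarrow> bool" where
  "std_periodic S \<epsilon> \<phi> \<longleftrightarrow>
     (\<forall>\<theta>. \<phi> \<theta> $ None > 0 \<and> std_den S \<epsilon> \<theta> (\<phi> \<theta>) \<noteq> 0 \<and>
        (\<phi> has_vector_derivative std_rhs S \<epsilon> \<theta> (\<phi> \<theta>)) (at \<theta>)) \<and>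
     (\<forall>\<theta>. \<phi> (\<theta> + 2 * pi) = \<phi> \<theta>)"

definition curve_of ::
    "'d::finite perturbed \<Rightarrow> real \<Rightarrow> (real \<Rightarrow> real ^ 'd option) \<Rightarrow> (real ^ 'd coord) set" where
  "curve_of S \<epsilon> \<phi> = range (\<lambda>\<theta>. (\<epsilon> powr (1 / (real (par_m S) - 1))) *\<^sub>R polar \<theta> (\<phi> \<theta>))"

text \<open>The closed orbits of the perturbed system that close up after one turn of \<open>\<theta>\<close>.\<close>

definition one_turn_orbits :: "'d::finite perturbed \<Rightarrow> real \<Rightarrow> (real ^ 'd coord) set set" where
  "one_turn_orbits S \<epsilon> =
     {\<Gamma>. closed_orbit (P_field S \<epsilon>) \<Gamma> \<and> (\<exists>\<phi>. std_periodic S \<epsilon> \<phi> \<and> \<Gamma> = curve_of S \<epsilon> \<phi>)}"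

text \<open>
  Isolation is required among orbits of one-turn type: a simple zero of the averaged function yields
  an isolated \<open>2\<pi>\<close>-periodic solution of the standard form. It does not exclude nearby closed orbits
  that close up only after many turns; these accumulate, for instance, when the return map has an
  elliptic fixed point.
\<close>

definition limit_cycle :: "'d::finite perturbed \<Rightarrow> real \<Rightarrow> (real ^ 'd coord) set \<Rightarrow> bool" where
  "limit_cycle S \<epsilon> \<Gamma> \<longleftrightarrow> \<Gamma> \<in> one_turn_orbits S \<epsilon> \<and>
     (\<exists>U. open U \<and> \<Gamma> \<subseteq> U \<and> (\<forall>\<Gamma>'\<in>one_turn_orbits S \<epsilon>. \<Gamma>' \<subseteq> U \<longrightarrow> \<Gamma>' = \<Gamma>))"

definition simple_zeros :: "'d::finite perturbed \<Rightarrow> (real ^ 'd option) set" where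
  "simple_zeros S = {\<eta>. \<eta> $ None > 0 \<and> f_avg S (par_k S) \<eta> = 0 \<and> D_avg S \<eta> \<noteq> 0}"

definition detected_cycles ::
    "'d::finite perturbed \<Rightarrow> real \<Rightarrow> real \<Rightarrow> real \<Rightarrow> (real ^ 'd coord) set set" where
  "detected_cycles S \<delta> \<rho> \<epsilon> =
     {\<Gamma>. limit_cycle S \<epsilon> \<Gamma> \<and> \<Gamma> \<subseteq> ball 0 \<rho> \<and>
        (\<exists>\<phi>. std_periodic S \<epsilon> \<phi> \<and> \<Gamma> = curve_of S \<epsilon> \<phi> \<and>
              (\<exists>\<eta>\<in>simple_zeros S. dist (\<phi> 0) \<eta> < \<delta>))}"

text \<open>
  For small \<open>\<epsilon> > 0\<close> there are exactly \<open>N\<close> limit cycles whose rescaled initial value lies near the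
  simple zeros of the \<open>k\<close>th averaged function. The count does not change when \<open>\<delta>\<close> and \<open>\<rho>\<close> shrink, so
  that these initial values converge to simple zeros and the cycles to the origin as \<open>\<epsilon> \<rightarrow> 0\<close>.
\<close>

definition exactly_bifurcating :: "'d::finite perturbed \<Rightarrow> nat \<Rightarrow> bool" where
  "exactly_bifurcating S N \<longleftrightarrow>
     (\<exists>\<delta>\<^sub>0>0. \<forall>\<delta>. 0 < \<delta> \<and> \<delta> \<le> \<delta>\<^sub>0 \<longrightarrow> (\<forall>\<rho>>0. \<exists>\<epsilon>\<^sub>0>0. \<forall>\<epsilon>. 0 < \<epsilon> \<and> \<epsilon> < \<epsilon>\<^sub>0 \<longrightarrow>
        finite (detected_cycles S \<delta> \<rho> \<epsilon>) \<and> card (detected_cycles S \<delta> \<rho> \<epsilon>) = N))"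

end

theory Submission
  imports Defs
begin

text \<open>
  Let \<open>G = \<epsilon> F\<^sub>1 + \<epsilon>\<^sup>2 F\<^sub>2 + \<dots>\<close> be the right-hand side of the standard form. A solution starting at \<open>\<eta>\<close>
  is sought in the form \<open>\<eta> + \<Sum>\<^sub>i \<epsilon>\<^sup>i y\<^sub>i(\<theta>, \<eta>) / i! + \<epsilon>\<^sup>k v(\<theta>)\<close>. By Faa di Bruno, the recursion for the \<open>y\<^sub>i\<close>
  says that the coefficients of \<open>\<epsilon>, \<dots>, \<epsilon>\<^sup>k\<close> cancel in the differential equation, even with \<open>v\<close> present, because
  \<open>G\<close> has no term of order \<open>\<epsilon>\<^sup>0\<close>. What remains is \<open>v' = \<epsilon> \<rho>(\<epsilon>, \<theta>, \<eta>, v)\<close>, \<open>v(0) = 0\<close>, with \<open>\<rho>\<close> bounded and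
  Lipschitz in \<open>(\<eta>, v)\<close> uniformly for small \<open>\<epsilon>\<close>. Hence the displacement after one turn is
  \<open>\<epsilon>\<^sup>k (f\<^sub>k(\<eta>) + w(\<eta>))\<close>, where \<open>w\<close> and its Lipschitz constant are \<open>O(\<epsilon>)\<close>, and a contraction argument gives exactly
  one zero near each simple zero of \<open>f\<^sub>k\<close>; no differentiability of the flow is needed.

  The expansions in \<open>\<epsilon>\<close> are controlled algebraically: the functions involved are built from Laurent polynomials
  in \<open>R\<close> and the \<open>X\<^sub>s\<close>, and functions with an expansion whose coefficients and remainders are uniformly bounded and
  Lipschitz form a ring closed under inverses of functions bounded away from \<open>0\<close>.
\<close>

section \<open>Laurent polynomials in the radius\<close>

text \<open>The term of order 0 in \<epsilon> of the denominator is b R, so for R > 0 every F_i is a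
  polynomial in 1/R, R, the X_s and sin, cos of \<theta>. That is why Laurent polynomials suffice
  for all y_i and f_i. The closure rules for expansions yield coefficients without formulas. These
  are identified point by point: coefficients are unique as limits, and at a fixed (\<theta>, p) the
  expansion along a polynomial path computes them. The contraction is y - M (f_k y + w y), with M
  the inverse Jacobian at the zero; it works because f_k is strictly differentiable there.
  Uniqueness for the differential equation shows that every periodic solution starting near the zero
  is a zero of the displacement, so none is missed. Periodic solutions become closed orbits by a
  change of time with speed \<open>std_den\<close> / R. A curve meets the half-hyperplane \<theta> =
  0 in a single point, so it determines the initial value; this gives injectivity of the count and
  isolation. Solutions stay bounded while the scaling factor tends to 0, so the cycles shrink to the
  origin. For R > 0 the factors R^\<mu> and the reduced denominator do not vanish, so the
  semi-algebraic system describes exactly the simple zeros.\<close>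

text \<open>
  The last rule makes the class insensitive to values outside the half-space \<open>R > 0\<close>, where the functions
  considered below are junk.
\<close>

inductive laurent :: "(real ^ 'd::finite option \<Rightarrow> real) \<Rightarrow> bool" where
  laurent_const: "laurent (\<lambda>_. c)"
| laurent_coord: "laurent (\<lambda>x. x $ s)"
| laurent_inv: "laurent (\<lambda>x. inverse (x $ None))"
| laurent_add: "laurent f \<Longrightarrow> laurent g \<Longrightarrow> laurent (\<lambda>x. f x + g x)"
| laurent_mult: "laurent f \<Longrightarrow> laurent g \<Longrightarrow> laurent (\<lambda>x. f x * g x)"
| laurent_cong: "laurent f \<Longrightarrow> (\<And>x. x $ None > 0 \<Longrightarrow> f x = g x) \<Longrightarrow> laurent g"

lemma laurent_sum: "(\<And>i. i \<in> A \<Longrightarrow> laurent (f i)) \<Longrightarrow> laurent (\<lambda>x. \<Sum>i\<in>A. f i x)"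
  by (induction A rule: infinite_finite_induct) (simp_all add: laurent_const laurent_add)

lemma open_halfspace: "open {x :: real ^ 'd::finite option. x $ None > 0}"
  using open_halfspace_component_gt_cart[of 0 None] by simp

text \<open>The half-space is open, so a derivative at one of its points only sees values inside
  it.\<close>

lemma has_derivative_cong_halfspace:
  fixes f g :: "real ^ 'd::finite option \<Rightarrow> 'b::real_normed_vector"
  assumes "\<And>x. x $ None > 0 \<Longrightarrow> f x = g x" and "x $ None > 0"
  shows "(f has_derivative D) (at x) \<longleftrightarrow> (g has_derivative D) (at x)"
proof -
  show ?thesis
    using assms has_derivative_transform_within_open[OF _ open_halfspace, of f D x UNIV g]
      has_derivative_transform_within_open[OF _ open_halfspace, of g D x UNIV f] by auto
qed

text \<open>Asking for Laurent partial derivatives \<open>D s\<close>, rather than mere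
  differentiability, makes the class closed under differentiation; derivatives of every order then
  exist on the half-space.\<close>

lemma laurent_has_derivative:
  fixes f :: "real ^ 'd::finite option \<Rightarrow> real"
  assumes "laurent f"
  shows "\<exists>D. (\<forall>s. laurent (D s)) \<and>
    (\<forall>x. x $ None > 0 \<longrightarrow> (f has_derivative (\<lambda>v. \<Sum>s\<in>UNIV. D s x * v $ s)) (at x))"
  using assms
proof induction
  case (laurent_const c)
  show ?case
    by (rule exI[of _ "\<lambda>_ _. 0"]) (auto intro: laurent.laurent_const)
next
  case (laurent_coord s)
  have "((\<lambda>x. x $ s) has_derivative (\<lambda>v. \<Sum>t\<in>UNIV. (if t = s then 1 else 0) * v $ t)) (at x)"
    for x :: "real ^ 'd option"
    by (simp add: if_distrib[of "\<lambda>a. a * _"] cong: if_cong)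
       (rule bounded_linear_imp_has_derivative[OF bounded_linear_vec_nth])
  then show ?case
    by (intro exI[of _ "\<lambda>t _. if t = s then 1 else 0"]) (auto intro: laurent.laurent_const)
next
  case laurent_inv
  have "((\<lambda>x. inverse (x $ None)) has_derivative
      (\<lambda>v. \<Sum>t\<in>UNIV. (if t = None then -1 * (inverse (x $ None) * inverse (x $ None)) else 0) * v $ t)) (at x)"
    if "x $ None > 0" for x :: "real ^ 'd option"
  proof -
    have "((\<lambda>x. inverse (x $ None)) has_derivative
       (\<lambda>v. - (inverse (x $ None) * v $ None * inverse (x $ None)))) (at x)"
      by (rule Deriv.has_derivative_inverse)
         (use that in \<open>auto intro!: bounded_linear_imp_has_derivative[OF bounded_linear_vec_nth]\<close>)
    then show ?thesis
      by (simp add: if_distrib[of "\<lambda>a. a * _"] cong: if_cong) (simp add: mult_ac)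
  qed
  moreover have "laurent (\<lambda>x :: real ^ 'd option.
      if t = None then -1 * (inverse (x $ None) * inverse (x $ None)) else 0)" for t :: "'d option"
    by (cases "t = None"; simp only: if_True if_False simp_thms)
       (intro laurent.laurent_mult laurent.laurent_const laurent.laurent_inv)+
  ultimately show ?case
    by (intro exI[of _ "\<lambda>t x. if t = None then -1 * (inverse (x $ None) * inverse (x $ None)) else 0"]) blast
next
  case (laurent_add f g)
  then obtain Df Dg where
    f: "\<And>s. laurent (Df s)" "\<And>x. x $ None > 0 \<Longrightarrow> (f has_derivative (\<lambda>v. \<Sum>s\<in>UNIV. Df s x * v $ s)) (at x)" and
    g: "\<And>s. laurent (Dg s)" "\<And>x. x $ None > 0 \<Longrightarrow> (g has_derivative (\<lambda>v. \<Sum>s\<in>UNIV. Dg s x * v $ s)) (at x)"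
    by blast
  have "((\<lambda>x. f x + g x) has_derivative (\<lambda>v. \<Sum>s\<in>UNIV. (Df s x + Dg s x) * v $ s)) (at x)"
    if "x $ None > 0" for x
    using has_derivative_add[OF f(2)[OF that] g(2)[OF that]] by (simp add: sum.distrib algebra_simps)
  moreover have "laurent (\<lambda>x. Df s x + Dg s x)" for s
    by (intro laurent.laurent_add f g)
  ultimately show ?case
    by (intro exI[of _ "\<lambda>s x. Df s x + Dg s x"]) blast
next
  case (laurent_mult f g)
  then obtain Df Dg where
    f: "\<And>s. laurent (Df s)" "\<And>x. x $ None > 0 \<Longrightarrow> (f has_derivative (\<lambda>v. \<Sum>s\<in>UNIV. Df s x * v $ s)) (at x)" and
    g: "\<And>s. laurent (Dg s)" "\<And>x. x $ None > 0 \<Longrightarrow> (g has_derivative (\<lambda>v. \<Sum>s\<in>UNIV. Dg s x * v $ s)) (at x)"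
    by blast
  have "((\<lambda>x. f x * g x) has_derivative (\<lambda>v. \<Sum>s\<in>UNIV. (f x * Dg s x + Df s x * g x) * v $ s)) (at x)"
    if "x $ None > 0" for x
    using has_derivative_mult[OF f(2)[OF that] g(2)[OF that]]
    by (simp add: sum.distrib sum_distrib_left sum_distrib_right algebra_simps)
  moreover have "laurent (\<lambda>x. f x * Dg s x + Df s x * g x)" for s
    by (intro laurent.laurent_add laurent.laurent_mult f g laurent_mult.hyps)
  ultimately show ?case
    by (intro exI[of _ "\<lambda>s x. f x * Dg s x + Df s x * g x"]) blast
next
  case (laurent_cong f g)
  then obtain D where "\<And>s. laurent (D s)"
    and "\<And>x. x $ None > 0 \<Longrightarrow> (f has_derivative (\<lambda>v. \<Sum>s\<in>UNIV. D s x * v $ s)) (at x)"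
    by blast
  then show ?case
    using has_derivative_cong_halfspace[of f g] laurent_cong.hyps(2) by blast
qed

lemma laurent_differentiable: "laurent f \<Longrightarrow> x $ None > 0 \<Longrightarrow> f differentiable (at x)"
  using laurent_has_derivative differentiable_def by blast

lemma laurent_isCont: "laurent f \<Longrightarrow> x $ None > 0 \<Longrightarrow> isCont f x"
  using laurent_differentiable differentiable_imp_continuous_within by blast

lemma laurent_frechet:
  assumes "laurent f"
  shows "laurent (\<lambda>x. frechet_derivative f (at x) v)"
proof -
  obtain D where D: "\<And>s. laurent (D s)"
    "\<And>x. x $ None > 0 \<Longrightarrow> (f has_derivative (\<lambda>v. \<Sum>s\<in>UNIV. D s x * v $ s)) (at x)"
    using laurent_has_derivative[OF assms] by blast
  have "laurent (\<lambda>x. \<Sum>s\<in>UNIV. D s x * v $ s)"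
    by (intro laurent_sum laurent_mult laurent_const D)
  then show ?thesis
    by (rule laurent_cong) (simp add: frechet_derivative_at[OF D(2), symmetric])
qed

lemma frechet_iter_Nil: "frechet_iter f [] = f"
  by (simp add: fun_eq_iff)

lemma frechet_iter_Cons: "frechet_iter f (v # vs) = (\<lambda>x. frechet_derivative (frechet_iter f vs) (at x) v)"
  by (simp add: fun_eq_iff)

lemma laurent_frechet_iter: "laurent f \<Longrightarrow> laurent (frechet_iter f vs)"
  by (induction vs) (auto intro: laurent_frechet simp: frechet_iter_Nil frechet_iter_Cons simp del: frechet_iter.simps)

lemma frechet_derivative_cong_halfspace:
  fixes f g :: "real ^ 'd::finite option \<Rightarrow> 'b::real_normed_vector"
  assumes "\<And>x. x $ None > 0 \<Longrightarrow> f x = g x" and "x $ None > 0"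
  shows "frechet_derivative f (at x) = frechet_derivative g (at x)"
  unfolding frechet_derivative_def using has_derivative_cong_halfspace[OF assms] by simp

lemma frechet_iter_cong_halfspace:
  fixes f g :: "real ^ 'd::finite option \<Rightarrow> 'b::real_normed_vector"
  assumes "\<And>x. x $ None > 0 \<Longrightarrow> f x = g x" and "x $ None > 0"
  shows "frechet_iter f vs x = frechet_iter g vs x"
  using assms(2)
proof (induction vs arbitrary: x)
  case (Cons v vs)
  then show ?case
    using frechet_derivative_cong_halfspace[of "frechet_iter f vs" "frechet_iter g vs" x] by simp
qed (simp add: assms)

text \<open>The end of the list is differentiated first, so splitting there exposes the innermost
  derivatives.\<close>

lemma frechet_iter_append: "frechet_iter f (vs @ ws) = frechet_iter (frechet_iter f ws) vs"
  by (induction vs) (simp_all add: frechet_iter_Nil frechet_iter_Cons del: frechet_iter.simps)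

text \<open>Every layer stays Laurent, hence differentiable, so linearity passes through one
  derivative at a time. The coefficients \<open>c i\<close> are constants of the differentiation;
  later they are components of frozen directions.\<close>

lemma frechet_iter_sum:
  assumes "\<And>i. i \<in> I \<Longrightarrow> laurent (g i)" and "x $ None > 0"
  shows "frechet_iter (\<lambda>x. \<Sum>i\<in>I. c i * g i x) vs x = (\<Sum>i\<in>I. c i * frechet_iter (g i) vs x)"
  using assms(2)
proof (induction vs arbitrary: x)
  case (Cons v vs)
  have "frechet_derivative (frechet_iter (\<lambda>x. \<Sum>i\<in>I. c i * g i x) vs) (at x)
     = frechet_derivative (\<lambda>x. \<Sum>i\<in>I. c i * frechet_iter (g i) vs x) (at x)"
    by (rule frechet_derivative_cong_halfspace) (use Cons in auto)
  also have "\<dots> = (\<lambda>v. \<Sum>i\<in>I. c i * frechet_derivative (frechet_iter (g i) vs) (at x) v)"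
  proof (rule frechet_derivative_at[symmetric])
    have "(frechet_iter (g i) vs has_derivative frechet_derivative (frechet_iter (g i) vs) (at x)) (at x)"
      if "i \<in> I" for i
      using laurent_differentiable[OF laurent_frechet_iter[OF assms(1)[OF that]] Cons.prems(1)]
        frechet_derivative_works by blast
    then show "((\<lambda>x. \<Sum>i\<in>I. c i * frechet_iter (g i) vs x) has_derivative
      (\<lambda>v. \<Sum>i\<in>I. c i * frechet_derivative (frechet_iter (g i) vs) (at x) v)) (at x)"
      by (intro has_derivative_sum has_derivative_mult_right)
  qed
  finally show ?case by simp
qed simp

lemma frechet_iter_component:
  fixes f :: "real ^ 'd::finite option \<Rightarrow> real ^ 'n"
  assumes "\<And>j. laurent (\<lambda>x. f x $ j)" and "x $ None > 0"
  shows "frechet_iter f vs x $ j = frechet_iter (\<lambda>x. f x $ j) vs x"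
  using assms(2)
proof (induction vs arbitrary: x j)
  case (Cons v vs)
  let ?D = "\<lambda>j. frechet_derivative (frechet_iter (\<lambda>x. f x $ j) vs) (at x)"
  have 1: "(frechet_iter (\<lambda>x. f x $ j) vs has_derivative ?D j) (at x)" for j
    using laurent_differentiable[OF laurent_frechet_iter[OF assms(1)] Cons.prems(1)]
      frechet_derivative_works by blast
  have 2: "((\<lambda>x. frechet_iter f vs x $ j) has_derivative ?D j) (at x)" for j
    using has_derivative_cong_halfspace[of "\<lambda>x. frechet_iter f vs x $ j" "frechet_iter (\<lambda>x. f x $ j) vs" x] 1 Cons by blast
  have "(frechet_iter f vs has_derivative (\<lambda>v. \<chi> j. ?D j v)) (at x)"
    unfolding has_derivative_componentwise_within[of "frechet_iter f vs"]
    using 2 by (auto simp: Basis_vec_def inner_axis)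
  from fun_cong[OF frechet_derivative_at[OF this], of v, symmetric] show ?case by simp
qed simp

text \<open>
  Finite sums of products \<open>c(\<theta>) m(\<eta>)\<close>. Unlike joint smoothness, this form makes closure under integration in
  \<open>\<theta>\<close> and differentiation in \<open>\<eta>\<close> immediate.
\<close>

inductive separable :: "(real \<Rightarrow> real ^ 'd::finite option \<Rightarrow> real) \<Rightarrow> bool" where
  separable_base: "continuous_on UNIV c \<Longrightarrow> laurent m \<Longrightarrow> separable (\<lambda>t x. c t * m x)"
| separable_add: "separable f \<Longrightarrow> separable g \<Longrightarrow> separable (\<lambda>t x. f t x + g t x)"
| separable_cong: "separable f \<Longrightarrow> (\<And>t x. x $ None > 0 \<Longrightarrow> f t x = g t x) \<Longrightarrow> separable g"

lemma separable_of_laurent: "laurent m \<Longrightarrow> separable (\<lambda>_. m)"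
  using separable_base[of "\<lambda>_. 1" m] by simp

lemma separable_of_continuous: "continuous_on UNIV c \<Longrightarrow> separable (\<lambda>t _. c t)"
  using separable_base[OF _ laurent_const[of 1], of c] by simp

lemma separable_const: "separable (\<lambda>_ _. c)"
  by (rule separable_of_continuous) simp

lemma separable_sum: "(\<And>i. i \<in> A \<Longrightarrow> separable (f i)) \<Longrightarrow> separable (\<lambda>t x. \<Sum>i\<in>A. f i t x)"
  by (induction A rule: infinite_finite_induct) (simp_all add: separable_const separable_add)

lemma separable_mult:
  assumes "separable f" and "separable g"
  shows "separable (\<lambda>t x. f t x * g t x)"
  using assms
proof induction
  case (separable_base c m)
  from separable_base.prems show ?case
  proof induction
    case (separable_base c' m')
    have "separable (\<lambda>t x. (c t * c' t) * (m x * m' x))"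
      by (intro separable.separable_base continuous_intros laurent_mult) (use \<open>continuous_on UNIV c\<close> \<open>laurent m\<close> separable_base in auto)
    then show ?case by (simp add: mult_ac)
  next
    case (separable_add f g)
    then show ?case using separable.separable_add[OF separable_add.IH] by (simp add: algebra_simps)
  next
    case (separable_cong f g)
    then show ?case by (auto intro: separable.separable_cong[OF separable_cong.IH])
  qed
next
  case (separable_add f g)
  then show ?case using separable.separable_add[OF separable_add.IH] by (simp add: algebra_simps)
next
  case (separable_cong f h)
  then show ?case by (auto intro: separable.separable_cong[OF separable_cong.IH])
qed

lemma separable_prod: "(\<And>i. i \<in> A \<Longrightarrow> separable (f i)) \<Longrightarrow> separable (\<lambda>t x. \<Prod>i\<in>A. f i t x)"
  by (induction A rule: infinite_finite_induct) (simp_all add: separable_const separable_mult)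

lemma separable_power: "separable f \<Longrightarrow> separable (\<lambda>t x. f t x ^ n)"
  by (induction n) (simp_all add: separable_const separable_mult)

lemma separable_imp_laurent:
  assumes "separable f" shows "laurent (f t)"
  using assms
proof induction
  case (separable_base c m)
  then show ?case by (intro laurent_mult laurent_const)
next
  case (separable_add f g)
  then show ?case by (intro laurent_add)
next
  case (separable_cong f g)
  from separable_cong.IH show ?case by (rule laurent_cong) (rule separable_cong.hyps)
qed

lemma separable_continuous:
  assumes "separable f"
  shows "continuous_on (UNIV \<times> {x. x $ None > 0}) (\<lambda>z. f (fst z) (snd z))"
  using assms
proof induction
  case (separable_base c m)
  have "continuous_on {x. x $ None > 0} m"
    using laurent_isCont[OF separable_base(2)] by (simp add: continuous_at_imp_continuous_on)
  then have "continuous_on (UNIV \<times> {x. x $ None > 0}) (\<lambda>z::real \<times> _. m (snd z))"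
    by (rule continuous_on_compose2) (auto intro!: continuous_intros)
  moreover have "continuous_on (UNIV \<times> {x::real^'a option. x $ None > 0}) (\<lambda>z. c (fst z))"
    by (rule continuous_on_compose2[OF separable_base(1)]) (auto intro!: continuous_intros)
  ultimately show ?case by (rule continuous_on_mult[rotated])
next
  case (separable_add f g)
  show ?case by (rule continuous_on_add[OF separable_add.IH])
next
  case (separable_cong f g)
  show ?case by (rule continuous_on_eq[OF separable_cong.IH]) (use separable_cong.hyps in auto)
qed

lemma separable_continuous_time:
  assumes "separable f" and "x $ None > 0"
  shows "continuous_on A (\<lambda>t. f t x)"
proof -
  have "continuous_on A (\<lambda>t. f (fst (t, x)) (snd (t, x)))"
    by (rule continuous_on_compose2[OF separable_continuous[OF assms(1)]]) 
       (use assms(2) in \<open>auto intro!: continuous_on_Pair continuous_on_id continuous_on_const\<close>)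
  then show ?thesis by simp
qed

text \<open>For t \<le> 0 the unoriented integral is 0. Continuity on the whole line, as
  \<open>separable_base\<close> demands, is glued from the two half-lines.\<close>

lemma continuous_on_integral_0:
  fixes c :: "real \<Rightarrow> real"
  assumes "continuous_on UNIV c"
  shows "continuous_on UNIV (\<lambda>t. integral {0..t} c)"
proof -
  have "continuous_on {..0} (\<lambda>t. integral {0..t} c)"
  proof (rule continuous_on_eq[OF continuous_on_const[of _ 0]])
    show "0 = integral {0..t} c" if "t \<in> {..0}" for t
      using that by (cases "t = 0") auto
  qed
  moreover have "continuous_on {0..} (\<lambda>t. integral {0..t} c)"
    unfolding continuous_on_eq_continuous_within
  proof
    fix t :: real assume t: "t \<in> {0..}"
    have "continuous_on {0..t+1} (\<lambda>t. integral {0..t} c)"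
      by (intro indefinite_integral_continuous_1 integrable_continuous_interval continuous_on_subset[OF assms]) auto
    then have "continuous (at t within {0..t+1}) (\<lambda>t. integral {0..t} c)"
      using t by (simp add: continuous_on_eq_continuous_within)
    \<comment> \<open>Continuity is local, so the bounded interval ending at t + 1 may replace the
      half-line.\<close>
    moreover have "at t within {0..t+1} = at t within {0..}"
      by (rule at_within_nhd[of t "{..<t+1}"]) auto
    ultimately show "continuous (at t within {0..}) (\<lambda>t. integral {0..t} c)" by simp
  qed
  ultimately have "continuous_on ({..0} \<union> {0..}) (\<lambda>t. integral {0..t} c)"
    by (intro continuous_on_closed_Un) auto
  moreover have "{..0} \<union> {0..} = (UNIV :: real set)" by auto
  ultimately show ?thesis by simp
qed

lemma separable_integral:
  assumes "separable f"
  shows "separable (\<lambda>t x. integral {0..t} (\<lambda>\<tau>. f \<tau> x))"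
  using assms
proof induction
  case (separable_base c m)
  have "separable (\<lambda>t x. integral {0..t} c * m x)"
    by (intro separable.separable_base continuous_on_integral_0) (use separable_base in auto)
  then show ?case by simp
next
  case (separable_add f g)
  show ?case
  proof (rule separable_cong[OF separable.separable_add[OF separable_add.IH]])
    fix t :: real and x :: "real ^ 'a option" assume x: "x $ None > 0"
    show "integral {0..t} (\<lambda>\<tau>. f \<tau> x) + integral {0..t} (\<lambda>\<tau>. g \<tau> x) = integral {0..t} (\<lambda>\<tau>. f \<tau> x + g \<tau> x)"
      by (rule integral_add[symmetric])
         (auto intro!: integrable_continuous_interval separable_continuous_time x separable_add.hyps)
  qed
next
  case (separable_cong f g)
  show ?case
    by (rule separable.separable_cong[OF separable_cong.IH]) (simp add: separable_cong.hyps)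
qed

lemma separable_frechet:
  assumes "separable f"
  shows "separable (\<lambda>t x. frechet_derivative (f t) (at x) v)"
  using assms
proof induction
  case (separable_base c m)
  have "separable (\<lambda>t x. c t * frechet_derivative m (at x) v)"
    by (intro separable.separable_base laurent_frechet separable_base.hyps)
  then show ?case
  proof (rule separable_cong)
    fix t and x :: "real ^ 'a option" assume x: "x $ None > 0"
    show "c t * frechet_derivative m (at x) v = frechet_derivative (\<lambda>x. c t * m x) (at x) v"
      using frechet_iter_sum[of "{()}" "\<lambda>_. m" x "\<lambda>_. c t" "[v]"] separable_base.hyps x by (simp add: frechet_iter_Nil)
  qed
next
  case (separable_add f g)
  show ?case
  proof (rule separable_cong[OF separable.separable_add[OF separable_add.IH]])
    fix t and x :: "real ^ 'a option" assume x: "x $ None > 0"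
    show "frechet_derivative (f t) (at x) v + frechet_derivative (g t) (at x) v
       = frechet_derivative (\<lambda>x. f t x + g t x) (at x) v"
      using frechet_iter_sum[of "UNIV" "\<lambda>b. if b then f t else g t" x "\<lambda>_. 1" "[v]"] separable_add.hyps x
      by (simp add: UNIV_bool separable_imp_laurent add.commute frechet_iter_Nil)
  qed
next
  case (separable_cong f g)
  show ?case
    by (rule separable.separable_cong[OF separable_cong.IH])
       (rule fun_cong[OF frechet_derivative_cong_halfspace[OF separable_cong.hyps(2)]])
qed

lemma linear_expand_axis:
  fixes v :: "real ^ 'n"
  assumes "linear L"
  shows "L v = (\<Sum>s\<in>UNIV. (v $ s) *\<^sub>R L (axis s 1))"
proof -
  have "L v = L (\<Sum>s\<in>UNIV. (v $ s) *\<^sub>R axis s 1)"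
    using basis_expansion[of v] by (simp add: scalar_mult_eq_scaleR)
  then show ?thesis
    by (simp add: linear_sum[OF assms] linear_scale[OF assms])
qed

text \<open>The directions depend on (t, x) but are frozen while differentiating. Expanding the
  innermost direction in the standard basis turns it into scalar factors, constant for the outer
  derivatives, times a derivative of a separable function along a fixed axis; this is again
  separable.\<close>

lemma separable_frechet_iter:
  assumes "separable f" and "\<And>w s. w \<in> set ws \<Longrightarrow> separable (\<lambda>t x. w t x $ s)"
  shows "separable (\<lambda>t x. frechet_iter (f t) (map (\<lambda>w. w t x) ws) x)"
  using assms
proof (induction ws arbitrary: f rule: rev_induct)
  case Nil
  then show ?case by simp
next
  case (snoc w ws)
  let ?D = "\<lambda>s t x. frechet_derivative (f t) (at x) (axis s 1)"
  have "separable (\<lambda>t x. \<Sum>s\<in>UNIV. w t x $ s * frechet_iter (?D s t) (map (\<lambda>w. w t x) ws) x)"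
    by (intro separable_sum separable_mult snoc.IH separable_frechet) (use snoc.prems in auto)
  then show ?case
  proof (rule separable_cong)
    fix t and x :: "real ^ 'a option" assume x: "x $ None > 0"
    \<comment> \<open>The direction keeps its value at x while the variable of differentiation is
      y.\<close>
    have "frechet_iter (frechet_iter (f t) [w t x]) (map (\<lambda>w. w t x) ws) x
      = frechet_iter (\<lambda>y. \<Sum>s\<in>UNIV. w t x $ s * ?D s t y) (map (\<lambda>w. w t x) ws) x"
    proof (rule frechet_iter_cong_halfspace[OF _ x])
      fix y :: "real ^ 'a option" assume y: "y $ None > 0"
      have "linear (frechet_derivative (f t) (at y))"
        using laurent_differentiable[OF separable_imp_laurent[OF snoc.prems(1)] y] linear_frechet_derivative by blast
      from linear_expand_axis[OF this, of "w t x"]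
      show "frechet_iter (f t) [w t x] y = (\<Sum>s\<in>UNIV. w t x $ s * ?D s t y)"
        by (simp add: frechet_iter_Nil)
    qed
    also have "\<dots> = (\<Sum>s\<in>UNIV. w t x $ s * frechet_iter (?D s t) (map (\<lambda>w. w t x) ws) x)"
      by (rule frechet_iter_sum[OF _ x]) (intro laurent_frechet separable_imp_laurent snoc.prems)
    finally show "(\<Sum>s\<in>UNIV. w t x $ s * frechet_iter (?D s t) (map (\<lambda>w. w t x) ws) x)
       = frechet_iter (f t) (map (\<lambda>w. w t x) (ws @ [w])) x"
      by (simp add: frechet_iter_append)
  qed
qed

section \<open>Uniform expansions in the perturbation parameter\<close>

text \<open>One constant serves for both size and Lipschitz modulus, so that each operation has to
  track a single number.\<close>

definition bdd_lip :: "'q set \<Rightarrow> 'p::metric_space set \<Rightarrow> real \<Rightarrow> ('q \<Rightarrow> 'p \<Rightarrow> real) \<Rightarrow> bool" where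
  "bdd_lip T K B g \<longleftrightarrow>
     (\<forall>t\<in>T. \<forall>p\<in>K. \<bar>g t p\<bar> \<le> B \<and> (\<forall>q\<in>K. \<bar>g t p - g t q\<bar> \<le> B * dist p q))"

lemma bdd_lipI:
  "(\<And>t p. t \<in> T \<Longrightarrow> p \<in> K \<Longrightarrow> \<bar>g t p\<bar> \<le> B) \<Longrightarrow>
   (\<And>t p q. t \<in> T \<Longrightarrow> p \<in> K \<Longrightarrow> q \<in> K \<Longrightarrow> \<bar>g t p - g t q\<bar> \<le> B * dist p q) \<Longrightarrow> bdd_lip T K B g"
  by (simp add: bdd_lip_def)

lemma bdd_lipD:
  assumes "bdd_lip T K B g" and "t \<in> T" and "p \<in> K"
  shows "\<bar>g t p\<bar> \<le> B" and "0 \<le> B" and "q \<in> K \<Longrightarrow> \<bar>g t p - g t q\<bar> \<le> B * dist p q"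
  using assms abs_ge_zero[of "g t p"] order_trans unfolding bdd_lip_def by blast+

lemma bdd_lip_mono:
  assumes "bdd_lip T K B g" and "B \<le> C"
  shows "bdd_lip T K C g"
proof (rule bdd_lipI)
  fix t p q assume tp: "t \<in> T" "p \<in> K"
  show "\<bar>g t p\<bar> \<le> C" using bdd_lipD(1)[OF assms(1) tp] assms(2) by simp
  assume "q \<in> K"
  then show "\<bar>g t p - g t q\<bar> \<le> C * dist p q"
    using bdd_lipD(3)[OF assms(1) tp] mult_right_mono[OF assms(2), of "dist p q"] by fastforce
qed

lemma bdd_lip_add:
  assumes "bdd_lip T K B f" and "bdd_lip T K C g"
  shows "bdd_lip T K (B + C) (\<lambda>t p. f t p + g t p)"
proof (rule bdd_lipI)
  fix t p q assume tp: "t \<in> T" "p \<in> K"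
  show "\<bar>f t p + g t p\<bar> \<le> B + C"
    using bdd_lipD(1)[OF assms(1) tp] bdd_lipD(1)[OF assms(2) tp] by linarith
  assume "q \<in> K"
  then show "\<bar>(f t p + g t p) - (f t q + g t q)\<bar> \<le> (B + C) * dist p q"
    using bdd_lipD(3)[OF assms(1) tp, of q] bdd_lipD(3)[OF assms(2) tp, of q]
    unfolding distrib_right by linarith
qed

text \<open>The factor 2 comes from f g - f' g' = f (g - g') + (f - f') g', where each summand
  contributes B C.\<close>

lemma bdd_lip_mult:
  assumes "bdd_lip T K B f" and "bdd_lip T K C g"
  shows "bdd_lip T K (2 * B * C) (\<lambda>t p. f t p * g t p)"
proof (rule bdd_lipI)
  fix t p q assume tp: "t \<in> T" "p \<in> K"
  note f = bdd_lipD[OF assms(1) tp] and g = bdd_lipD[OF assms(2) tp]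
  have "\<bar>f t p * g t p\<bar> \<le> B * C"
    unfolding abs_mult by (intro mult_mono f g) auto
  also have "\<dots> \<le> 2 * B * C" using f(2) g(2) by simp
  finally show "\<bar>f t p * g t p\<bar> \<le> 2 * B * C" .
  assume q: "q \<in> K"
  have "f t p * g t p - f t q * g t q = f t p * (g t p - g t q) + (f t p - f t q) * g t q"
    by (simp add: algebra_simps)
  then have "\<bar>f t p * g t p - f t q * g t q\<bar> \<le> \<bar>f t p\<bar> * \<bar>g t p - g t q\<bar> + \<bar>f t p - f t q\<bar> * \<bar>g t q\<bar>"
    by (metis abs_mult abs_triangle_ineq)
  also have "\<dots> \<le> B * (C * dist p q) + (B * dist p q) * C"
    by (intro add_mono mult_mono f g q bdd_lipD(1)[OF assms(2) tp(1) q]) (use f(2) g(2) in auto)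
  finally show "\<bar>f t p * g t p - f t q * g t q\<bar> \<le> (2 * B * C) * dist p q"
    by (simp add: algebra_simps)
qed

text \<open>The first summand of the constant bounds the inverse, the second its Lipschitz modulus:
  a difference of inverses has the product of two values, at least c^2 in modulus, as
  denominator.\<close>

lemma bdd_lip_inverse:
  assumes "bdd_lip T K B f" and "c > 0" and c: "\<And>t p. t \<in> T \<Longrightarrow> p \<in> K \<Longrightarrow> c \<le> \<bar>f t p\<bar>"
  shows "bdd_lip T K (inverse c + B * inverse c * inverse c) (\<lambda>t p. inverse (f t p))"
proof (rule bdd_lipI)
  have inv: "\<bar>inverse (f t p)\<bar> \<le> inverse c" and nz: "f t p \<noteq> 0" if "t \<in> T" "p \<in> K" for t p
    using c[OF that] \<open>c > 0\<close> by (auto simp: le_imp_inverse_le)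
  fix t p q assume tp: "t \<in> T" "p \<in> K"
  note f = bdd_lipD[OF assms(1) tp]
  have "0 \<le> B * inverse c * inverse c" using f(2) \<open>c > 0\<close> by simp
  then show "\<bar>inverse (f t p)\<bar> \<le> inverse c + B * inverse c * inverse c" using inv[OF tp] by linarith
  assume q: "q \<in> K"
  have "inverse (f t p) - inverse (f t q) = - (f t p - f t q) * inverse (f t p) * inverse (f t q)"
    using nz[OF tp] nz[OF tp(1) q] by (simp add: field_simps)
  then have "\<bar>inverse (f t p) - inverse (f t q)\<bar> = \<bar>f t p - f t q\<bar> * \<bar>inverse (f t p)\<bar> * \<bar>inverse (f t q)\<bar>"
    by (simp only: abs_mult abs_minus_cancel)
  also have "\<dots> \<le> B * dist p q * inverse c * inverse c"
    by (intro mult_mono f(3) inv tp q) (use f(2) \<open>c > 0\<close> in auto)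
  also have "\<dots> \<le> (inverse c + B * inverse c * inverse c) * dist p q"
    using \<open>c > 0\<close> by (simp add: algebra_simps)
  finally show "\<bar>inverse (f t p) - inverse (f t q)\<bar> \<le> (inverse c + B * inverse c * inverse c) * dist p q" .
qed

text \<open>The constant precedes \<epsilon>; this is the uniformity that later makes the
  displacement error O(\<epsilon>) in size and in Lipschitz modulus.\<close>

definition unif_lip :: "'q set \<Rightarrow> 'p::metric_space set \<Rightarrow> (real \<Rightarrow> 'q \<Rightarrow> 'p \<Rightarrow> real) \<Rightarrow> bool" where
  "unif_lip T K h \<longleftrightarrow> (\<exists>B. \<forall>\<^sub>F e in at_right 0. bdd_lip T K B (h e))"

lemma unif_lip_obtain:
  assumes "unif_lip T K h"
  obtains B where "B \<ge> 0" and "\<forall>\<^sub>F e in at_right 0. bdd_lip T K B (h e)"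
proof -
  obtain B where "\<forall>\<^sub>F e in at_right 0. bdd_lip T K B (h e)"
    using assms unfolding unif_lip_def by blast
  then have "\<forall>\<^sub>F e in at_right 0. bdd_lip T K (max B 0) (h e)"
    by (rule eventually_mono) (auto intro: bdd_lip_mono)
  then show ?thesis by (intro that[of "max B 0"]) auto
qed

lemma unif_lip_cong:
  assumes "unif_lip T K f" and "\<forall>\<^sub>F e in at_right 0. \<forall>t\<in>T. \<forall>p\<in>K. f e t p = g e t p"
  shows "unif_lip T K g"
proof -
  obtain B where "\<forall>\<^sub>F e in at_right 0. bdd_lip T K B (f e)"
    using assms(1) unfolding unif_lip_def by blast
  with assms(2) have "\<forall>\<^sub>F e in at_right 0. bdd_lip T K B (g e)"
    by eventually_elim (simp add: bdd_lip_def)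
  then show ?thesis unfolding unif_lip_def by blast
qed

lemma unif_lip_subset: "unif_lip T K h \<Longrightarrow> T' \<subseteq> T \<Longrightarrow> K' \<subseteq> K \<Longrightarrow> unif_lip T' K' h"
  unfolding unif_lip_def bdd_lip_def by (elim exE, rule exI, erule eventually_mono) blast

lemma unif_lip_bounded: "(\<And>t. t \<in> T \<Longrightarrow> \<bar>c t\<bar> \<le> B) \<Longrightarrow> unif_lip T K (\<lambda>_ t _. c t)"
  unfolding unif_lip_def bdd_lip_def
  by (rule exI[of _ "max B 0"]) (auto intro!: always_eventually simp: le_max_iff_disj zero_le_mult_iff)

lemma unif_lip_const: "unif_lip T K (\<lambda>_ _ _. c)"
  by (rule unif_lip_bounded[of _ _ "\<bar>c\<bar>"]) simp

lemma unif_lip_Lipschitz: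
  fixes K :: "'p::metric_space set"
  assumes "\<And>p. p \<in> K \<Longrightarrow> \<bar>g p\<bar> \<le> B" and "\<And>p q. p \<in> K \<Longrightarrow> q \<in> K \<Longrightarrow> \<bar>g p - g q\<bar> \<le> L * dist p q"
  shows "unif_lip T K (\<lambda>_ _ p. g p)"
proof -
  have "L * dist p q \<le> max B L * dist p q" for p q :: 'p
    by (rule mult_right_mono) auto
  then have "\<bar>g p\<bar> \<le> max B L \<and> (\<forall>q\<in>K. \<bar>g p - g q\<bar> \<le> max B L * dist p q)" if "p \<in> K" for p
    using assms that by (meson max.coboundedI1 order_trans)
  then show ?thesis unfolding unif_lip_def bdd_lip_def by (intro exI[of _ "max B L"]) (simp add: always_eventually)
qed

lemma unif_lip_eps: "unif_lip T K (\<lambda>e _ _. e)"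
  unfolding unif_lip_def
proof (rule exI[of _ 1])
  have "\<forall>\<^sub>F e in at_right 0. e \<in> {0<..<1::real}"
    by (rule eventually_at_right_real) simp
  then show "\<forall>\<^sub>F e in at_right 0. bdd_lip T K 1 (\<lambda>_ _. e)"
    by eventually_elim (auto simp: bdd_lip_def)
qed

lemma unif_lip_combine:
  assumes "unif_lip T K f" and "unif_lip T K g"
    and "\<And>e B C. bdd_lip T K B (f e) \<Longrightarrow> bdd_lip T K C (g e) \<Longrightarrow> bdd_lip T K (F B C) (h e)"
  shows "unif_lip T K h"
proof -
  obtain B C where "\<forall>\<^sub>F e in at_right 0. bdd_lip T K B (f e)" "\<forall>\<^sub>F e in at_right 0. bdd_lip T K C (g e)"
    using assms(1,2) unfolding unif_lip_def by blast
  then have "\<forall>\<^sub>F e in at_right 0. bdd_lip T K (F B C) (h e)"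
    by eventually_elim (rule assms(3))
  then show ?thesis unfolding unif_lip_def by blast
qed

lemma unif_lip_add: "unif_lip T K f \<Longrightarrow> unif_lip T K g \<Longrightarrow> unif_lip T K (\<lambda>e t p. f e t p + g e t p)"
  by (erule (1) unif_lip_combine) (rule bdd_lip_add)

lemma unif_lip_mult: "unif_lip T K f \<Longrightarrow> unif_lip T K g \<Longrightarrow> unif_lip T K (\<lambda>e t p. f e t p * g e t p)"
  by (erule (1) unif_lip_combine) (rule bdd_lip_mult)

lemma unif_lip_inverse:
  assumes "unif_lip T K f" and "c > 0" and "\<forall>\<^sub>F e in at_right 0. \<forall>t\<in>T. \<forall>p\<in>K. c \<le> \<bar>f e t p\<bar>"
  shows "unif_lip T K (\<lambda>e t p. inverse (f e t p))"
proof -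
  obtain B where "\<forall>\<^sub>F e in at_right 0. bdd_lip T K B (f e)"
    using assms(1) unfolding unif_lip_def by blast
  with assms(3) have "\<forall>\<^sub>F e in at_right 0.
      bdd_lip T K (inverse c + B * inverse c * inverse c) (\<lambda>t p. inverse (f e t p))"
    by eventually_elim (rule bdd_lip_inverse[OF _ \<open>c > 0\<close>], auto)
  then show ?thesis unfolding unif_lip_def by blast
qed

text \<open>
  Expansion to order \<open>n\<close> as \<open>\<epsilon>\<close> tends to \<open>0\<close> from the right. Peeling off one coefficient at a time makes
  products and inverses accessible to induction on \<open>n\<close>.
\<close>

fun expands :: "'q set \<Rightarrow> 'p::metric_space set \<Rightarrow> nat \<Rightarrow> (real \<Rightarrow> 'q \<Rightarrow> 'p \<Rightarrow> real) \<Rightarrow>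
    ('q \<Rightarrow> 'p \<Rightarrow> real fps) \<Rightarrow> bool" where
  "expands T K 0 f A \<longleftrightarrow> unif_lip T K f"
| "expands T K (Suc n) f A \<longleftrightarrow> unif_lip T K (\<lambda>_ t p. fps_nth (A t p) 0) \<and>
     (\<exists>f'. expands T K n f' (\<lambda>t p. fps_shift 1 (A t p)) \<and>
       (\<forall>\<^sub>F e in at_right 0. \<forall>t\<in>T. \<forall>p\<in>K. f e t p = fps_nth (A t p) 0 + e * f' e t p))"

lemma expands_SucE:
  assumes "expands T K (Suc n) f A"
  obtains f' where "unif_lip T K (\<lambda>_ t p. fps_nth (A t p) 0)" and "expands T K n f' (\<lambda>t p. fps_shift 1 (A t p))"
    and "\<forall>\<^sub>F e in at_right 0. \<forall>t\<in>T. \<forall>p\<in>K. f e t p = fps_nth (A t p) 0 + e * f' e t p"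
  using assms unfolding expands.simps(2) by blast

text \<open>An expansion to order n constrains only the coefficients below n, hence the formal
  series may be exchanged beyond that index.\<close>

lemma expands_cong:
  assumes "expands T K n f A" and "\<forall>\<^sub>F e in at_right 0. \<forall>t\<in>T. \<forall>p\<in>K. f e t p = g e t p"
    and "\<And>i t p. i < n \<Longrightarrow> t \<in> T \<Longrightarrow> p \<in> K \<Longrightarrow> fps_nth (A t p) i = fps_nth (B t p) i"
  shows "expands T K n g B"
  using assms
proof (induction n arbitrary: f g A B)
  case 0
  then show ?case using unif_lip_cong by auto
next
  case (Suc n)
  obtain f' where A0: "unif_lip T K (\<lambda>_ t p. fps_nth (A t p) 0)" and f': "expands T K n f' (\<lambda>t p. fps_shift 1 (A t p))"
    "\<forall>\<^sub>F e in at_right 0. \<forall>t\<in>T. \<forall>p\<in>K. f e t p = fps_nth (A t p) 0 + e * f' e t p"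
    using Suc.prems(1) by (rule expands_SucE)
  have eq: "fps_nth (A t p) 0 = fps_nth (B t p) 0" if "t \<in> T" "p \<in> K" for t p
    using Suc.prems(3)[of 0] that by simp
  have "unif_lip T K (\<lambda>_ t p. fps_nth (B t p) 0)"
    by (rule unif_lip_cong[OF A0]) (simp add: eq always_eventually)
  moreover have "expands T K n f' (\<lambda>t p. fps_shift 1 (B t p))"
    by (rule Suc.IH[OF f'(1)]) (use Suc.prems(3) in \<open>auto intro: always_eventually\<close>)
  moreover have "\<forall>\<^sub>F e in at_right 0. \<forall>t\<in>T. \<forall>p\<in>K. g e t p = fps_nth (B t p) 0 + e * f' e t p"
    using Suc.prems(2) f'(2) by eventually_elim (simp add: eq)
  ultimately show ?case by auto
qed

lemma expands_cong_fps:
  "expands T K n f A \<Longrightarrow>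
    (\<And>i t p. i < n \<Longrightarrow> t \<in> T \<Longrightarrow> p \<in> K \<Longrightarrow> fps_nth (A t p) i = fps_nth (B t p) i) \<Longrightarrow> expands T K n f B"
  by (erule expands_cong) (auto intro: always_eventually)

lemma expands_subset:
  "expands T K n f A \<Longrightarrow> T' \<subseteq> T \<Longrightarrow> K' \<subseteq> K \<Longrightarrow> expands T' K' n f A"
proof (induction n arbitrary: f A)
  case 0
  then show ?case using unif_lip_subset by auto
next
  case (Suc n)
  obtain f' where A0: "unif_lip T K (\<lambda>_ t p. fps_nth (A t p) 0)" and f': "expands T K n f' (\<lambda>t p. fps_shift 1 (A t p))"
    "\<forall>\<^sub>F e in at_right 0. \<forall>t\<in>T. \<forall>p\<in>K. f e t p = fps_nth (A t p) 0 + e * f' e t p"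
    using Suc.prems(1) by (rule expands_SucE)
  have "\<forall>\<^sub>F e in at_right 0. \<forall>t\<in>T'. \<forall>p\<in>K'. f e t p = fps_nth (A t p) 0 + e * f' e t p"
    using f'(2) by eventually_elim (use Suc.prems in blast)
  with Suc.IH[OF f'(1)] Suc.prems(2,3) unif_lip_subset[OF A0] show ?case by auto
qed

lemma expands_imp_unif_lip: "expands T K n f A \<Longrightarrow> unif_lip T K f"
proof (induction n arbitrary: f A)
  case (Suc n)
  obtain f' where A0: "unif_lip T K (\<lambda>_ t p. fps_nth (A t p) 0)" and f': "expands T K n f' (\<lambda>t p. fps_shift 1 (A t p))"
    "\<forall>\<^sub>F e in at_right 0. \<forall>t\<in>T. \<forall>p\<in>K. f e t p = fps_nth (A t p) 0 + e * f' e t p"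
    using Suc.prems(1) by (rule expands_SucE)
  show ?case
  proof (rule unif_lip_cong[OF unif_lip_add[OF A0 unif_lip_mult[OF unif_lip_eps Suc.IH[OF f'(1)]]]])
    show "\<forall>\<^sub>F e in at_right 0. \<forall>t\<in>T. \<forall>p\<in>K. fps_nth (A t p) 0 + e * f' e t p = f e t p"
      using f'(2) by eventually_elim simp
  qed
qed simp

lemma expands_Suc_imp: "expands T K (Suc n) f A \<Longrightarrow> expands T K n f A"
proof (induction n arbitrary: f A)
  case 0
  then show ?case using expands_imp_unif_lip[OF 0] by simp
next
  case (Suc n)
  from Suc.prems obtain f' where f': "expands T K (Suc n) f' (\<lambda>t p. fps_shift 1 (A t p))"
    "\<forall>\<^sub>F e in at_right 0. \<forall>t\<in>T. \<forall>p\<in>K. f e t p = fps_nth (A t p) 0 + e * f' e t p"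
    and A0: "unif_lip T K (\<lambda>_ t p. fps_nth (A t p) 0)"
    by (subst (asm) expands.simps(2)) auto
  from Suc.IH[OF f'(1)] f'(2) A0 show ?case by auto
qed

lemma expands_mono: "m \<le> n \<Longrightarrow> expands T K n f A \<Longrightarrow> expands T K m f A"
proof (induction rule: inc_induct)
  case (step k)
  then show ?case using expands_Suc_imp by blast
qed

lemma expands_const:
  assumes "unif_lip T K (\<lambda>_. c)"
  shows "expands T K n (\<lambda>_. c) (\<lambda>t p. fps_const (c t p))"
proof -
  have 0: "expands T K n (\<lambda>_ _ _. 0) (\<lambda>_ _. 0)" for n
  proof (induction n)
    case (Suc n)
    then show ?case by (auto intro!: exI[of _ "\<lambda>_ _ _. 0"] unif_lip_const)
  qed (simp add: unif_lip_const)
  show ?thesis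
  proof (cases n)
    case (Suc n')
    have "fps_shift 1 (fps_const x) = 0" for x :: real
      by (rule fps_ext) simp
    then show ?thesis using assms 0[of n'] Suc by (auto intro!: exI[of _ "\<lambda>_ _ _. 0"])
  qed (simp add: assms)
qed

lemma expands_eps_mult:
  assumes "expands T K n f A"
  shows "expands T K (Suc n) (\<lambda>e t p. e * f e t p) (\<lambda>t p. fps_X * A t p)"
proof -
  have "fps_shift 1 (fps_X * A t p) = A t p" for t p
    by (rule fps_ext) simp
  with assms show ?thesis by (auto intro!: unif_lip_const exI[of _ f])
qed

text \<open>The gain of m orders lets a merely bounded remainder count as an expansion with
  vanishing coefficients.\<close>

lemma expands_eps_power_mult:
  assumes "expands T K n f A"
  shows "expands T K (m + n) (\<lambda>e t p. e ^ m * f e t p) (\<lambda>t p. fps_X ^ m * A t p)"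
proof (induction m)
  case (Suc m)
  from expands_eps_mult[OF Suc] show ?case by (simp add: mult.assoc)
qed (simp add: assms)

lemma expands_add:
  assumes "expands T K n f A" and "expands T K n g B"
  shows "expands T K n (\<lambda>e t p. f e t p + g e t p) (\<lambda>t p. A t p + B t p)"
  using assms
proof (induction n arbitrary: f g A B)
  case 0
  then show ?case using unif_lip_add by auto
next
  case (Suc n)
  obtain f' where A0: "unif_lip T K (\<lambda>_ t p. fps_nth (A t p) 0)" and f': "expands T K n f' (\<lambda>t p. fps_shift 1 (A t p))"
    "\<forall>\<^sub>F e in at_right 0. \<forall>t\<in>T. \<forall>p\<in>K. f e t p = fps_nth (A t p) 0 + e * f' e t p"
    using Suc.prems(1) by (rule expands_SucE)
  obtain g' where B0: "unif_lip T K (\<lambda>_ t p. fps_nth (B t p) 0)" and g': "expands T K n g' (\<lambda>t p. fps_shift 1 (B t p))"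
    "\<forall>\<^sub>F e in at_right 0. \<forall>t\<in>T. \<forall>p\<in>K. g e t p = fps_nth (B t p) 0 + e * g' e t p"
    using Suc.prems(2) by (rule expands_SucE)
  have "\<forall>\<^sub>F e in at_right 0. \<forall>t\<in>T. \<forall>p\<in>K. f e t p + g e t p =
     fps_nth (A t p + B t p) 0 + e * (f' e t p + g' e t p)"
    using f'(2) g'(2) by eventually_elim (simp add: algebra_simps)
  moreover have "expands T K n (\<lambda>e t p. f' e t p + g' e t p) (\<lambda>t p. fps_shift 1 (A t p + B t p))"
    using Suc.IH[OF f'(1) g'(1)] by (simp add: fps_shift_add)
  ultimately show ?case using unif_lip_add[OF A0 B0] by auto
qed

text \<open>With a = a0 + X a' and b = b0 + X b', the product is a0 b0 + X (a0 b' + a' b). Leaving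
  the second factor b whole mirrors the splitting of function products in
  \<open>expands_mult\<close>.\<close>

lemma fps_shift_mult_one:
  "fps_shift 1 (a * b) = fps_const (fps_nth a 0) * fps_shift 1 b + fps_shift 1 a * (b :: real fps)"
proof (rule fps_ext)
  fix n
  have "fps_nth (a * b) (Suc n) = fps_nth a 0 * fps_nth b (Suc n) + (\<Sum>i=0..n. fps_nth a (Suc i) * fps_nth b (n - i))"
    unfolding fps_mult_nth by (subst sum.atLeast0_atMost_Suc_shift) simp
  then show "fps_nth (fps_shift 1 (a * b)) n =
     fps_nth (fps_const (fps_nth a 0) * fps_shift 1 b + fps_shift 1 a * b) n"
    by (simp only: fps_shift_nth fps_add_nth fps_mult_left_const_nth fps_mult_nth[of "fps_shift 1 a"]) simp
qed

lemma expands_mult: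
  assumes "expands T K n f A" and "expands T K n g B"
  shows "expands T K n (\<lambda>e t p. f e t p * g e t p) (\<lambda>t p. A t p * B t p)"
  using assms
proof (induction n arbitrary: f g A B)
  case 0
  then show ?case using unif_lip_mult by auto
next
  case (Suc n)
  obtain f' where A0: "unif_lip T K (\<lambda>_ t p. fps_nth (A t p) 0)" and f': "expands T K n f' (\<lambda>t p. fps_shift 1 (A t p))"
    "\<forall>\<^sub>F e in at_right 0. \<forall>t\<in>T. \<forall>p\<in>K. f e t p = fps_nth (A t p) 0 + e * f' e t p"
    using Suc.prems(1) by (rule expands_SucE)
  obtain g' where B0: "unif_lip T K (\<lambda>_ t p. fps_nth (B t p) 0)" and g': "expands T K n g' (\<lambda>t p. fps_shift 1 (B t p))"
    "\<forall>\<^sub>F e in at_right 0. \<forall>t\<in>T. \<forall>p\<in>K. g e t p = fps_nth (B t p) 0 + e * g' e t p"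
    using Suc.prems(2) by (rule expands_SucE)
  have "\<forall>\<^sub>F e in at_right 0. \<forall>t\<in>T. \<forall>p\<in>K. f e t p * g e t p =
     fps_nth (A t p * B t p) 0 + e * (fps_nth (A t p) 0 * g' e t p + f' e t p * g e t p)"
    using f'(2) g'(2) by eventually_elim (simp add: algebra_simps)
  moreover have "expands T K n (\<lambda>e t p. fps_nth (A t p) 0 * g' e t p + f' e t p * g e t p)
      (\<lambda>t p. fps_shift 1 (A t p * B t p))"
    using expands_add[OF Suc.IH[OF expands_const[OF A0] g'(1)] Suc.IH[OF f'(1) expands_Suc_imp[OF Suc.prems(2)]]]
    by (simp only: fps_shift_mult_one)
  ultimately show ?case using unif_lip_mult[OF A0 B0] by auto
qed

lemma expands_sum:
  "(\<And>i. i \<in> I \<Longrightarrow> expands T K n (f i) (A i)) \<Longrightarrow>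
    expands T K n (\<lambda>e t p. \<Sum>i\<in>I. f i e t p) (\<lambda>t p. \<Sum>i\<in>I. A i t p)"
proof (induction I rule: infinite_finite_induct)
  case (insert x F)
  then show ?case by (auto intro: expands_add)
qed (use expands_const[OF unif_lip_const[of T K 0]] in auto)

text \<open>The identity 1/f = 1/a0 - \<epsilon> f' / (a0 f) expresses the next layer through 1/f
  itself, which the induction hypothesis already expands to one order less. The same identity for
  formal series gives the coefficients.\<close>

lemma expands_inverse:
  assumes "expands T K n f A" and "c > 0"
    and "\<forall>\<^sub>F e in at_right 0. \<forall>t\<in>T. \<forall>p\<in>K. c \<le> \<bar>f e t p\<bar>"
    and "\<And>t p. t \<in> T \<Longrightarrow> p \<in> K \<Longrightarrow> c \<le> \<bar>fps_nth (A t p) 0\<bar>"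
  shows "expands T K n (\<lambda>e t p. inverse (f e t p)) (\<lambda>t p. inverse (A t p))"
  using assms(1)
proof (induction n)
  case 0
  then show ?case using unif_lip_inverse assms by auto
next
  case (Suc n)
  obtain f' where A0: "unif_lip T K (\<lambda>_ t p. fps_nth (A t p) 0)" and f': "expands T K n f' (\<lambda>t p. fps_shift 1 (A t p))"
    "\<forall>\<^sub>F e in at_right 0. \<forall>t\<in>T. \<forall>p\<in>K. f e t p = fps_nth (A t p) 0 + e * f' e t p"
    using Suc.prems(1) by (rule expands_SucE)
  have I: "unif_lip T K (\<lambda>_ t p. inverse (fps_nth (A t p) 0))"
    by (rule unif_lip_inverse[OF A0 \<open>c > 0\<close>]) (simp add: assms(4) always_eventually)
  have shift: "fps_shift 1 (inverse a) =
      fps_const (inverse (fps_nth a 0)) * (fps_const (-1) * (fps_shift 1 a * inverse a))"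
    if "fps_nth a 0 \<noteq> 0" for a :: "real fps"
  proof -
    have "0 = fps_const (fps_nth a 0) * fps_shift 1 (inverse a) + fps_shift 1 a * inverse a"
      unfolding fps_shift_mult_one[symmetric] inverse_mult_eq_1'[OF that]
      by (rule fps_ext) simp
    then have "fps_const (fps_nth a 0) * fps_shift 1 (inverse a) = - (fps_shift 1 a * inverse a)"
      by (simp add: eq_neg_iff_add_eq_0)
    then have "fps_const (inverse (fps_nth a 0)) * (fps_const (fps_nth a 0) * fps_shift 1 (inverse a)) =
      fps_const (inverse (fps_nth a 0)) * - (fps_shift 1 a * inverse a)" by simp
    then show ?thesis using that
      by (simp add: mult.assoc[symmetric] fps_const_neg[symmetric] del: fps_const_neg)
  qed
  have "\<forall>\<^sub>F e in at_right 0. \<forall>t\<in>T. \<forall>p\<in>K. inverse (f e t p) =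
     fps_nth (inverse (A t p)) 0 +
       e * (inverse (fps_nth (A t p) 0) * (-1 * (f' e t p * inverse (f e t p))))"
    using f'(2) assms(3)
  proof eventually_elim
    case (elim e)
    show ?case
    proof (intro ballI)
      fix t p assume *: "t \<in> T" "p \<in> K"
      have "f e t p \<noteq> 0" "fps_nth (A t p) 0 \<noteq> 0"
        using elim * \<open>c > 0\<close> assms(4)[OF *] by fastforce+
      moreover have "e * f' e t p = f e t p - fps_nth (A t p) 0" using elim * by simp
      ultimately show "inverse (f e t p) = fps_nth (inverse (A t p)) 0 +
       e * (inverse (fps_nth (A t p) 0) * (-1 * (f' e t p * inverse (f e t p))))"
        by (simp add: field_simps)
    qed
  qed
  moreover have "expands T K n (\<lambda>e t p. inverse (fps_nth (A t p) 0) * (-1 * (f' e t p * inverse (f e t p))))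
      (\<lambda>t p. fps_const (inverse (fps_nth (A t p) 0)) *
          (fps_const (-1) * (fps_shift 1 (A t p) * inverse (A t p))))"
    by (intro expands_mult expands_const[OF I] expands_const[OF unif_lip_const] f'(1) Suc.IH expands_Suc_imp[OF Suc.prems])
  then have "expands T K n (\<lambda>e t p. inverse (fps_nth (A t p) 0) * (-1 * (f' e t p * inverse (f e t p))))
      (\<lambda>t p. fps_shift 1 (inverse (A t p)))"
    by (rule expands_cong_fps) (use assms(2,4) in \<open>subst shift; fastforce\<close>)
  ultimately show ?case using I by auto
qed

text \<open>The constant coefficient is the limit as \<epsilon> tends to 0, and dividing by
  \<epsilon> moves to the next one. Working at one point suffices to identify coefficients of
  uniform expansions.\<close>

lemma expands_unique:
  assumes "expands {t} {p} n f A" and "expands {t} {p} n f B" and "i < n"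
  shows "fps_nth (A t p) i = fps_nth (B t p) i"
  using assms
proof (induction n arbitrary: f A B i)
  case (Suc n)
  obtain f' where f': "expands {t} {p} n f' (\<lambda>t p. fps_shift 1 (A t p))"
    "\<forall>\<^sub>F e in at_right 0. f e t p = fps_nth (A t p) 0 + e * f' e t p"
    using Suc.prems(1) by auto
  from Suc.prems(2) obtain g' where g': "expands {t} {p} n g' (\<lambda>t p. fps_shift 1 (B t p))"
    "\<forall>\<^sub>F e in at_right 0. f e t p = fps_nth (B t p) 0 + e * g' e t p"
    by auto
  have lim: "((\<lambda>e. e * h e t p) \<longlongrightarrow> 0) (at_right 0)" if h: "expands {t} {p} n h C" for h C
  proof -
    obtain M where "\<forall>\<^sub>F e in at_right 0. \<bar>h e t p\<bar> \<le> M"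
      using expands_imp_unif_lip[OF h] by (auto simp: unif_lip_def bdd_lip_def elim: eventually_mono)
    then show ?thesis
      by (intro lim_null_mult_right_bounded[where B = M] tendsto_ident_at) simp
  qed
  have "((\<lambda>e. f e t p) \<longlongrightarrow> fps_nth (A t p) 0 + 0) (at_right 0)"
    by (rule Lim_transform_eventually[OF tendsto_add[OF tendsto_const lim[OF f'(1)]]])
       (use f'(2) in eventually_elim, simp)
  moreover have "((\<lambda>e. f e t p) \<longlongrightarrow> fps_nth (B t p) 0 + 0) (at_right 0)"
    by (rule Lim_transform_eventually[OF tendsto_add[OF tendsto_const lim[OF g'(1)]]])
       (use g'(2) in eventually_elim, simp)
  ultimately have 0: "fps_nth (A t p) 0 = fps_nth (B t p) 0"
    using tendsto_unique trivial_limit_at_right_real by (metis add.right_neutral)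
  show ?case
  proof (cases i)
    case (Suc i')
    \<comment> \<open>Positive \<epsilon> can be cancelled, so the two quotients agree eventually
      and both series expand the same function.\<close>
    have "\<forall>\<^sub>F e in at_right 0. e \<in> {0<..<1::real}"
      by (rule eventually_at_right_real) simp
    with f'(2) g'(2) have "\<forall>\<^sub>F e in at_right 0. f' e t p = g' e t p"
      by eventually_elim (use 0 in auto)
    then have "expands {t} {p} n g' (\<lambda>t p. fps_shift 1 (A t p))"
      by (intro expands_cong[OF f'(1)]) auto
    from Suc.IH[OF this g'(1), of i'] Suc Suc.prems(3) show ?thesis by simp
  qed (simp add: 0)
qed simp

lemma expands_remainder:
  assumes "expands T K n f A"
  obtains h where "unif_lip T K h"
    and "\<forall>\<^sub>F e in at_right 0. \<forall>t\<in>T. \<forall>p\<in>K.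
      f e t p = (\<Sum>i<n. fps_nth (A t p) i * e ^ i) + e ^ n * h e t p"
  using assms
proof (induction n arbitrary: f A thesis)
  case 0
  then show ?case by auto
next
  case (Suc n)
  from Suc.prems(2) obtain f' where f': "expands T K n f' (\<lambda>t p. fps_shift 1 (A t p))"
    "\<forall>\<^sub>F e in at_right 0. \<forall>t\<in>T. \<forall>p\<in>K. f e t p = fps_nth (A t p) 0 + e * f' e t p"
    by auto
  obtain h where h: "unif_lip T K h"
    "\<forall>\<^sub>F e in at_right 0. \<forall>t\<in>T. \<forall>p\<in>K.
      f' e t p = (\<Sum>i<n. fps_nth (fps_shift 1 (A t p)) i * e ^ i) + e ^ n * h e t p"
    using Suc.IH[OF _ f'(1)] by blast
  have "\<forall>\<^sub>F e in at_right 0. \<forall>t\<in>T. \<forall>p\<in>K.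
      f e t p = (\<Sum>i<Suc n. fps_nth (A t p) i * e ^ i) + e ^ Suc n * h e t p"
    using f'(2) h(2)
    by eventually_elim
       (simp add: sum.lessThan_Suc_shift sum_distrib_left algebra_simps del: sum.lessThan_Suc)
  from Suc.prems(1)[OF h(1) this] show ?case .
qed

section \<open>Bounds and expansions for Laurent and separable functions on compact sets\<close>

lemma compact_halfspace_lower_bound:
  fixes K :: "(real ^ 'd::finite option) set"
  assumes "compact K" and "K \<subseteq> {x. x $ None > 0}"
  obtains c where "c > 0" and "\<And>x. x \<in> K \<Longrightarrow> c \<le> x $ None"
proof (cases "K = {}")
  case True
  then show ?thesis using that[of 1] by simp
next
  case False
  have "continuous_on K (\<lambda>x. x $ None)" by (intro continuous_intros)
  from continuous_attains_inf[OF assms(1) False this] obtain x where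
    "x \<in> K" "\<And>y. y \<in> K \<Longrightarrow> x $ None \<le> y $ None" by blast
  then show ?thesis using that[of "x $ None"] assms(2) by blast
qed

lemma unif_lip_coord:
  fixes K :: "(real ^ 'n) set"
  assumes "bounded K"
  shows "unif_lip T K (\<lambda>_ _ x. x $ s)"
proof -
  obtain B where "\<And>x. x \<in> K \<Longrightarrow> norm x \<le> B"
    using assms bounded_iff by blast
  then show ?thesis
    by (intro unif_lip_Lipschitz[of _ _ B 1])
       (auto intro: order_trans[OF component_le_norm_cart] simp: dist_norm
          simp flip: vector_minus_component intro!: component_le_norm_cart)
qed

lemma unif_lip_laurent:
  assumes "laurent m" and "compact K" and "K \<subseteq> {x. x $ None > 0}"
  shows "unif_lip T K (\<lambda>_ _. m)"
  using assms(1)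
proof induction
  case (laurent_coord s)
  show ?case by (rule unif_lip_coord[OF compact_imp_bounded[OF assms(2)]])
next
  case laurent_inv
  obtain c where "c > 0" and c: "\<And>x. x \<in> K \<Longrightarrow> c \<le> x $ None"
    using compact_halfspace_lower_bound[OF assms(2,3)] by blast
  show ?case
    by (rule unif_lip_inverse[OF unif_lip_coord[OF compact_imp_bounded[OF assms(2)]] \<open>c > 0\<close>])
       (use c in \<open>force intro: always_eventually\<close>)
next
  case (laurent_cong f g)
  show ?case
    by (rule unif_lip_cong[OF laurent_cong.IH])
       (use assms(3) laurent_cong.hyps in \<open>auto intro!: always_eventually\<close>)
qed (rule unif_lip_const unif_lip_add unif_lip_mult; assumption)+

lemma unif_lip_continuous:
  assumes "compact T" and "continuous_on UNIV (c :: real \<Rightarrow> real)"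
  shows "unif_lip T K (\<lambda>_ t _. c t)"
proof -
  have "bounded (c ` T)"
    by (intro compact_imp_bounded compact_continuous_image continuous_on_subset[OF assms(2)] assms(1)) simp
  then obtain B where "\<And>t. t \<in> T \<Longrightarrow> \<bar>c t\<bar> \<le> B"
    unfolding bounded_iff by auto
  then show ?thesis by (rule unif_lip_bounded)
qed

lemma unif_lip_separable:
  assumes "separable f" and "compact T" and "compact K" and "K \<subseteq> {x. x $ None > 0}"
  shows "unif_lip T K (\<lambda>_. f)"
  using assms(1)
proof induction
  case (separable_base c m)
  then show ?case
    by (intro unif_lip_mult unif_lip_continuous unif_lip_laurent assms)
next
  case (separable_add f g)
  show ?case by (rule unif_lip_add[OF separable_add.IH])
next
  case (separable_cong f g)
  show ?case
    by (rule unif_lip_cong[OF separable_cong.IH])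
       (use assms(4) separable_cong.hyps in \<open>auto intro!: always_eventually\<close>)
qed

text \<open>Closure under sums, products and 1/R gives existence and uniformity of the expansion.
  The coefficients \<open>B\<close> are left unspecified, because they are computed afterwards by a
  pointwise comparison. The bound c keeps R away from 0 both along Y and in its limit.\<close>

lemma expands_compose_laurent:
  fixes Y :: "real \<Rightarrow> 'q \<Rightarrow> 'p::metric_space \<Rightarrow> real ^ 'd::finite option"
  assumes "laurent m"
    and Y: "\<And>s. expands T K n (\<lambda>e t p. Y e t p $ s) (A s)"
    and "c > 0" and c: "\<forall>\<^sub>F e in at_right 0. \<forall>t\<in>T. \<forall>p\<in>K. c \<le> Y e t p $ None"
    and cA: "\<And>t p. t \<in> T \<Longrightarrow> p \<in> K \<Longrightarrow> c \<le> fps_nth (A None t p) 0"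
  shows "\<exists>B. expands T K n (\<lambda>e t p. m (Y e t p)) B"
  using assms(1)
proof induction
  case (laurent_const c)
  show ?case using expands_const[OF unif_lip_const] by blast
next
  case (laurent_coord s)
  show ?case using Y by blast
next
  case laurent_inv
  have "expands T K n (\<lambda>e t p. inverse (Y e t p $ None)) (\<lambda>t p. inverse (A None t p))"
  proof (rule expands_inverse[OF Y \<open>c > 0\<close>])
    show "\<forall>\<^sub>F e in at_right 0. \<forall>t\<in>T. \<forall>p\<in>K. c \<le> \<bar>Y e t p $ None\<bar>"
      using c by eventually_elim force
  qed (use cA in force)
  then show ?case by blast
next
  case (laurent_add f g)
  then show ?case using expands_add by blast
next
  case (laurent_mult f g)
  then show ?case using expands_mult by blast
next
  case (laurent_cong f g)
  then obtain B where B: "expands T K n (\<lambda>e t p. f (Y e t p)) B" by blast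
  have "\<forall>\<^sub>F e in at_right 0. \<forall>t\<in>T. \<forall>p\<in>K. f (Y e t p) = g (Y e t p)"
    using c by eventually_elim (use \<open>c > 0\<close> laurent_cong.hyps(2) in force)
  from expands_cong[OF B this] show ?case by blast
qed

lemma expands_compose_separable:
  fixes Y :: "real \<Rightarrow> real \<Rightarrow> 'p::metric_space \<Rightarrow> real ^ 'd::finite option"
  assumes "separable f" and "compact T"
    and Y: "\<And>s. expands T K n (\<lambda>e t p. Y e t p $ s) (A s)"
    and "c > 0" and c: "\<forall>\<^sub>F e in at_right 0. \<forall>t\<in>T. \<forall>p\<in>K. c \<le> Y e t p $ None"
    and cA: "\<And>t p. t \<in> T \<Longrightarrow> p \<in> K \<Longrightarrow> c \<le> fps_nth (A None t p) 0"
  shows "\<exists>B. expands T K n (\<lambda>e t p. f t (Y e t p)) B"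
  using assms(1)
proof induction
  case (separable_base a m)
  from expands_compose_laurent[OF separable_base(2) Y \<open>c > 0\<close> c cA] obtain B where
    B: "expands T K n (\<lambda>e t p. m (Y e t p)) B" by blast
  from expands_mult[OF expands_const[OF unif_lip_continuous[OF assms(2) separable_base(1)]] B]
  show ?case by blast
next
  case (separable_add f g)
  then show ?case using expands_add by blast
next
  case (separable_cong f g)
  then obtain B where B: "expands T K n (\<lambda>e t p. f t (Y e t p)) B" by blast
  have "\<forall>\<^sub>F e in at_right 0. \<forall>t\<in>T. \<forall>p\<in>K. f t (Y e t p) = g t (Y e t p)"
    using c by eventually_elim (use \<open>c > 0\<close> separable_cong.hyps(2) in force)
  from expands_cong[OF B this] show ?case by blast
qed

section \<open>Faa di Bruno expansion along a polynomial path\<close>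

text \<open>Separating the largest index J from the weight l permits induction on J;
  \<open>beta_tuples l\<close> is the case J = l.\<close>

definition weighted_tuples :: "nat \<Rightarrow> nat \<Rightarrow> (nat \<Rightarrow> nat) set" where
  "weighted_tuples J l = {\<beta>. (\<forall>j. j \<notin> {1..J} \<longrightarrow> \<beta> j = 0) \<and> (\<Sum>j=1..J. j * \<beta> j) = l}"

text \<open>This is the coefficient of \<epsilon>^l in F (x + \<epsilon> u_1 + ... + \<epsilon>^J
  u_J). The powers of j! of the averaging recursion are absorbed in u_j = y_j / j!.\<close>

definition faa_coeff ::
    "('a::real_normed_vector \<Rightarrow> real) \<Rightarrow> 'a \<Rightarrow> (nat \<Rightarrow> 'a) \<Rightarrow> nat \<Rightarrow> nat \<Rightarrow> real" where
  "faa_coeff F x u J l = (\<Sum>\<beta>\<in>weighted_tuples J l. (1 / (\<Prod>j=1..J. fact (\<beta> j))) *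
     frechet_iter F (concat (map (\<lambda>j. replicate (\<beta> j) (u j)) [1..<Suc J])) x)"

lemma finite_weighted_tuples: "finite (weighted_tuples J l)"
proof (rule finite_subset)
  show "weighted_tuples J l \<subseteq> {\<beta>. \<forall>j. (j \<in> {1..J} \<longrightarrow> \<beta> j \<in> {..l}) \<and> (j \<notin> {1..J} \<longrightarrow> \<beta> j = 0)}"
  proof (clarsimp simp: weighted_tuples_def)
    fix \<beta> :: "nat \<Rightarrow> nat" and j
    assume j: "Suc 0 \<le> j" "j \<le> J"
    have "j * \<beta> j \<le> (\<Sum>j = Suc 0..J. j * \<beta> j)"
      by (rule member_le_sum) (use j in auto)
    moreover have "\<beta> j \<le> j * \<beta> j" using j by simp
    ultimately show "\<beta> j \<le> (\<Sum>j = Suc 0..J. j * \<beta> j)" by linarith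
  qed
qed (rule finite_set_of_finite_funs; simp)

lemma faa_coeff_0: "faa_coeff F x u 0 l = (if l = 0 then F x else 0)"
proof -
  have "weighted_tuples 0 l = (if l = 0 then {\<lambda>_. 0} else {})"
    by (auto simp: weighted_tuples_def)
  then show ?thesis by (simp add: faa_coeff_def)
qed

text \<open>Tuples are sorted by their last entry n, whose directions stand at the end of the list
  and are therefore the innermost derivatives. The bound \<open>n \<le> l\<close> makes finiteness
  of the index set immediate.\<close>

lemma faa_coeff_Suc:
  "faa_coeff F x u (Suc J) l = (\<Sum>n | n \<le> l \<and> Suc J * n \<le> l.
     1 / fact n * faa_coeff (frechet_iter F (replicate n (u (Suc J)))) x u J (l - Suc J * n))"
proof -
  let ?G = "\<lambda>\<beta> :: nat \<Rightarrow> nat. frechet_iter F (concat (map (\<lambda>j. replicate (\<beta> j) (u j)) [1..<Suc (Suc J)])) x"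
  let ?H = "\<lambda>n (\<beta> :: nat \<Rightarrow> nat). frechet_iter (frechet_iter F (replicate n (u (Suc J))))
      (concat (map (\<lambda>j. replicate (\<beta> j) (u j)) [1..<Suc J])) x"
  have fin: "finite {n. n \<le> l \<and> Suc J * n \<le> l}"
    by (rule finite_subset[of _ "{..l}"]) auto
  have mem: "\<And>\<beta> j. \<beta> \<in> weighted_tuples J l \<Longrightarrow> j > J \<Longrightarrow> \<beta> j = 0" for l
    by (auto simp: weighted_tuples_def)
  have "faa_coeff F x u (Suc J) l =
    (\<Sum>(n, \<beta>)\<in>(SIGMA n:{n. n \<le> l \<and> Suc J * n \<le> l}. weighted_tuples J (l - Suc J * n)).
      1 / fact n * ((1 / (\<Prod>j=1..J. fact (\<beta> j))) * ?H n \<beta>))"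
    unfolding faa_coeff_def
  proof (rule sum.reindex_bij_witness[where
      i = "\<lambda>(n, \<beta>). \<beta>(Suc J := n)" and j = "\<lambda>\<beta>. (\<beta> (Suc J), \<beta>(Suc J := 0))"])
    fix \<beta> assume \<beta>: "\<beta> \<in> weighted_tuples (Suc J) l"
    show "(case (\<beta> (Suc J), \<beta>(Suc J := 0)) of (n, \<beta>) \<Rightarrow> \<beta>(Suc J := n)) = \<beta>" by auto
    have s: "(\<Sum>j=1..J. j * \<beta> j) + Suc J * \<beta> (Suc J) = l"
      using \<beta> by (simp add: weighted_tuples_def)
    have "(\<Sum>j=1..J. j * (\<beta>(Suc J := 0)) j) = (\<Sum>j=1..J. j * \<beta> j)"
      by (rule sum.cong) auto
    moreover have "\<beta> (Suc J) \<le> Suc J * \<beta> (Suc J)" by simp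
    then have "\<beta> (Suc J) \<le> l" using s by linarith
    ultimately show "(\<beta> (Suc J), \<beta>(Suc J := 0)) \<in> (SIGMA n:{n. n \<le> l \<and> Suc J * n \<le> l}. weighted_tuples J (l - Suc J * n))"
      using s \<beta> unfolding weighted_tuples_def mem_Sigma_iff mem_Collect_eq by (auto simp del: mult_Suc)
    have "(\<Prod>j=1..J. fact ((\<beta>(Suc J := 0)) j) :: real) = (\<Prod>j=1..J. fact (\<beta> j))"
      by (rule prod.cong) auto
    moreover have "?G \<beta> = ?H (\<beta> (Suc J)) (\<beta>(Suc J := 0))"
    proof -
      have m: "map (\<lambda>j. replicate ((\<beta>(Suc J := 0)) j) (u j)) [1..<Suc J] = map (\<lambda>j. replicate (\<beta> j) (u j)) [1..<Suc J]"
        by (rule map_cong) auto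
      have upt: "[1..<Suc (Suc J)] = [1..<Suc J] @ [Suc J]" by simp
      show ?thesis
        unfolding upt map_append concat_append frechet_iter_append m by simp
    qed
    ultimately show "(case (\<beta> (Suc J), \<beta>(Suc J := 0)) of (n, \<beta>) \<Rightarrow>
        1 / fact n * ((1 / (\<Prod>j=1..J. fact (\<beta> j))) * ?H n \<beta>)) =
       (1 / (\<Prod>j=1..Suc J. fact (\<beta> j))) * ?G \<beta>"
      by (simp del: upt_Suc fun_upd_apply)
  next
    fix z assume z: "z \<in> (SIGMA n:{n. n \<le> l \<and> Suc J * n \<le> l}. weighted_tuples J (l - Suc J * n))"
    then obtain n \<beta> where [simp]: "z = (n, \<beta>)" and n: "n \<le> l" "Suc J * n \<le> l"
      and \<beta>: "\<beta> \<in> weighted_tuples J (l - Suc J * n)" by auto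
    have "\<beta>(Suc J := 0) = \<beta>" using mem[OF \<beta>, of "Suc J"] by auto
    then show "(\<lambda>\<beta>. (\<beta> (Suc J), \<beta>(Suc J := 0))) (case z of (n, \<beta>) \<Rightarrow> \<beta>(Suc J := n)) = z"
      by simp
    have "(\<Sum>j=1..J. j * (\<beta>(Suc J := n)) j) = (\<Sum>j=1..J. j * \<beta> j)"
      by (rule sum.cong) auto
    then show "(case z of (n, \<beta>) \<Rightarrow> \<beta>(Suc J := n)) \<in> weighted_tuples (Suc J) l"
      using \<beta> n by (auto simp: weighted_tuples_def simp del: mult_Suc)
  qed
  also have "\<dots> = (\<Sum>n | n \<le> l \<and> Suc J * n \<le> l. \<Sum>\<beta>\<in>weighted_tuples J (l - Suc J * n).
      1 / fact n * ((1 / (\<Prod>j=1..J. fact (\<beta> j))) * ?H n \<beta>))"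
    by (rule sum.Sigma[symmetric]) (use fin finite_weighted_tuples in auto)
  finally show ?thesis by (simp add: faa_coeff_def sum_distrib_left)
qed

text \<open>A tuple of weight l has no entry at an index above l. This reconciles paths of degree k
  with the tuples of length l in the recursion.\<close>

lemma faa_coeff_upper:
  assumes "l \<le> J"
  shows "faa_coeff F x u J l = faa_coeff F x u l l"
proof -
  have "faa_coeff F x u (l + d) l = faa_coeff F x u l l" for d
  proof (induction d)
    case (Suc d)
    have "{n. n \<le> l \<and> Suc (l + d) * n \<le> l} = {0}"
    proof -
      have "n = 0" if "Suc (l + d) * n \<le> l" for n
        using that by (cases n) auto
      then show ?thesis by auto
    qed
    then have "faa_coeff F x u (Suc (l + d)) l = faa_coeff F x u (l + d) l"
      unfolding faa_coeff_Suc by (simp add: frechet_iter_Nil)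
    with Suc show ?case by simp
  qed simp
  from this[of "J - l"] assms show ?thesis by simp
qed

lemma faa_coeff_cong:
  assumes "\<And>j. j \<in> {1..J} \<Longrightarrow> u j = w j"
  shows "faa_coeff F x u J l = faa_coeff F x w J l"
proof -
  have "map (\<lambda>j. replicate (\<beta> j) (u j)) [1..<Suc J] = map (\<lambda>j. replicate (\<beta> j) (w j)) [1..<Suc J]"
    for \<beta> :: "nat \<Rightarrow> nat"
    by (rule map_cong) (use assms in auto)
  then show ?thesis unfolding faa_coeff_def by (simp only:)
qed

lemma unif_lip_singleton:
  "(\<forall>\<^sub>F e in at_right 0. \<bar>h e t p\<bar> \<le> B) \<Longrightarrow> unif_lip {t} {p} h"
  unfolding unif_lip_def bdd_lip_def
  by (rule exI[of _ B]) (erule eventually_mono, simp)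

lemma eventually_polynomial_path:
  fixes u :: "nat \<Rightarrow> 'a::real_normed_vector"
  assumes "r > 0"
  shows "\<forall>\<^sub>F e in at_right 0. norm (\<Sum>j=1..J. e ^ j *\<^sub>R u j) < (r :: real)"
proof -
  have "((\<lambda>e::real. norm (\<Sum>j=1..J. e ^ j *\<^sub>R u j)) \<longlongrightarrow> norm (\<Sum>j=1..J. 0 ^ j *\<^sub>R (u j :: 'a))) (at_right 0)"
    by (intro tendsto_intros)
  moreover have "(\<Sum>j=1..J. 0 ^ j *\<^sub>R (u j :: 'a)) = 0"
    by (intro sum.neutral) auto
  ultimately show ?thesis using order_tendstoD(2) assms by fastforce
qed

lemma laurent_bounded_near:
  fixes F :: "real ^ 'd::finite option \<Rightarrow> real"
  assumes "laurent F" and "x $ None > 0"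
  obtains r M where "r > 0" and "\<And>y. y \<in> ball x r \<Longrightarrow> y $ None > 0"
    and "\<And>y. y \<in> ball x r \<Longrightarrow> \<bar>F y\<bar> \<le> M"
proof -
  obtain r1 where r1: "r1 > 0" "ball x r1 \<subseteq> {x. x $ None > 0}"
    using open_halfspace assms(2) openE by blast
  obtain r2 where r2: "r2 > 0" "\<And>y. dist y x < r2 \<Longrightarrow> dist (F y) (F x) < 1"
    using laurent_isCont[OF assms] unfolding continuous_at_eps_delta by (metis zero_less_one)
  show ?thesis
  proof (rule that[of "min r1 r2" "\<bar>F x\<bar> + 1"])
    fix y assume "y \<in> ball x (min r1 r2)"
    then have "dist y x < r2" by (simp add: dist_commute)
    from r2(2)[OF this] show "\<bar>F y\<bar> \<le> \<bar>F x\<bar> + 1" by (simp add: dist_real_def)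
  qed (use r1 r2 in auto)
qed

text \<open>
  Induction on \<open>J\<close>: the increment in the last direction is expanded by the one-dimensional Taylor formula. Its
  derivatives are innermost in \<open>faa_coeff\<close>, so the symmetry of higher derivatives is never used.
\<close>

lemma expands_path:
  fixes F :: "real ^ 'd::finite option \<Rightarrow> real"
  assumes "laurent F" and "x $ None > 0"
  shows "expands {t} {p} N (\<lambda>e _ _. F (x + (\<Sum>j=1..J. e ^ j *\<^sub>R u j)))
     (\<lambda>_ _. Abs_fps (faa_coeff F x u J))"
  using assms(1)
proof (induction J arbitrary: F)
  case 0
  have "expands {t} {p} N (\<lambda>_ _ _. F x) (\<lambda>_ _. fps_const (F x))"
    by (rule expands_const[OF unif_lip_const])
  moreover have "fps_const (F x) = Abs_fps (faa_coeff F x u 0)"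
    by (rule fps_ext) (simp add: faa_coeff_0)
  ultimately show ?case by simp
next
  case (Suc J)
  let ?v = "u (Suc J)"
  let ?D = "\<lambda>n. frechet_iter F (replicate n ?v)"
  let ?z = "\<lambda>e::real. x + (\<Sum>j=1..J. e ^ j *\<^sub>R u j)"
  have D: "laurent (?D n)" for n
    by (rule laurent_frechet_iter[OF Suc.prems])
  obtain r M where r: "r > 0" and pos: "\<And>y. y \<in> ball x r \<Longrightarrow> y $ None > 0"
    and M: "\<And>y. y \<in> ball x r \<Longrightarrow> \<bar>?D N y\<bar> \<le> M"
    using laurent_bounded_near[OF D assms(2)] by metis
  \<comment> \<open>The Taylor remainder of order N for the increment \<open>e ^ Suc J\<close> in
    direction \<open>u (Suc J)\<close>, divided by the N-th power of that increment.\<close>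
  define R where "R e = (F (?z e + e ^ Suc J *\<^sub>R ?v) -
      (\<Sum>n<N. ?D n (?z e) / fact n * (e ^ Suc J) ^ n)) / (e ^ Suc J) ^ N" for e
  have e1: "\<forall>\<^sub>F e in at_right 0. norm (\<Sum>j=1..J. e ^ j *\<^sub>R u j) < r / 2"
    by (rule eventually_polynomial_path) (use r in simp)
  have e2: "\<forall>\<^sub>F e in at_right 0. norm (e ^ Suc J *\<^sub>R ?v) < r / 2"
  proof -
    have "((\<lambda>e. norm (e ^ Suc J *\<^sub>R ?v)) \<longlongrightarrow> norm (0 ^ Suc J *\<^sub>R ?v)) (at_right (0::real))"
      by (intro tendsto_intros)
    from order_tendstoD(2)[OF this, of "r/2"] r show ?thesis by (simp del: norm_scaleR)
  qed
  have e3: "\<forall>\<^sub>F e in at_right 0. (0::real) < e"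
    by (simp add: eventually_at_filter)
  have "\<forall>\<^sub>F e in at_right 0. \<bar>R e\<bar> \<le> M / fact N"
    using e1 e2 e3
  proof eventually_elim
    case (elim e)
    let ?t = "e ^ Suc J"
    have t: "?t > 0" using elim(3) by simp
    \<comment> \<open>The path and the last increment each stay within r / 2, so the whole segment
      lies in the ball where the N-th derivative is bounded by M.\<close>
    have near: "?z e + s *\<^sub>R ?v \<in> ball x r" if "0 \<le> s" "s \<le> ?t" for s
    proof -
      have "norm (s *\<^sub>R ?v) \<le> norm (?t *\<^sub>R ?v)"
        using that by (auto intro!: mult_right_mono simp del: power_Suc)
      then have "norm ((\<Sum>j=1..J. e ^ j *\<^sub>R u j) + s *\<^sub>R ?v) < r"
        using elim norm_triangle_ineq[of "\<Sum>j=1..J. e ^ j *\<^sub>R u j" "s *\<^sub>R ?v"] by linarith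
      moreover have "x - (?z e + s *\<^sub>R ?v) = - ((\<Sum>j=1..J. e ^ j *\<^sub>R u j) + s *\<^sub>R ?v)"
        by (simp add: algebra_simps)
      ultimately show ?thesis by (simp only: mem_ball dist_norm norm_minus_cancel)
    qed
    have "((\<lambda>s. ?D m (?z e + s *\<^sub>R ?v)) has_field_derivative ?D (Suc m) (?z e + s *\<^sub>R ?v)) (at s)"
      if "0 \<le> s" "s \<le> ?t" for m s
    proof -
      let ?y = "?z e + s *\<^sub>R ?v"
      have dif: "(?D m has_derivative frechet_derivative (?D m) (at ?y)) (at ?y)"
        using laurent_differentiable[OF D pos[OF near[OF that]]] frechet_derivative_works by blast
      have "((\<lambda>s. ?z e + s *\<^sub>R ?v) has_derivative (\<lambda>h. h *\<^sub>R ?v)) (at s)"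
        by (auto intro!: derivative_eq_intros)
      from has_derivative_compose[OF this dif]
      have "((\<lambda>s. ?D m (?z e + s *\<^sub>R ?v)) has_derivative (\<lambda>h. frechet_derivative (?D m) (at ?y) (h *\<^sub>R ?v))) (at s)" .
      moreover have "(\<lambda>h. frechet_derivative (?D m) (at ?y) (h *\<^sub>R ?v)) = (*) (?D (Suc m) ?y)"
        using linear_scale[OF has_derivative_linear[OF dif]] by (simp add: fun_eq_iff)
      ultimately show ?thesis unfolding has_field_derivative_def by simp
    qed
    then have "\<exists>s. 0 < s \<and> s \<le> ?t \<and> F (?z e + ?t *\<^sub>R ?v) =
       (\<Sum>m<N. ?D m (?z e + 0 *\<^sub>R ?v) / fact m * ?t ^ m) + ?D N (?z e + s *\<^sub>R ?v) / fact N * ?t ^ N"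
      by (intro Maclaurin2[OF t, where diff = "\<lambda>m s. ?D m (?z e + s *\<^sub>R ?v)"
           and f = "\<lambda>s. F (?z e + s *\<^sub>R ?v)"]) (auto simp del: power_Suc replicate_Suc)
    then obtain s where s: "0 < s" "s \<le> ?t" and eq: "F (?z e + ?t *\<^sub>R ?v) =
       (\<Sum>m<N. ?D m (?z e) / fact m * ?t ^ m) + ?D N (?z e + s *\<^sub>R ?v) / fact N * ?t ^ N"
      by auto
    have "R e = ?D N (?z e + s *\<^sub>R ?v) / fact N"
      unfolding R_def eq using elim(3) by simp
    moreover have "\<bar>?D N (?z e + s *\<^sub>R ?v)\<bar> \<le> M" by (rule M[OF near]) (use s in auto)
    ultimately show ?case by (simp add: divide_right_mono abs_divide)
  qed
  then have "expands {t} {p} 0 (\<lambda>e _ _. R e) (\<lambda>_ _. 0)"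
    unfolding expands.simps by (rule unif_lip_singleton)
  \<comment> \<open>The bounded remainder carries a power of \<epsilon> with exponent (J + 1) N
    \<ge> N, so it contributes no coefficient below N.\<close>
  from expands_eps_power_mult[OF this, of "Suc J * N"]
  have rem: "expands {t} {p} N (\<lambda>e _ _. e ^ (Suc J * N) * R e) (\<lambda>_ _. 0)"
    by (intro expands_mono[of N "Suc J * N"]) (simp_all only: mult_zero_right add_0_right, simp)
  have trm: "expands {t} {p} N (\<lambda>e _ _. e ^ (Suc J * n) * (1 / fact n * ?D n (?z e)))
      (\<lambda>_ _. fps_X ^ (Suc J * n) * (fps_const (1 / fact n) * Abs_fps (faa_coeff (?D n) x u J)))" for n
  proof (rule expands_mono)
    show "expands {t} {p} (Suc J * n + N) (\<lambda>e _ _. e ^ (Suc J * n) * (1 / fact n * ?D n (?z e)))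
      (\<lambda>_ _. fps_X ^ (Suc J * n) * (fps_const (1 / fact n) * Abs_fps (faa_coeff (?D n) x u J)))"
      by (rule expands_eps_power_mult[OF expands_mult[OF expands_const[OF unif_lip_const] Suc.IH[OF D]]])
  qed simp
  have sum: "expands {t} {p} N
      (\<lambda>e _ _. (\<Sum>n<N. e ^ (Suc J * n) * (1 / fact n * ?D n (?z e))) + e ^ (Suc J * N) * R e)
      (\<lambda>_ _. (\<Sum>n<N. fps_X ^ (Suc J * n) * (fps_const (1 / fact n) * Abs_fps (faa_coeff (?D n) x u J))) + 0)"
    by (intro expands_add expands_sum trm rem)
  show ?case
  proof (rule expands_cong[OF sum])
    show "\<forall>\<^sub>F e in at_right 0. \<forall>t\<in>{t}. \<forall>p\<in>{p}.
       (\<Sum>n<N. e ^ (Suc J * n) * (1 / fact n * ?D n (?z e))) + e ^ (Suc J * N) * R e =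
       F (x + (\<Sum>j = 1..Suc J. e ^ j *\<^sub>R u j))"
      using e3
    proof eventually_elim
      case (elim e)
      have "(\<Sum>n<N. e ^ (Suc J * n) * (1 / fact n * ?D n (?z e))) =
        (\<Sum>n<N. ?D n (?z e) / fact n * (e ^ Suc J) ^ n)"
        by (rule sum.cong) (simp_all only: power_mult, simp add: mult.commute)
      moreover have "e ^ (Suc J * N) * R e = F (?z e + e ^ Suc J *\<^sub>R ?v) -
         (\<Sum>n<N. ?D n (?z e) / fact n * (e ^ Suc J) ^ n)"
        using elim by (simp only: power_mult R_def) (simp del: power_Suc)
      ultimately show ?case by (simp add: add.assoc del: power_Suc)
    qed
  next
    fix i assume i: "i < N"
    have *: "fps_nth (fps_X ^ (Suc J * n) * (fps_const (1 / fact n) * Abs_fps (faa_coeff (?D n) x u J))) i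
       = (if Suc J * n \<le> i then 1 / fact n * faa_coeff (?D n) x u J (i - Suc J * n) else 0)" for n
      by (simp add: fps_X_power_mult_nth del: mult_Suc)
    \<comment> \<open>Coefficient i collects the n with (J + 1) n \<le> i, which is the index set of
      \<open>faa_coeff_Suc\<close>; all of these lie below N because i < N.\<close>
    have "(\<Sum>n<N. if Suc J * n \<le> i then 1 / fact n * faa_coeff (?D n) x u J (i - Suc J * n) else 0)
       = (\<Sum>n | n \<le> i \<and> Suc J * n \<le> i. 1 / fact n * faa_coeff (?D n) x u J (i - Suc J * n))"
    proof (rule sum.mono_neutral_cong_right)
      show "{n. n \<le> i \<and> Suc J * n \<le> i} \<subseteq> {..<N}" using i by auto
      have "n \<le> i" if "Suc J * n \<le> i" for n using that by simp
      then show "\<forall>n\<in>{..<N} - {n. n \<le> i \<and> Suc J * n \<le> i}.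
        (if Suc J * n \<le> i then 1 / fact n * faa_coeff (?D n) x u J (i - Suc J * n) else 0) = 0"
        by auto
    qed auto
    then show "fps_nth ((\<Sum>n<N. fps_X ^ (Suc J * n) * (fps_const (1 / fact n) * Abs_fps (faa_coeff (?D n) x u J))) + 0) i
       = fps_nth (Abs_fps (faa_coeff F x u (Suc J))) i"
      unfolding fps_add_nth fps_sum_nth * by (simp add: faa_coeff_Suc del: mult_Suc)
  qed
qed

section \<open>Expansion of the standard form\<close>

text \<open>Agreement with the series near 0 is also agreement near every z close to 0, so the
  derivatives coincide on a neighbourhood and not just at 0. This allows iteration.\<close>

lemma deriv_has_fps_expansion_real:
  fixes f :: "real \<Rightarrow> real"
  assumes "f has_fps_expansion F"
  shows "deriv f has_fps_expansion fps_deriv F"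
proof -
  have r: "fps_conv_radius F > 0" and ev: "\<forall>\<^sub>F z in nhds 0. eval_fps F z = f z"
    using assms by (auto simp: has_fps_expansion_def)
  have "\<forall>\<^sub>F z in nhds 0. \<forall>\<^sub>F z' in nhds z. eval_fps F z' = f z'"
    using ev by (simp add: eventually_eventually)
  moreover have "\<forall>\<^sub>F z in nhds (0::real). z \<in> eball 0 (fps_conv_radius F)"
    using r by (intro eventually_nhds_in_open) (auto simp: zero_ereal_def)
  ultimately have "\<forall>\<^sub>F z in nhds 0. eval_fps (fps_deriv F) z = deriv f z"
  proof eventually_elim
    case (elim z)
    then have "eval_fps (fps_deriv F) z = deriv (eval_fps F) z"
      by (intro eval_fps_deriv) (simp add: in_eball_iff)
    also have "\<dots> = deriv f z" by (rule deriv_cong_ev) (use elim in auto)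
    finally show ?case .
  qed
  then show ?thesis
    using r fps_conv_radius_deriv[of F] unfolding has_fps_expansion_def by auto
qed

lemma fps_nth_eq_deriv_real:
  fixes f :: "real \<Rightarrow> real"
  assumes "f has_fps_expansion F"
  shows "fps_nth F n = (deriv ^^ n) f 0 / fact n"
proof -
  have "((deriv ^^ n) f) has_fps_expansion ((fps_deriv ^^ n) F)"
    by (induction n) (simp_all add: assms deriv_has_fps_expansion_real)
  then have "\<forall>\<^sub>F z in nhds 0. eval_fps ((fps_deriv ^^ n) F) z = (deriv ^^ n) f z"
    unfolding has_fps_expansion_def by blast
  from eventually_nhds_x_imp_x[OF this] have "(deriv ^^ n) f 0 = fps_nth ((fps_deriv ^^ n) F) 0"
    by (simp add: eval_fps_at_0)
  then show ?thesis by (simp add: fps_0th_higher_deriv)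
qed

definition num_fps :: "'d::finite perturbed \<Rightarrow> 'd option \<Rightarrow> real \<Rightarrow> real ^ 'd option \<Rightarrow> real fps" where
  "num_fps S j \<theta> \<eta> = (\<Sum>i=1..par_k S. fps_X ^ i * fps_const (S_num S i \<theta> \<eta> j))"

definition den_fps :: "'d::finite perturbed \<Rightarrow> real \<Rightarrow> real ^ 'd option \<Rightarrow> real fps" where
  "den_fps S \<theta> \<eta> = fps_const (par_b S * \<eta> $ None) + (\<Sum>i=1..par_k S. fps_X ^ i * fps_const (S_den S i \<theta> \<eta>))"

definition rhs_fps :: "'d::finite perturbed \<Rightarrow> 'd option \<Rightarrow> real \<Rightarrow> real ^ 'd option \<Rightarrow> real fps" where
  "rhs_fps S j \<theta> \<eta> = fps_const (\<eta> $ None) * num_fps S j \<theta> \<eta> * inverse (den_fps S \<theta> \<eta>)"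

lemma den_fps_0: "fps_nth (den_fps S \<theta> \<eta>) 0 = par_b S * \<eta> $ None"
  by (simp add: den_fps_def fps_sum_nth fps_X_power_mult_nth)

lemma num_fps_0: "fps_nth (num_fps S j \<theta> \<eta>) 0 = 0"
  by (simp add: num_fps_def fps_sum_nth fps_X_power_mult_nth)

lemma rhs_fps_0: "fps_nth (rhs_fps S j \<theta> \<eta>) 0 = 0"
  by (simp add: rhs_fps_def num_fps_0)

lemma std_rhs_eq: "std_rhs S \<epsilon> \<theta> \<eta> $ j =
   \<eta> $ None * (\<Sum>i=1..par_k S. \<epsilon> ^ i * S_num S i \<theta> \<eta> j) * inverse (std_den S \<epsilon> \<theta> \<eta>)"
  by (simp add: std_rhs_def divide_inverse)

text \<open>The denominator has the nonzero constant term b R, so the quotient is analytic at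
  \<epsilon> = 0 and its iterated derivatives there are read off a formal quotient.\<close>

lemma F_coeff_eq:
  fixes S :: "'d::finite perturbed"
  assumes "par_b S \<noteq> 0" and "\<eta> $ None > 0"
  shows "F_coeff S i \<theta> \<eta> $ j = fps_nth (rhs_fps S j \<theta> \<eta>) i"
proof -
  have "(\<lambda>\<epsilon>. std_rhs S \<epsilon> \<theta> \<eta> $ j) has_fps_expansion rhs_fps S j \<theta> \<eta>"
    unfolding std_rhs_eq std_den_def rhs_fps_def num_fps_def
    by (intro has_fps_expansion_mult has_fps_expansion_inverse)
       (use assms den_fps_0[of S \<theta> \<eta>] in \<open>auto simp: den_fps_def
          intro!: has_fps_expansion_add has_fps_expansion_sum has_fps_expansion_mult
            has_fps_expansion_fps_X_power\<close>)
  from fps_nth_eq_deriv_real[OF this, of i] show ?thesis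
    by (simp add: F_coeff_def)
qed

lemma separable_polar: "separable (\<lambda>\<theta> \<eta>. polar \<theta> \<eta> $ v)"
proof (cases v)
  case C1
  have "separable (\<lambda>\<theta> (\<eta> :: real ^ 'a option). \<eta> $ None * cos \<theta>)"
    by (intro separable_mult separable_of_laurent laurent_coord separable_of_continuous continuous_intros)
  with C1 show ?thesis by (simp add: polar_def)
next
  case C2
  have "separable (\<lambda>\<theta> (\<eta> :: real ^ 'a option). \<eta> $ None * sin \<theta>)"
    by (intro separable_mult separable_of_laurent laurent_coord separable_of_continuous continuous_intros)
  with C2 show ?thesis by (simp add: polar_def)
next
  case (CS s)
  have "separable (\<lambda>\<theta> (\<eta> :: real ^ 'a option). \<eta> $ Some s)"
    by (intro separable_of_laurent laurent_coord)
  with CS show ?thesis by (simp add: polar_def)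
qed

lemma separable_monomial: "separable (\<lambda>\<theta> \<eta>. monomial \<alpha> (polar \<theta> \<eta>))"
  unfolding monomial_def by (intro separable_prod separable_power separable_polar)

lemma separable_S_num: "separable (\<lambda>\<theta> \<eta>. S_num S i \<theta> \<eta> j)"
proof (cases j)
  case None
  have "separable (\<lambda>\<theta> \<eta>. par_a S i * \<eta> $ None
         + (\<Sum>\<alpha>\<in>multi_indices (par_m S).
              (par_p S C1 \<alpha> (i - 1) * cos \<theta> + par_p S C2 \<alpha> (i - 1) * sin \<theta>)
                * monomial \<alpha> (polar \<theta> \<eta>)))"
    by (intro separable_add separable_sum separable_mult[OF _ separable_monomial] separable_mult[OF separable_const] separable_of_laurent laurent_coord
         separable_of_continuous continuous_intros)
  with None show ?thesis by (simp add: S_num_def)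
next
  case (Some s)
  have "separable (\<lambda>\<theta> \<eta>. par_c S s i * \<eta> $ Some s
         + (\<Sum>\<alpha>\<in>multi_indices (par_m S). par_p S (CS s) \<alpha> (i - 1) * monomial \<alpha> (polar \<theta> \<eta>)))"
    by (intro separable_add separable_sum separable_mult[OF _ separable_monomial] separable_mult[OF separable_const] separable_of_laurent laurent_coord
         separable_const)
  with Some show ?thesis by (simp add: S_num_def)
qed

lemma separable_S_den: "separable (\<lambda>\<theta> \<eta>. S_den S i \<theta> \<eta>)"
  unfolding S_den_def
  by (intro separable_add separable_sum separable_mult[OF _ separable_monomial] separable_mult[OF separable_const] separable_of_laurent laurent_coord
         separable_of_continuous continuous_intros)

lemma separable_fps_mult:
  assumes "\<And>i. separable (\<lambda>\<theta> \<eta>. fps_nth (A \<theta> \<eta>) i)" and "\<And>i. separable (\<lambda>\<theta> \<eta>. fps_nth (B \<theta> \<eta>) i)"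
  shows "separable (\<lambda>\<theta> \<eta>. fps_nth (A \<theta> \<eta> * B \<theta> \<eta> :: real fps) i)"
  unfolding fps_mult_nth by (intro separable_sum separable_mult assms)

lemma separable_fps_X_power_sum:
  assumes "\<And>i. i \<in> I \<Longrightarrow> separable (f i)"
  shows "separable (\<lambda>\<theta> \<eta>. fps_nth (\<Sum>i\<in>I. fps_X ^ i * fps_const (f i \<theta> \<eta>) :: real fps) n)"
proof -
  have "separable (\<lambda>\<theta> \<eta>. \<Sum>i\<in>I. if n = i then f i \<theta> \<eta> else 0)"
  proof (rule separable_sum)
    show "separable (\<lambda>\<theta> \<eta>. if n = i then f i \<theta> \<eta> else 0)" if "i \<in> I" for i
      using assms[OF that] by (cases "n = i") (auto intro: separable_const)
  qed
  moreover have "fps_nth (\<Sum>i\<in>I. fps_X ^ i * fps_const (f i \<theta> \<eta>) :: real fps) n =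
     (\<Sum>i\<in>I. if n = i then f i \<theta> \<eta> else 0)" for \<theta> \<eta>
    unfolding fps_sum_nth by (rule sum.cong) (auto simp: fps_X_power_mult_nth)
  ultimately show ?thesis by simp
qed

text \<open>The recursion for the coefficients of a reciprocal series divides only by the constant
  term b R. Hence only powers of R ever appear as denominators.\<close>

lemma separable_inverse_den_fps:
  assumes "par_b S \<noteq> 0"
  shows "separable (\<lambda>\<theta> \<eta>. fps_nth (inverse (den_fps S \<theta> \<eta>)) n)"
proof (induction n rule: less_induct)
  case (less n)
  have D: "separable (\<lambda>\<theta> \<eta>. fps_nth (den_fps S \<theta> \<eta>) i)" for i
  proof -
    have "separable (\<lambda>\<theta> \<eta>. fps_nth (fps_const (par_b S * \<eta> $ None)) i)"
      using assms by (cases "i = 0") (auto intro!: separable_of_laurent laurent_mult laurent_const laurent_coord)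
    then show ?thesis unfolding den_fps_def fps_add_nth
      by (intro separable_add separable_fps_X_power_sum separable_S_den)
  qed
  have inv: "separable (\<lambda>\<theta> (\<eta> :: real ^ 'a option). inverse (par_b S) * inverse (\<eta> $ None))"
    by (intro separable_of_laurent laurent_mult laurent_const laurent_inv)
  show ?case
  proof (cases "n = 0")
    case True
    with inv show ?thesis by (simp add: den_fps_0 inverse_mult_distrib)
  next
    case False
    have "separable (\<lambda>\<theta> \<eta>. (- 1 * (inverse (par_b S) * inverse (\<eta> $ None))) *
      (\<Sum>i=1..n. fps_nth (den_fps S \<theta> \<eta>) i * fps_nth (inverse (den_fps S \<theta> \<eta>)) (n - i)))"
      by (intro separable_mult[OF separable_mult[OF separable_const inv]] separable_sum separable_mult[OF D less]) (use False in auto)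
    then show ?thesis
      using False by (simp add: fps_inverse_def fps_right_inverse_constructor_rec den_fps_0)
  qed
qed

lemma separable_rhs_fps:
  assumes "par_b S \<noteq> 0"
  shows "separable (\<lambda>\<theta> \<eta>. fps_nth (rhs_fps S j \<theta> \<eta>) n)"
proof -
  have "separable (\<lambda>\<theta> (\<eta> :: real ^ 'a option). fps_nth (fps_const (\<eta> $ None)) i)" for i
    by (cases "i = 0") (auto intro: separable_of_laurent laurent_coord separable_const)
  then show ?thesis
    unfolding rhs_fps_def num_fps_def
    by (intro separable_fps_mult separable_fps_X_power_sum separable_inverse_den_fps assms separable_S_num)
qed

lemma separable_F_coeff:
  assumes "par_b S \<noteq> 0"
  shows "separable (\<lambda>\<theta> \<eta>. F_coeff S i \<theta> \<eta> $ j)"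
  by (rule separable_cong[OF separable_rhs_fps[OF assms]]) (simp add: F_coeff_eq[OF assms])

text \<open>The function differs from its constant coefficient by \<epsilon> times a uniformly
  bounded term. Closeness and lower bound are stated together because different applications need
  one or the other.\<close>

lemma expands_lower_bound:
  assumes "expands T K (Suc n) f A" and "c < c'"
    and "\<And>\<theta> p. \<theta> \<in> T \<Longrightarrow> p \<in> K \<Longrightarrow> c' \<le> \<bar>fps_nth (A \<theta> p) 0\<bar>"
  shows "\<forall>\<^sub>F \<epsilon> in at_right 0. \<forall>\<theta>\<in>T. \<forall>p\<in>K. \<bar>f \<epsilon> \<theta> p - fps_nth (A \<theta> p) 0\<bar> < c' - c \<and> c \<le> \<bar>f \<epsilon> \<theta> p\<bar>"
proof -
  obtain f' where f': "expands T K n f' (\<lambda>\<theta> p. fps_shift 1 (A \<theta> p))"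
    and eq: "\<forall>\<^sub>F \<epsilon> in at_right 0. \<forall>\<theta>\<in>T. \<forall>p\<in>K. f \<epsilon> \<theta> p = fps_nth (A \<theta> p) 0 + \<epsilon> * f' \<epsilon> \<theta> p"
    using assms(1) by auto
  obtain B where B0: "B \<ge> 0" and B: "\<forall>\<^sub>F \<epsilon> in at_right 0. bdd_lip T K B (f' \<epsilon>)"
    using expands_imp_unif_lip[OF f'] by (rule unif_lip_obtain)
  \<comment> \<open>B + 1 instead of B keeps the quotient meaningful when B = 0.\<close>
  have "\<forall>\<^sub>F \<epsilon> in at_right 0. \<epsilon> \<in> {0<..<(c' - c) / (B + 1)}"
    by (rule eventually_at_right_real) (use assms(2) B0 in simp)
  with eq B show ?thesis
  proof eventually_elim
    case (elim \<epsilon>)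
    show ?case
    proof (intro ballI)
      fix \<theta> p assume *: "\<theta> \<in> T" "p \<in> K"
      have \<epsilon>: "\<epsilon> > 0" "\<epsilon> * (B + 1) < c' - c"
        using elim(3) B0 by (auto simp: field_simps)
      have "\<bar>\<epsilon> * f' \<epsilon> \<theta> p\<bar> \<le> \<epsilon> * B"
        using bdd_lipD(1)[OF elim(2) *] \<epsilon>(1) by (simp add: abs_mult)
      then have "\<bar>\<epsilon> * f' \<epsilon> \<theta> p\<bar> < c' - c" using \<epsilon> by (simp add: algebra_simps)
      then show "\<bar>f \<epsilon> \<theta> p - fps_nth (A \<theta> p) 0\<bar> < c' - c \<and> c \<le> \<bar>f \<epsilon> \<theta> p\<bar>"
        using elim(1) * assms(3)[OF *] by auto
    qed
  qed
qed

lemma expands_eps_sum: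
  assumes "\<And>i. i \<in> I \<Longrightarrow> unif_lip T K (\<lambda>_. f i)"
  shows "expands T K n (\<lambda>\<epsilon> \<theta> p. \<Sum>i\<in>I. \<epsilon> ^ i * f i \<theta> p) (\<lambda>\<theta> p. \<Sum>i\<in>I. fps_X ^ i * fps_const (f i \<theta> p))"
  by (intro expands_sum expands_mono[OF le_add2 expands_eps_power_mult] expands_const assms)

lemma expands_std_den:
  assumes "compact T" and "compact K" and "K \<subseteq> {x. x $ None > 0}"
  shows "expands T K n (std_den S) (den_fps S)"
proof -
  have "expands T K n (\<lambda>\<epsilon> \<theta> \<eta>. par_b S * \<eta> $ None + (\<Sum>i=1..par_k S. \<epsilon> ^ i * S_den S i \<theta> \<eta>))
    (\<lambda>\<theta> \<eta>. fps_const (par_b S * \<eta> $ None) + (\<Sum>i=1..par_k S. fps_X ^ i * fps_const (S_den S i \<theta> \<eta>)))"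
    by (intro expands_add expands_const expands_eps_sum unif_lip_mult unif_lip_const unif_lip_coord compact_imp_bounded assms unif_lip_separable[OF separable_S_den])
  then show ?thesis by (simp add: std_den_def[abs_def] den_fps_def[abs_def])
qed

text \<open>On a compact set R is bounded below, so \<bar>b R\<bar> is too; half of that bound is
  given up to the terms of higher order in \<epsilon>.\<close>

lemma std_den_lower_bound:
  assumes "par_b S \<noteq> 0" and "compact T" and "compact K" and "K \<subseteq> {x. x $ None > 0}"
  obtains c where "c > 0" and "\<forall>\<^sub>F \<epsilon> in at_right 0. \<forall>\<theta>\<in>T. \<forall>p\<in>K. c \<le> \<bar>std_den S \<epsilon> \<theta> p\<bar>"
    and "\<forall>\<theta>. \<forall>p\<in>K. c \<le> \<bar>fps_nth (den_fps S \<theta> p) 0\<bar>"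
proof -
  obtain c where "c > 0" and c: "\<And>x. x \<in> K \<Longrightarrow> c \<le> x $ None"
    using compact_halfspace_lower_bound[OF assms(3,4)] by blast
  have *: "\<bar>par_b S\<bar> * c \<le> \<bar>fps_nth (den_fps S \<theta> p) 0\<bar>" if "p \<in> K" for \<theta> p
    using c[OF that] \<open>c > 0\<close> by (simp add: den_fps_0 abs_mult mult_left_mono)
  have pos: "\<bar>par_b S\<bar> * c > 0" using assms(1) \<open>c > 0\<close> by simp
  show ?thesis
  proof (rule that[of "\<bar>par_b S\<bar> * c / 2"])
    show "\<forall>\<^sub>F \<epsilon> in at_right 0. \<forall>\<theta>\<in>T. \<forall>p\<in>K. \<bar>par_b S\<bar> * c / 2 \<le> \<bar>std_den S \<epsilon> \<theta> p\<bar>"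
    proof -
      have "\<bar>par_b S\<bar> * c / 2 < \<bar>par_b S\<bar> * c" using pos by linarith
      from expands_lower_bound[OF expands_std_den[OF assms(2-4), where S = S and n = "Suc 0"] this *]
      show ?thesis by (rule eventually_mono) (auto intro: less_imp_le)
    qed
    show "\<forall>\<theta>. \<forall>p\<in>K. \<bar>par_b S\<bar> * c / 2 \<le> \<bar>fps_nth (den_fps S \<theta> p) 0\<bar>"
    proof (intro allI ballI)
      fix \<theta> p assume "p \<in> K"
      from *[OF this, of \<theta>] pos show "\<bar>par_b S\<bar> * c / 2 \<le> \<bar>fps_nth (den_fps S \<theta> p) 0\<bar>"
        by linarith
    qed
  qed (use pos in simp)
qed

lemma expands_std_rhs:
  assumes "par_b S \<noteq> 0" and "compact T" and "compact K" and "K \<subseteq> {x. x $ None > 0}"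
  shows "expands T K n (\<lambda>\<epsilon> \<theta> \<eta>. std_rhs S \<epsilon> \<theta> \<eta> $ j) (rhs_fps S j)"
proof -
  obtain c where c: "c > 0" "\<forall>\<^sub>F \<epsilon> in at_right 0. \<forall>\<theta>\<in>T. \<forall>p\<in>K. c \<le> \<bar>std_den S \<epsilon> \<theta> p\<bar>"
    "\<forall>\<theta>. \<forall>p\<in>K. c \<le> \<bar>fps_nth (den_fps S \<theta> p) 0\<bar>"
    by (rule std_den_lower_bound[OF assms]) blast
  show ?thesis
    unfolding std_rhs_eq rhs_fps_def[abs_def] num_fps_def
    by (intro expands_mult expands_eps_sum expands_const expands_inverse[OF expands_std_den[OF assms(2-4)] c(1)] c(2) c(3)[rule_format]
          unif_lip_coord compact_imp_bounded assms unif_lip_separable[OF separable_S_num])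
qed

section \<open>The averaged functions\<close>

definition y_integrand :: "'d::finite perturbed \<Rightarrow> nat \<Rightarrow> real \<Rightarrow> real ^ 'd option \<Rightarrow> real ^ 'd option" where
  "y_integrand S i \<tau> \<eta> = F_coeff S i \<tau> \<eta>
     + (\<Sum>l=1..i-1. \<Sum>\<beta>\<in>beta_tuples l.
          (1 / (\<Prod>j=1..l. fact (\<beta> j) * fact j ^ \<beta> j)) *\<^sub>R
            frechet_iter (F_coeff S (i - l) \<tau>)
              (concat (map (\<lambda>j. replicate (\<beta> j) (y_avg S j \<tau> \<eta>)) [1..<Suc l])) \<eta>)"

lemma y_avg_eq: "y_avg S i \<theta> \<eta> = fact i *\<^sub>R integral {0..\<theta>} (\<lambda>\<tau>. y_integrand S i \<tau> \<eta>)"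
  unfolding y_integrand_def by (rule y_avg.simps)

lemma y_integrand_component:
  assumes "par_b S \<noteq> 0" and "\<eta> $ None > 0"
  shows "y_integrand S i \<tau> \<eta> $ s = F_coeff S i \<tau> \<eta> $ s
     + (\<Sum>l=1..i-1. \<Sum>\<beta>\<in>beta_tuples l.
          (1 / (\<Prod>j=1..l. fact (\<beta> j) * fact j ^ \<beta> j)) *
            frechet_iter (\<lambda>\<eta>. F_coeff S (i - l) \<tau> \<eta> $ s)
              (concat (map (\<lambda>j. replicate (\<beta> j) (y_avg S j \<tau> \<eta>)) [1..<Suc l])) \<eta>)"
  by (simp add: y_integrand_def frechet_iter_component[OF separable_imp_laurent[OF separable_F_coeff[OF assms(1)]] assms(2)]
      del: upt_Suc)

text \<open>Only y_j with j \<le> l \<le> i - 1 enter the recursion, so the claim for smaller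
  indices suffices and can serve as the step of a strong induction.\<close>

lemma separable_y_integrand_step:
  assumes "par_b S \<noteq> 0" and "\<And>j s. j < i \<Longrightarrow> separable (\<lambda>\<theta> \<eta>. y_avg S j \<theta> \<eta> $ s)"
  shows "separable (\<lambda>\<theta> \<eta>. y_integrand S i \<theta> \<eta> $ s)"
proof -
  have "separable (\<lambda>\<tau> \<eta>. frechet_iter (\<lambda>\<eta>. F_coeff S (i - l) \<tau> \<eta> $ s)
              (concat (map (\<lambda>j. replicate (\<beta> j) (y_avg S j \<tau> \<eta>)) [1..<Suc l])) \<eta>)"
    if "l \<in> {1..i-1}" for l \<beta>
  proof -
    let ?ws = "concat (map (\<lambda>j. replicate (\<beta> j) (y_avg S j)) [1..<Suc l])"
    have "separable (\<lambda>\<tau> \<eta>. frechet_iter (\<lambda>\<eta>. F_coeff S (i - l) \<tau> \<eta> $ s) (map (\<lambda>w. w \<tau> \<eta>) ?ws) \<eta>)"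
    proof (rule separable_frechet_iter[OF separable_F_coeff[OF assms(1)]])
      fix w s assume "w \<in> set ?ws"
      then obtain j where "w = y_avg S j" "j \<in> {1..<Suc l}" by (auto simp del: upt_Suc)
      then show "separable (\<lambda>\<theta> \<eta>. w \<theta> \<eta> $ s)" using assms(2)[of j] that by auto
    qed
    then show ?thesis by (simp add: map_concat comp_def del: upt_Suc)
  qed
  then have "separable (\<lambda>\<tau> \<eta>. F_coeff S i \<tau> \<eta> $ s
     + (\<Sum>l=1..i-1. \<Sum>\<beta>\<in>beta_tuples l.
          (1 / (\<Prod>j=1..l. fact (\<beta> j) * fact j ^ \<beta> j)) *
            frechet_iter (\<lambda>\<eta>. F_coeff S (i - l) \<tau> \<eta> $ s)
              (concat (map (\<lambda>j. replicate (\<beta> j) (y_avg S j \<tau> \<eta>)) [1..<Suc l])) \<eta>))"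
    by (intro separable_add separable_F_coeff[OF assms(1)] separable_sum separable_mult[OF separable_const])
  then show ?thesis
    by (rule separable_cong) (simp only: y_integrand_component[OF assms(1)])
qed

lemma continuous_on_separable_vec:
  fixes f :: "real \<Rightarrow> real ^ 'd::finite option \<Rightarrow> real ^ 'n"
  assumes "\<And>s. separable (\<lambda>\<theta> \<eta>. f \<theta> \<eta> $ s)" and "\<eta> $ None > 0"
  shows "continuous_on A (\<lambda>\<theta>. f \<theta> \<eta>)"
proof -
  have "continuous_on A (\<lambda>\<theta>. \<chi> s. f \<theta> \<eta> $ s)"
    by (intro continuous_intros separable_continuous_time[OF assms(1)] assms(2))
  then show ?thesis by simp
qed

lemma separable_y_avg:
  assumes "par_b S \<noteq> 0"
  shows "separable (\<lambda>\<theta> \<eta>. y_avg S i \<theta> \<eta> $ s)"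
proof (induction i arbitrary: s rule: less_induct)
  case (less i)
  have I: "separable (\<lambda>\<theta> \<eta>. y_integrand S i \<theta> \<eta> $ s)" for s
    by (rule separable_y_integrand_step[OF assms less])
  have "separable (\<lambda>\<theta> \<eta>. fact i * integral {0..\<theta>} (\<lambda>\<tau>. y_integrand S i \<tau> \<eta> $ s))"
    by (intro separable_mult[OF separable_const] separable_integral I)
  then show ?case
  proof (rule separable_cong)
    fix \<theta> and \<eta> :: "real ^ 'a option" assume "\<eta> $ None > 0"
    then have "(\<lambda>\<tau>. y_integrand S i \<tau> \<eta>) integrable_on {0..\<theta>}"
      by (intro integrable_continuous_interval continuous_on_separable_vec I)
    then show "fact i * integral {0..\<theta>} (\<lambda>\<tau>. y_integrand S i \<tau> \<eta> $ s) = y_avg S i \<theta> \<eta> $ s"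
      by (simp add: y_avg_eq)
  qed
qed

lemma separable_y_integrand:
  assumes "par_b S \<noteq> 0"
  shows "separable (\<lambda>\<theta> \<eta>. y_integrand S i \<theta> \<eta> $ s)"
  by (rule separable_y_integrand_step[OF assms separable_y_avg[OF assms]])

lemma y_avg_has_vector_derivative:
  assumes "par_b S \<noteq> 0" and "\<eta> $ None > 0" and "\<theta> \<in> {0..b}"
  shows "((\<lambda>\<theta>. y_avg S i \<theta> \<eta>) has_vector_derivative fact i *\<^sub>R y_integrand S i \<theta> \<eta>) (at \<theta> within {0..b})"
  unfolding y_avg_eq
  by (intro bounded_linear.has_vector_derivative[OF bounded_linear_scaleR_right] integral_has_vector_derivative continuous_on_separable_vec
        separable_y_integrand assms)

lemma y_avg_0: "y_avg S i 0 \<eta> = 0"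
  by (simp add: y_avg_eq)

lemma frechet_iter_cmult:
  "laurent g \<Longrightarrow> x $ None > 0 \<Longrightarrow> frechet_iter (\<lambda>x. c * g x) vs x = c * frechet_iter g vs x"
  using frechet_iter_sum[of "{()}" "\<lambda>_. g" x "\<lambda>_. c" vs] by simp

lemma frechet_iter_replicate_scale:
  assumes "laurent g" and "x $ None > 0"
  shows "frechet_iter g (replicate n (c *\<^sub>R v)) x = c ^ n * frechet_iter g (replicate n v) x"
  using assms(2)
proof (induction n arbitrary: x)
  case (Suc n)
  let ?h = "frechet_iter g (replicate n v)"
  have "frechet_derivative (frechet_iter g (replicate n (c *\<^sub>R v))) (at x) =
        frechet_derivative (\<lambda>x. c ^ n * ?h x) (at x)"
    by (rule frechet_derivative_cong_halfspace) (use Suc in auto)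
  moreover have "frechet_derivative (\<lambda>x. c ^ n * ?h x) (at x) w = c ^ n * frechet_derivative ?h (at x) w" for w
    using frechet_iter_cmult[OF laurent_frechet_iter[OF assms(1)] Suc.prems, of "c ^ n" _ "[w]"]
    by (simp add: frechet_iter_Nil)
  moreover have "linear (frechet_derivative ?h (at x))"
    using laurent_differentiable[OF laurent_frechet_iter[OF assms(1)] Suc.prems] linear_frechet_derivative by blast
  ultimately show ?case by (simp add: linear_scale)
qed simp

lemma frechet_iter_concat_scale:
  assumes "laurent g" and "x $ None > 0"
  shows "frechet_iter g (concat (map (\<lambda>j. replicate (\<beta> j) (c j *\<^sub>R v j)) js)) x =
    prod_list (map (\<lambda>j. c j ^ \<beta> j) js) * frechet_iter g (concat (map (\<lambda>j. replicate (\<beta> j) (v j)) js)) x"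
  using assms(2)
proof (induction js arbitrary: x)
  case (Cons j js)
  let ?L = "concat (map (\<lambda>j. replicate (\<beta> j) (c j *\<^sub>R v j)) js)"
  let ?M = "concat (map (\<lambda>j. replicate (\<beta> j) (v j)) js)"
  let ?p = "prod_list (map (\<lambda>j. c j ^ \<beta> j) js)"
  have "frechet_iter (frechet_iter g ?L) (replicate (\<beta> j) (c j *\<^sub>R v j)) x =
     frechet_iter (\<lambda>x. ?p * frechet_iter g ?M x) (replicate (\<beta> j) (c j *\<^sub>R v j)) x"
    by (rule frechet_iter_cong_halfspace) (use Cons in auto)
  also have "\<dots> = ?p * (c j ^ \<beta> j * frechet_iter (frechet_iter g ?M) (replicate (\<beta> j) (v j)) x)"
    using assms(1) Cons.prems
    by (simp add: frechet_iter_cmult frechet_iter_replicate_scale laurent_frechet_iter)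
  finally show ?case by (simp add: frechet_iter_append)
qed simp

text \<open>Multilinearity moves the factors j! into the directions, which turns the weights of the
  recursion into those of \<open>faa_coeff\<close>. The separate summand F_i becomes the term l =
  0.\<close>

lemma y_integrand_faa:
  fixes S :: "'d::finite perturbed"
  assumes "par_b S \<noteq> 0" and "\<eta> $ None > 0" and "i \<ge> 1"
  shows "y_integrand S i \<tau> \<eta> $ s = (\<Sum>l<i. faa_coeff (\<lambda>\<eta>. F_coeff S (i - l) \<tau> \<eta> $ s) \<eta>
      (\<lambda>j. (1 / fact j) *\<^sub>R y_avg S j \<tau> \<eta>) l l)"
proof -
  have *: "(\<Sum>\<beta>\<in>beta_tuples l. (1 / (\<Prod>j=1..l. fact (\<beta> j) * fact j ^ \<beta> j)) *
            frechet_iter (\<lambda>\<eta>. F_coeff S (i - l) \<tau> \<eta> $ s)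
              (concat (map (\<lambda>j. replicate (\<beta> j) (y_avg S j \<tau> \<eta>)) [1..<Suc l])) \<eta>)
      = faa_coeff (\<lambda>\<eta>. F_coeff S (i - l) \<tau> \<eta> $ s) \<eta> (\<lambda>j. (1 / fact j) *\<^sub>R y_avg S j \<tau> \<eta>) l l" for l
  proof -
    have t: "beta_tuples l = weighted_tuples l l" by (simp add: beta_tuples_def weighted_tuples_def)
    have p: "prod_list (map (\<lambda>j. (1 / fact j) ^ \<beta> j) [1..<Suc l]) = (\<Prod>j=1..l. (1 / fact j :: real) ^ \<beta> j)"
      for \<beta> :: "nat \<Rightarrow> nat"
      using prod.distinct_set_conv_list[of "[1..<Suc l]" "\<lambda>j. (1 / fact j :: real) ^ \<beta> j"]
      by (simp del: upt_Suc add: atLeastLessThanSuc_atLeastAtMost)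
    show ?thesis
      unfolding faa_coeff_def t
      by (subst frechet_iter_concat_scale[OF separable_imp_laurent[OF separable_F_coeff[OF assms(1)]] assms(2)])
         (simp only: p, simp add: prod.distrib power_one_over prod_dividef del: upt_Suc)
  qed
  have "{..<i} = insert 0 {1..i-1}" using assms(3) by auto
  then show ?thesis
    unfolding y_integrand_component[OF assms(1,2)] *
    by (simp add: faa_coeff_0)
qed

section \<open>Expansion along the approximate solution\<close>

text \<open>
  The second component \<open>v\<close> of the parameter \<open>p = (\<eta>, v)\<close> is the unknown correction of order \<open>\<epsilon>\<^sup>k\<close>; treating it as
  a further parameter yields the Lipschitz dependence of the remainder on \<open>v\<close>.
\<close>

definition correction ::
    "'d::finite perturbed \<Rightarrow> real \<Rightarrow> (real ^ 'd option) \<times> (real ^ 'd option) \<Rightarrow> nat \<Rightarrow> real ^ 'd option" where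
  "correction S \<theta> p i = (1 / fact i) *\<^sub>R y_avg S i \<theta> (fst p) + (if i = par_k S then snd p else 0)"

definition approx ::
    "'d::finite perturbed \<Rightarrow> real \<Rightarrow> real \<Rightarrow> (real ^ 'd option) \<times> (real ^ 'd option) \<Rightarrow> real ^ 'd option" where
  "approx S \<epsilon> \<theta> p = fst p + (\<Sum>i=1..par_k S. \<epsilon> ^ i *\<^sub>R correction S \<theta> p i)"

lemma unif_lip_fst:
  assumes "unif_lip T K h"
  shows "unif_lip T (K \<times> V) (\<lambda>e t p. h e t (fst p))"
proof -
  obtain B where "\<forall>\<^sub>F e in at_right 0. bdd_lip T K B (h e)"
    using assms by (rule unif_lip_obtain)
  then have "\<forall>\<^sub>F e in at_right 0. bdd_lip T (K \<times> V) B (\<lambda>t p. h e t (fst p))"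
  proof eventually_elim
    case (elim e)
    show ?case
    proof (rule bdd_lipI)
      fix t p q assume t: "t \<in> T" and p: "p \<in> K \<times> V"
      then have K: "fst p \<in> K" by auto
      show "\<bar>h e t (fst p)\<bar> \<le> B" by (rule bdd_lipD(1)[OF elim t K])
      assume "q \<in> K \<times> V"
      then have "\<bar>h e t (fst p) - h e t (fst q)\<bar> \<le> B * dist (fst p) (fst q)"
        by (intro bdd_lipD(3)[OF elim t K]) auto
      also have "\<dots> \<le> B * dist p q"
        by (intro mult_left_mono dist_fst_le bdd_lipD(2)[OF elim t K])
      finally show "\<bar>h e t (fst p) - h e t (fst q)\<bar> \<le> B * dist p q" .
    qed
  qed
  then show ?thesis unfolding unif_lip_def by blast
qed

lemma unif_lip_snd_coord:
  fixes V :: "(real ^ 'n) set" and K :: "'a::metric_space set"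
  assumes "bounded V"
  shows "unif_lip T (K \<times> V) (\<lambda>_ _ p. snd p $ s)"
proof -
  obtain B where B: "\<And>x. x \<in> V \<Longrightarrow> norm x \<le> B"
    using assms bounded_iff by blast
  show ?thesis
  proof (rule unif_lip_Lipschitz[of _ _ B 1])
    show "\<bar>snd p $ s\<bar> \<le> B" if "p \<in> K \<times> V" for p
      using that B[of "snd p"] component_le_norm_cart[of "snd p" s] by auto
    show "\<bar>snd p $ s - snd q $ s\<bar> \<le> 1 * dist p q" for p q :: "'a \<times> (real ^ 'n)"
      using component_le_norm_cart[of "snd p - snd q" s] dist_snd_le[of p q]
      by (simp add: dist_norm)
  qed
qed

lemma norm_le_card_bound:
  fixes x :: "real ^ 'n"
  assumes "\<And>s. \<bar>x $ s\<bar> \<le> c"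
  shows "norm x \<le> real CARD('n) * c"
  using norm_le_l1_cart[of x] sum_bounded_above[of UNIV "\<lambda>s. \<bar>x $ s\<bar>" c] assms by simp

lemma unif_lip_components_bounds:
  fixes h :: "'n::finite \<Rightarrow> real \<Rightarrow> 'q \<Rightarrow> 'p::metric_space \<Rightarrow> real"
  assumes "\<And>s. unif_lip T K (h s)"
  obtains B where "\<And>s. B s \<ge> 0" and "\<forall>\<^sub>F e in at_right 0. \<forall>s. bdd_lip T K (B s) (h s e)"
proof -
  have "\<forall>s. \<exists>B\<ge>0. \<forall>\<^sub>F e in at_right 0. bdd_lip T K B (h s e)"
    using unif_lip_obtain[OF assms] by blast
  from choice[OF this] obtain B where "\<And>s. B s \<ge> 0" and
    B: "\<And>s. \<forall>\<^sub>F e in at_right 0. bdd_lip T K (B s) (h s e)" by blast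
  then show ?thesis by (intro that[of B] eventually_all_finite)
qed

lemma unif_lip_vec:
  fixes Y :: "real \<Rightarrow> 'q \<Rightarrow> 'p::metric_space \<Rightarrow> real ^ 'n"
  assumes "\<And>s. unif_lip T K (\<lambda>e t p. Y e t p $ s)"
  obtains B where "B \<ge> 0" and "\<forall>\<^sub>F e in at_right 0. \<forall>t\<in>T. \<forall>p\<in>K. norm (Y e t p) \<le> B \<and>
    (\<forall>q\<in>K. dist (Y e t p) (Y e t q) \<le> B * dist p q)"
proof -
  obtain B where B0: "\<And>s. B s \<ge> 0"
    and B: "\<forall>\<^sub>F e in at_right 0. \<forall>s. bdd_lip T K (B s) (\<lambda>t p. Y e t p $ s)"
    using unif_lip_components_bounds[of T K "\<lambda>s e t p. Y e t p $ s", OF assms] by blast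
  show ?thesis
  proof (rule that[of "sum B UNIV"])
    show "sum B UNIV \<ge> 0" by (simp add: B0 sum_nonneg)
    show "\<forall>\<^sub>F e in at_right 0. \<forall>t\<in>T. \<forall>p\<in>K. norm (Y e t p) \<le> sum B UNIV \<and>
      (\<forall>q\<in>K. dist (Y e t p) (Y e t q) \<le> sum B UNIV * dist p q)"
      using B
    proof eventually_elim
      case (elim e)
      show ?case
      proof (intro ballI conjI)
        fix t p assume *: "t \<in> T" "p \<in> K"
        note b = bdd_lipD[OF spec[OF elim] *]
        show "norm (Y e t p) \<le> sum B UNIV"
          by (rule order_trans[OF norm_le_l1_cart sum_mono]) (rule b(1))
        fix q assume q: "q \<in> K"
        have "dist (Y e t p) (Y e t q) \<le> (\<Sum>s\<in>UNIV. B s * dist p q)"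
          unfolding dist_norm[of "Y e t p"]
          by (rule order_trans[OF norm_le_l1_cart sum_mono]) (use b(3)[OF q] in simp)
        then show "dist (Y e t p) (Y e t q) \<le> sum B UNIV * dist p q"
          by (simp add: sum_distrib_right)
      qed
    qed
  qed
qed

text \<open>The composite is bounded by B and has Lipschitz modulus B C, hence the maximum.\<close>

lemma unif_lip_compose:
  fixes Y :: "real \<Rightarrow> 'q \<Rightarrow> 'p::metric_space \<Rightarrow> real ^ 'n"
  assumes "unif_lip T K' h" and "\<And>s. unif_lip T K (\<lambda>e t p. Y e t p $ s)"
    and "\<forall>\<^sub>F e in at_right 0. \<forall>t\<in>T. \<forall>p\<in>K. Y e t p \<in> K'"
  shows "unif_lip T K (\<lambda>e t p. h e t (Y e t p))"
proof -
  obtain B where B: "\<forall>\<^sub>F e in at_right 0. bdd_lip T K' B (h e)"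
    using assms(1) by (rule unif_lip_obtain)
  obtain C where C: "\<forall>\<^sub>F e in at_right 0. \<forall>t\<in>T. \<forall>p\<in>K. norm (Y e t p) \<le> C \<and>
    (\<forall>q\<in>K. dist (Y e t p) (Y e t q) \<le> C * dist p q)"
    using unif_lip_vec[of T K Y, OF assms(2)] by blast
  from B C assms(3) have "\<forall>\<^sub>F e in at_right 0. bdd_lip T K (max B (B * C)) (\<lambda>t p. h e t (Y e t p))"
  proof eventually_elim
    case (elim e)
    show ?case
    proof (rule bdd_lipI)
      fix t p q assume *: "t \<in> T" "p \<in> K"
      then have Y: "Y e t p \<in> K'" using elim(3) by blast
      note h = bdd_lipD[OF elim(1) *(1) Y]
      show "\<bar>h e t (Y e t p)\<bar> \<le> max B (B * C)" using h(1) by simp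
      assume q: "q \<in> K"
      have "\<bar>h e t (Y e t p) - h e t (Y e t q)\<bar> \<le> B * dist (Y e t p) (Y e t q)"
        using elim(3) * q by (intro h(3)) blast
      also have "\<dots> \<le> B * (C * dist p q)"
        using elim(2) * q h(2) by (intro mult_left_mono) auto
      also have "\<dots> \<le> max B (B * C) * dist p q"
        unfolding mult.assoc[symmetric] by (rule mult_right_mono) auto
      finally show "\<bar>h e t (Y e t p) - h e t (Y e t q)\<bar> \<le> max B (B * C) * dist p q" .
    qed
  qed
  then show ?thesis unfolding unif_lip_def by blast
qed

lemma expands_approx:
  assumes "par_b S \<noteq> 0" and "compact T" and "compact K" and "K \<subseteq> {x. x $ None > 0}" and "bounded V"
  shows "expands T (K \<times> V) n (\<lambda>\<epsilon> \<theta> p. approx S \<epsilon> \<theta> p $ s)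
     (\<lambda>\<theta> p. fps_const (fst p $ s) + (\<Sum>i=1..par_k S. fps_X ^ i * fps_const (correction S \<theta> p i $ s)))"
proof -
  have y: "unif_lip T (K \<times> V) (\<lambda>_ \<theta> p. y_avg S i \<theta> (fst p) $ s)" for i
    by (rule unif_lip_fst[OF unif_lip_separable[OF separable_y_avg[OF assms(1)] assms(2-4)], of V])
  have "unif_lip T (K \<times> V) (\<lambda>_ \<theta> p. if i = par_k S then snd p $ s else 0)" for i
    by (cases "i = par_k S") (auto intro: unif_lip_const unif_lip_snd_coord assms)
  then have "unif_lip T (K \<times> V) (\<lambda>_ \<theta> p. (1 / fact i) * y_avg S i \<theta> (fst p) $ s + (if i = par_k S then snd p $ s else 0))" for i
    by (intro unif_lip_add unif_lip_mult unif_lip_const y)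
  moreover have "correction S \<theta> p i $ s = (1 / fact i) * y_avg S i \<theta> (fst p) $ s + (if i = par_k S then snd p $ s else 0)" for \<theta> p i
    by (simp add: correction_def)
  ultimately have c: "unif_lip T (K \<times> V) (\<lambda>_ \<theta> p. correction S \<theta> p i $ s)" for i
    by (simp only:)
  have f: "unif_lip T (K \<times> V) (\<lambda>_ \<theta> p. fst p $ s)"
    by (rule unif_lip_fst[OF unif_lip_coord[OF compact_imp_bounded[OF assms(3)]]])
  show ?thesis
    unfolding approx_def vector_add_component sum_component vector_scaleR_component real_scaleR_def
    by (intro expands_add expands_const expands_eps_sum c f)
qed

lemma approx_close:
  assumes "par_b S \<noteq> 0" and "compact T" and "compact K" and "K \<subseteq> {x. x $ None > 0}" and "bounded V"
    and "r > 0"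
  shows "\<forall>\<^sub>F \<epsilon> in at_right 0. \<forall>\<theta>\<in>T. \<forall>p\<in>K \<times> V. norm (approx S \<epsilon> \<theta> p - fst p) < r"
proof -
  define c where "c = real CARD('a option)"
  have c: "c > 0" by (simp add: c_def card_gt_0_iff)
  have "\<forall>\<^sub>F \<epsilon> in at_right 0. \<forall>s. \<forall>\<theta>\<in>T. \<forall>p\<in>K \<times> V. \<bar>approx S \<epsilon> \<theta> p $ s - fst p $ s\<bar> < r / (2 * c)"
  proof (rule eventually_all_finite)
    fix s
    have z: "fps_nth (fps_const (fst p $ s) + (\<Sum>i=1..par_k S. fps_X ^ i * fps_const (correction S \<theta> p i $ s))) 0 = fst p $ s"
      for \<theta> p by (simp add: fps_sum_nth fps_X_power_mult_nth)
    \<comment> \<open>With a negative c and c' = 0 the lower bound on the coefficient is trivial;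
      only the closeness part is extracted.\<close>
    from expands_lower_bound[OF expands_approx[OF assms(1-5), of "Suc 0" s], of "- (r / (2 * c))" 0]
    show "\<forall>\<^sub>F \<epsilon> in at_right 0. \<forall>\<theta>\<in>T. \<forall>p\<in>K \<times> V. \<bar>approx S \<epsilon> \<theta> p $ s - fst p $ s\<bar> < r / (2 * c)"
      unfolding z using assms(6) c by (auto elim!: eventually_mono)
  qed
  then show ?thesis
  proof eventually_elim
    case (elim \<epsilon>)
    show ?case
    proof (intro ballI)
      fix \<theta> p assume "\<theta> \<in> T" "p \<in> K \<times> V"
      then have "norm (approx S \<epsilon> \<theta> p - fst p) \<le> c * (r / (2 * c))"
        using elim by (unfold c_def, intro norm_le_card_bound less_imp_le, unfold vector_minus_component) blast
      then show "norm (approx S \<epsilon> \<theta> p - fst p) < r" using c assms(6) by simp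
    qed
  qed
qed

text \<open>At a fixed \<theta> and p, \<open>approx\<close> is a polynomial path in \<epsilon>.
  Uniqueness of coefficients transfers its explicit expansion to the unspecified uniform
  one.\<close>

lemma F_coeff_approx_coeff:
  assumes "par_b S \<noteq> 0" and "fst p $ None > 0"
    and "expands {\<theta>} {p} n (\<lambda>\<epsilon> \<theta> p. F_coeff S i \<theta> (approx S \<epsilon> \<theta> p) $ s) B" and "l < n"
  shows "fps_nth (B \<theta> p) l = faa_coeff (\<lambda>\<eta>. F_coeff S i \<theta> \<eta> $ s) (fst p) (correction S \<theta> p) (par_k S) l"
proof -
  have "expands {\<theta>} {p} n (\<lambda>\<epsilon> \<theta> p. F_coeff S i \<theta> (approx S \<epsilon> \<theta> p) $ s)
     (\<lambda>_ _. Abs_fps (faa_coeff (\<lambda>\<eta>. F_coeff S i \<theta> \<eta> $ s) (fst p) (correction S \<theta> p) (par_k S)))"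
    by (rule expands_cong[OF expands_path[OF separable_imp_laurent[OF separable_F_coeff[OF assms(1)]] assms(2)]])
       (auto simp: approx_def intro: always_eventually)
  from expands_unique[OF assms(3) this assms(4)] show ?thesis by simp
qed

text \<open>Two expansions are nested: \<open>std_rhs\<close> in \<epsilon> at a fixed state, and
  then each F_i along \<open>approx\<close>. The gap between r and r' leaves room for
  \<open>approx\<close>, so the remainder of the first expansion may be evaluated there.\<close>

lemma averaging_expansion_component:
  assumes "par_b S \<noteq> 0" and "compact T" and "r < r'" and "cball x r' \<subseteq> {x. x $ None > 0}" and "bounded V"
  shows "\<exists>\<rho>. unif_lip T (cball x r \<times> V) \<rho> \<and>
    (\<forall>\<^sub>F \<epsilon> in at_right 0. \<forall>\<theta>\<in>T. \<forall>p\<in>cball x r \<times> V.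
       std_rhs S \<epsilon> \<theta> (approx S \<epsilon> \<theta> p) $ s =
         (\<Sum>l=1..par_k S. \<epsilon> ^ l * y_integrand S l \<theta> (fst p) $ s) + \<epsilon> ^ Suc (par_k S) * \<rho> \<epsilon> \<theta> p)"
proof -
  let ?k = "par_k S" and ?K = "cball x r \<times> V" and ?Y = "approx S"
  have sub: "cball x r \<subseteq> cball x r'" using assms(3) by auto
  then have sub0: "cball x r \<subseteq> {x. x $ None > 0}" using assms(4) by blast
  note Yh = expands_approx[OF assms(1,2) compact_cball sub0 assms(5)]
  have Yin: "\<forall>\<^sub>F \<epsilon> in at_right 0. \<forall>\<theta>\<in>T. \<forall>p\<in>?K. ?Y \<epsilon> \<theta> p \<in> cball x r'"
  proof (rule eventually_mono)
    show "\<forall>\<^sub>F \<epsilon> in at_right 0. \<forall>\<theta>\<in>T. \<forall>p\<in>?K. norm (?Y \<epsilon> \<theta> p - fst p) < r' - r"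
      by (rule approx_close[OF assms(1,2) compact_cball sub0 assms(5)]) (use assms(3) in simp)
  next
    fix \<epsilon> assume *: "\<forall>\<theta>\<in>T. \<forall>p\<in>?K. norm (?Y \<epsilon> \<theta> p - fst p) < r' - r"
    show "\<forall>\<theta>\<in>T. \<forall>p\<in>?K. ?Y \<epsilon> \<theta> p \<in> cball x r'"
    proof (intro ballI)
      fix \<theta> p assume "\<theta> \<in> T" and p: "p \<in> ?K"
      then have "dist (fst p) (?Y \<epsilon> \<theta> p) < r' - r"
        using * unfolding dist_norm by (metis norm_minus_commute)
      moreover have "dist x (fst p) \<le> r" using p by auto
      ultimately show "?Y \<epsilon> \<theta> p \<in> cball x r'" using dist_triangle[of x "?Y \<epsilon> \<theta> p" "fst p"] by simp
    qed
  qed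
  obtain c where c: "c > 0" "\<And>y. y \<in> cball x r' \<Longrightarrow> c \<le> y $ None"
    using compact_halfspace_lower_bound[OF compact_cball assms(4)] by blast
  \<comment> \<open>The remainder is controlled on the larger ball, as a function of an arbitrary
    state; composing it with \<open>approx\<close> keeps it bounded and Lipschitz in (\<eta>,
    v).\<close>
  obtain h where h: "unif_lip T (cball x r') h"
    and eqh: "\<forall>\<^sub>F \<epsilon> in at_right 0. \<forall>\<theta>\<in>T. \<forall>\<eta>\<in>cball x r'. std_rhs S \<epsilon> \<theta> \<eta> $ s =
       (\<Sum>i<Suc ?k. fps_nth (rhs_fps S s \<theta> \<eta>) i * \<epsilon> ^ i) + \<epsilon> ^ Suc ?k * h \<epsilon> \<theta> \<eta>"
    using expands_remainder[OF expands_std_rhs[OF assms(1,2) compact_cball assms(4), of "Suc ?k" s]] by blast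
  have hY: "unif_lip T ?K (\<lambda>\<epsilon> \<theta> p. h \<epsilon> \<theta> (?Y \<epsilon> \<theta> p))"
    by (rule unif_lip_compose[OF h expands_imp_unif_lip[OF Yh] Yin])
  have "\<forall>i. \<exists>B. expands T ?K (Suc ?k) (\<lambda>\<epsilon> \<theta> p. F_coeff S i \<theta> (?Y \<epsilon> \<theta> p) $ s) B"
  proof (rule allI, rule expands_compose_separable[OF separable_F_coeff[OF assms(1)] assms(2) Yh c(1)])
    show "\<forall>\<^sub>F \<epsilon> in at_right 0. \<forall>\<theta>\<in>T. \<forall>p\<in>?K. c \<le> ?Y \<epsilon> \<theta> p $ None"
      using Yin by (rule eventually_mono) (blast intro: c(2))
    show "c \<le> fps_nth (fps_const (fst p $ None) + (\<Sum>i=1..par_k S. fps_X ^ i * fps_const (correction S \<theta> p i $ None))) 0"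
      if "p \<in> ?K" for \<theta> p
      using c(2)[of "fst p"] that sub by (auto simp: fps_sum_nth fps_X_power_mult_nth)
  qed
  from choice[OF this] obtain B where
    B: "\<And>i. expands T ?K (Suc ?k) (\<lambda>\<epsilon> \<theta> p. F_coeff S i \<theta> (?Y \<epsilon> \<theta> p) $ s) (B i)"
    by blast
  have Bc: "fps_nth (B i \<theta> p) l = faa_coeff (\<lambda>\<eta>. F_coeff S i \<theta> \<eta> $ s) (fst p) (correction S \<theta> p) ?k l"
    if "\<theta> \<in> T" "p \<in> ?K" "l < Suc ?k" for i \<theta> p l
  proof (rule F_coeff_approx_coeff[OF assms(1) _ expands_subset[OF B] that(3)])
    show "fst p $ None > 0" using that(2) sub0 by auto
  qed (use that in auto)
  have total: "expands T ?K (Suc ?k)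
     (\<lambda>\<epsilon> \<theta> p. (\<Sum>i=1..?k. \<epsilon> ^ i * F_coeff S i \<theta> (?Y \<epsilon> \<theta> p) $ s) + \<epsilon> ^ Suc ?k * h \<epsilon> \<theta> (?Y \<epsilon> \<theta> p))
     (\<lambda>\<theta> p. (\<Sum>i=1..?k. fps_X ^ i * B i \<theta> p) + fps_X ^ Suc ?k * 0)"
  proof (intro expands_add expands_sum)
    show "expands T ?K (Suc ?k) (\<lambda>\<epsilon> \<theta> p. \<epsilon> ^ i * F_coeff S i \<theta> (?Y \<epsilon> \<theta> p) $ s) (\<lambda>\<theta> p. fps_X ^ i * B i \<theta> p)" for i
      by (rule expands_mono[OF le_add2 expands_eps_power_mult[OF B]])
    show "expands T ?K (Suc ?k) (\<lambda>\<epsilon> \<theta> p. \<epsilon> ^ Suc ?k * h \<epsilon> \<theta> (?Y \<epsilon> \<theta> p)) (\<lambda>\<theta> p. fps_X ^ Suc ?k * 0)"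
      using expands_eps_power_mult[of T ?K 0 "\<lambda>\<epsilon> \<theta> p. h \<epsilon> \<theta> (?Y \<epsilon> \<theta> p)" "\<lambda>_ _. 0" "Suc ?k"] hY
      by simp
  qed
  obtain \<rho> where \<rho>: "unif_lip T ?K \<rho>"
    and eq\<rho>: "\<forall>\<^sub>F \<epsilon> in at_right 0. \<forall>\<theta>\<in>T. \<forall>p\<in>?K.
      (\<Sum>i=1..?k. \<epsilon> ^ i * F_coeff S i \<theta> (?Y \<epsilon> \<theta> p) $ s) + \<epsilon> ^ Suc ?k * h \<epsilon> \<theta> (?Y \<epsilon> \<theta> p) =
      (\<Sum>l<Suc ?k. fps_nth ((\<Sum>i=1..?k. fps_X ^ i * B i \<theta> p) + fps_X ^ Suc ?k * 0) l * \<epsilon> ^ l)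
        + \<epsilon> ^ Suc ?k * \<rho> \<epsilon> \<theta> p"
    using expands_remainder[OF total] by blast
  have coeff: "fps_nth ((\<Sum>i=1..?k. fps_X ^ i * B i \<theta> p) + fps_X ^ Suc ?k * 0) l =
      (if l = 0 then 0 else y_integrand S l \<theta> (fst p) $ s)"
    if *: "\<theta> \<in> T" "p \<in> ?K" "l < Suc ?k" for \<theta> p l
  proof -
    have "fps_nth ((\<Sum>i=1..?k. fps_X ^ i * B i \<theta> p) + fps_X ^ Suc ?k * 0) l =
       (\<Sum>i=1..?k. if i \<le> l then fps_nth (B i \<theta> p) (l - i) else 0)"
      by (simp add: fps_sum_nth fps_X_power_mult_nth not_less if_distrib cong: if_cong) 
         (rule sum.cong, auto)
    also have "\<dots> = (\<Sum>i=1..l. fps_nth (B i \<theta> p) (l - i))"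
      by (rule sum.mono_neutral_cong_right) (use *(3) in auto)
    \<comment> \<open>Reversing the order of summation makes the Faa di Bruno index the summation
      variable, as in \<open>y_integrand_faa\<close>.\<close>
    also have "\<dots> = (\<Sum>i<l. fps_nth (B (l - i) \<theta> p) i)"
      by (rule sum.reindex_bij_witness[of _ "\<lambda>i. l - i" "\<lambda>i. l - i"]) auto
    also have "\<dots> = (\<Sum>i<l. faa_coeff (\<lambda>\<eta>. F_coeff S (l - i) \<theta> \<eta> $ s) (fst p)
        (\<lambda>j. (1 / fact j) *\<^sub>R y_avg S j \<theta> (fst p)) i i)"
    proof (rule sum.cong)
      fix i assume i: "i \<in> {..<l}"
      have "fps_nth (B (l - i) \<theta> p) i =
        faa_coeff (\<lambda>\<eta>. F_coeff S (l - i) \<theta> \<eta> $ s) (fst p) (correction S \<theta> p) ?k i"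
        by (rule Bc) (use * i in auto)
      also have "\<dots> = faa_coeff (\<lambda>\<eta>. F_coeff S (l - i) \<theta> \<eta> $ s) (fst p) (correction S \<theta> p) i i"
        by (rule faa_coeff_upper) (use * i in auto)
      \<comment> \<open>Here i < l \<le> k, so only corrections of index below k occur, and these do
        not contain v.\<close>
      also have "\<dots> = faa_coeff (\<lambda>\<eta>. F_coeff S (l - i) \<theta> \<eta> $ s) (fst p)
          (\<lambda>j. (1 / fact j) *\<^sub>R y_avg S j \<theta> (fst p)) i i"
        by (rule faa_coeff_cong) (use * i in \<open>auto simp: correction_def\<close>)
      finally show "fps_nth (B (l - i) \<theta> p) i = \<dots>" .
    qed simp
    also have "\<dots> = (if l = 0 then 0 else y_integrand S l \<theta> (fst p) $ s)"
    proof (cases "l = 0")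
      case False
      have "fst p $ None > 0" using *(2) sub0 by auto
      from y_integrand_faa[OF assms(1) this, of l] False show ?thesis by simp
    qed simp
    finally show ?thesis .
  qed
  have "\<forall>\<^sub>F \<epsilon> in at_right 0. \<forall>\<theta>\<in>T. \<forall>p\<in>?K.
       std_rhs S \<epsilon> \<theta> (?Y \<epsilon> \<theta> p) $ s =
         (\<Sum>l=1..?k. \<epsilon> ^ l * y_integrand S l \<theta> (fst p) $ s) + \<epsilon> ^ Suc ?k * \<rho> \<epsilon> \<theta> p"
    using eqh eq\<rho> Yin
  proof eventually_elim
    case (elim \<epsilon>)
    show ?case
    proof (intro ballI)
      fix \<theta> p assume *: "\<theta> \<in> T" "p \<in> ?K"
      then have Y: "?Y \<epsilon> \<theta> p \<in> cball x r'" using elim(3) by blast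
      then have pos: "?Y \<epsilon> \<theta> p $ None > 0" using assms(4) by blast
      have shift: "(\<Sum>i<Suc ?k. g i) = (\<Sum>i=1..?k. g i)" if "g 0 = 0" for g :: "nat \<Rightarrow> real"
        using that by (simp add: sum.lessThan_Suc_shift sum.atLeast1_atMost_eq del: sum.lessThan_Suc)
      have "std_rhs S \<epsilon> \<theta> (?Y \<epsilon> \<theta> p) $ s =
         (\<Sum>i<Suc ?k. fps_nth (rhs_fps S s \<theta> (?Y \<epsilon> \<theta> p)) i * \<epsilon> ^ i) + \<epsilon> ^ Suc ?k * h \<epsilon> \<theta> (?Y \<epsilon> \<theta> p)"
        using elim(1) * Y by blast
      also have "(\<Sum>i<Suc ?k. fps_nth (rhs_fps S s \<theta> (?Y \<epsilon> \<theta> p)) i * \<epsilon> ^ i) =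
         (\<Sum>i=1..?k. \<epsilon> ^ i * F_coeff S i \<theta> (?Y \<epsilon> \<theta> p) $ s)"
        by (subst shift) (simp_all add: rhs_fps_0 F_coeff_eq[OF assms(1) pos] mult.commute)
      also have "\<dots> + \<epsilon> ^ Suc ?k * h \<epsilon> \<theta> (?Y \<epsilon> \<theta> p) =
         (\<Sum>l<Suc ?k. fps_nth ((\<Sum>i=1..?k. fps_X ^ i * B i \<theta> p) + fps_X ^ Suc ?k * 0) l * \<epsilon> ^ l)
        + \<epsilon> ^ Suc ?k * \<rho> \<epsilon> \<theta> p"
        using elim(2) * by blast
      also have "(\<Sum>l<Suc ?k. fps_nth ((\<Sum>i=1..?k. fps_X ^ i * B i \<theta> p) + fps_X ^ Suc ?k * 0) l * \<epsilon> ^ l) =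
         (\<Sum>l<Suc ?k. (if l = 0 then 0 else y_integrand S l \<theta> (fst p) $ s) * \<epsilon> ^ l)"
        by (rule sum.cong) (use coeff[OF *] in auto)
      also have "\<dots> = (\<Sum>l=1..?k. \<epsilon> ^ l * y_integrand S l \<theta> (fst p) $ s)"
        by (subst shift) (auto intro!: sum.cong simp: mult.commute)
      finally show "std_rhs S \<epsilon> \<theta> (?Y \<epsilon> \<theta> p) $ s =
         (\<Sum>l=1..?k. \<epsilon> ^ l * y_integrand S l \<theta> (fst p) $ s) + \<epsilon> ^ Suc ?k * \<rho> \<epsilon> \<theta> p" .
    qed
  qed
  with \<rho> show ?thesis by blast
qed

section \<open>Simple zeros and ordinary differential equations\<close>

text \<open>The mean value inequality is applied to f minus its linearisation at x: the partial
  derivatives are continuous, so the derivative of this difference is small on a ball. The share e /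
  ?c per coordinate sums to e.\<close>

lemma laurent_strictly_differentiable:
  fixes f :: "real ^ 'd::finite option \<Rightarrow> real"
  assumes "laurent f" and "x $ None > 0" and "e > 0"
  obtains d where "d > 0" and "\<And>y z. y \<in> ball x d \<Longrightarrow> z \<in> ball x d \<Longrightarrow>
    \<bar>f y - f z - frechet_derivative f (at x) (y - z)\<bar> \<le> e * norm (y - z)"
proof -
  obtain D where D: "\<And>s. laurent (D s)"
    and der: "\<And>x. x $ None > 0 \<Longrightarrow> (f has_derivative (\<lambda>v. \<Sum>s\<in>UNIV. D s x * v $ s)) (at x)"
    using laurent_has_derivative[OF assms(1)] by blast
  let ?c = "real CARD('d option)"
  have c: "?c > 0" by (simp add: card_gt_0_iff)
  have "\<forall>\<^sub>F y in nhds x. \<forall>s. \<bar>D s y - D s x\<bar> < e / ?c"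
  proof (rule eventually_all_finite)
    fix s
    have "((\<lambda>y. D s y - D s x) \<longlongrightarrow> D s x - D s x) (nhds x)"
      using laurent_isCont[OF D assms(2)]
      by (intro tendsto_intros) (auto simp: continuous_within tendsto_at_iff_tendsto_nhds)
    then have "((\<lambda>y. \<bar>D s y - D s x\<bar>) \<longlongrightarrow> 0) (nhds x)"
      using tendsto_rabs_zero by simp
    from order_tendstoD(2)[OF this, of "e / ?c"] show "\<forall>\<^sub>F y in nhds x. \<bar>D s y - D s x\<bar> < e / ?c"
      using assms(3) c by simp
  qed
  moreover have "\<forall>\<^sub>F y in nhds x. y \<in> {y. y $ None > 0}"
    using open_halfspace assms(2) by (intro eventually_nhds_in_open) auto
  ultimately have "\<forall>\<^sub>F y in nhds x. y $ None > 0 \<and> (\<forall>s. \<bar>D s y - D s x\<bar> < e / ?c)"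
    by eventually_elim auto
  then obtain d where d: "d > 0"
    "\<And>y. dist y x < d \<Longrightarrow> y $ None > 0 \<and> (\<forall>s. \<bar>D s y - D s x\<bar> < e / ?c)"
    unfolding eventually_nhds_metric by blast
  let ?L = "\<lambda>v :: real ^ 'd option. \<Sum>s\<in>UNIV. D s x * v $ s"
  have L: "frechet_derivative f (at x) = ?L"
    by (rule frechet_derivative_at[OF der[OF assms(2)], symmetric])
  have bl: "bounded_linear ?L" using der[OF assms(2)] has_derivative_bounded_linear by blast
  show ?thesis
  proof (rule that[OF d(1)])
    fix y z assume yz: "y \<in> ball x d" "z \<in> ball x d"
    have "norm ((f y - ?L y) - (f z - ?L z)) \<le> e * norm (y - z)"
    proof (rule differentiable_bound[OF convex_ball _ _ yz])
      fix w assume "w \<in> ball x d"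
      then have w: "w $ None > 0" "\<And>s. \<bar>D s w - D s x\<bar> < e / ?c"
        using d(2)[of w] by (auto simp: dist_commute)
      show "((\<lambda>y. f y - ?L y) has_derivative (\<lambda>v. (\<Sum>s\<in>UNIV. D s w * v $ s) - ?L v)) (at w within ball x d)"
        by (intro has_derivative_diff has_derivative_at_withinI[OF der[OF w(1)]] bounded_linear_imp_has_derivative bl)
      show "onorm (\<lambda>v. (\<Sum>s\<in>UNIV. D s w * v $ s) - ?L v) \<le> e"
      proof (rule onorm_le)
        fix v :: "real ^ 'd option"
        have "norm ((\<Sum>s\<in>UNIV. D s w * v $ s) - ?L v) = \<bar>\<Sum>s\<in>UNIV. (D s w - D s x) * v $ s\<bar>"
          by (simp add: sum_subtractf algebra_simps)
        also have "\<dots> \<le> (\<Sum>s\<in>UNIV. \<bar>(D s w - D s x) * v $ s\<bar>)" by (rule sum_abs)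
        also have "\<dots> \<le> (\<Sum>s\<in>(UNIV::'d option set). e / ?c * norm v)"
          unfolding abs_mult
          by (intro sum_mono mult_mono less_imp_le[OF w(2)] component_le_norm_cart) (use assms(3) c in auto)
        also have "\<dots> = e * norm v" using c by simp
        finally show "norm ((\<Sum>s\<in>UNIV. D s w * v $ s) - ?L v) \<le> e * norm v" .
      qed
    qed
    moreover have "?L (y - z) = ?L y - ?L z" by (simp add: right_diff_distrib sum_subtractf)
    ultimately show "\<bar>f y - f z - frechet_derivative f (at x) (y - z)\<bar> \<le> e * norm (y - z)"
      unfolding L by (simp add: algebra_simps)
  qed
qed

lemma laurent_vec_strictly_differentiable:
  fixes f :: "real ^ 'd::finite option \<Rightarrow> real ^ 'n"
  assumes f: "\<And>j. laurent (\<lambda>x. f x $ j)" and "x $ None > 0" and "e > 0"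
  obtains d where "d > 0" and "\<And>y z. y \<in> ball x d \<Longrightarrow> z \<in> ball x d \<Longrightarrow>
    norm (f y - f z - frechet_derivative f (at x) (y - z)) \<le> e * norm (y - z)"
proof -
  let ?c = "real CARD('n)"
  have c: "?c > 0" by (simp add: card_gt_0_iff)
  have "\<forall>j. \<exists>d>0. \<forall>y z. y \<in> ball x d \<longrightarrow> z \<in> ball x d \<longrightarrow>
    \<bar>f y $ j - f z $ j - frechet_derivative (\<lambda>x. f x $ j) (at x) (y - z)\<bar> \<le> e / ?c * norm (y - z)"
  proof
    fix j
    have "e / ?c > 0" using assms(3) c by simp
    then obtain d where "d > 0" "\<And>y z. y \<in> ball x d \<Longrightarrow> z \<in> ball x d \<Longrightarrow>
      \<bar>f y $ j - f z $ j - frechet_derivative (\<lambda>x. f x $ j) (at x) (y - z)\<bar> \<le> e / ?c * norm (y - z)"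
      using laurent_strictly_differentiable[OF f[of j] assms(2)] by (metis (no_types, lifting))
    then show "\<exists>d>0. \<forall>y z. y \<in> ball x d \<longrightarrow> z \<in> ball x d \<longrightarrow>
      \<bar>f y $ j - f z $ j - frechet_derivative (\<lambda>x. f x $ j) (at x) (y - z)\<bar> \<le> e / ?c * norm (y - z)"
      by blast
  qed
  from choice[OF this] obtain d where d: "\<And>j. d j > 0"
    "\<And>j y z. y \<in> ball x (d j) \<Longrightarrow> z \<in> ball x (d j) \<Longrightarrow>
    \<bar>f y $ j - f z $ j - frechet_derivative (\<lambda>x. f x $ j) (at x) (y - z)\<bar> \<le> e / ?c * norm (y - z)"
    by blast
  have le: "Min (range d) \<le> d j" for j by simp
  show ?thesis
  proof (rule that[of "Min (range d)"])
    show "Min (range d) > 0" using d(1) by simp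
    fix y z assume yz: "y \<in> ball x (Min (range d))" "z \<in> ball x (Min (range d))"
    have "\<bar>(f y - f z - frechet_derivative f (at x) (y - z)) $ j\<bar> \<le> e / ?c * norm (y - z)" for j
    proof -
      have "frechet_derivative f (at x) (y - z) $ j = frechet_derivative (\<lambda>x. f x $ j) (at x) (y - z)"
        using frechet_iter_component[OF f assms(2), of "[y - z]" j] by (simp add: frechet_iter_Nil)
      moreover have "y \<in> ball x (d j)" "z \<in> ball x (d j)" using yz le[of j] by auto
      ultimately show ?thesis using d(2)[of y j z] by simp
    qed
    from norm_le_card_bound[OF this] c
    show "norm (f y - f z - frechet_derivative f (at x) (y - z)) \<le> e * norm (y - z)" by simp
  qed
qed

lemma laurent_vec_differentiable:
  fixes f :: "real ^ 'd::finite option \<Rightarrow> real ^ 'n"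
  assumes f: "\<And>j. laurent (\<lambda>x. f x $ j)" and "x $ None > 0"
  shows "f differentiable (at x)"
proof -
  have "(f has_derivative (\<lambda>v. \<chi> j. frechet_derivative (\<lambda>x. f x $ j) (at x) v)) (at x)"
    unfolding has_derivative_componentwise_within[of f]
    using laurent_differentiable[OF f assms(2)] frechet_derivative_works
    by (auto simp: Basis_vec_def inner_axis)
  then show ?thesis by (rule differentiableI)
qed

text \<open>Zeros of f + g are fixed points of the Newton-type map y - M (f y + g y) with the
  inverse Jacobian M frozen at x. The radius d is chosen before \<delta>, so uniqueness holds on a
  fixed ball while existence is localised in an arbitrarily small one; only \<kappa> depends on
  \<delta>.\<close>

lemma perturbed_simple_zero:
  fixes f :: "real ^ 'd::finite option \<Rightarrow> real ^ 'd option"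
  assumes f: "\<And>j. laurent (\<lambda>x. f x $ j)" and "x $ None > 0" and "f x = 0"
    and "det (jacobian f (at x)) \<noteq> 0" and "r > 0"
  obtains d where "0 < d" and "d \<le> r" and "\<And>\<delta>. 0 < \<delta> \<Longrightarrow> \<delta> \<le> d \<Longrightarrow> \<exists>\<kappa>>0. \<forall>g.
    (\<forall>y\<in>cball x d. norm (g y) \<le> \<kappa>) \<and> (\<forall>y\<in>cball x d. \<forall>z\<in>cball x d. norm (g y - g z) \<le> \<kappa> * norm (y - z))
    \<longrightarrow> (\<exists>y\<in>ball x \<delta>. f y + g y = 0) \<and>
        (\<forall>y\<in>cball x d. \<forall>z\<in>cball x d. f y + g y = 0 \<longrightarrow> f z + g z = 0 \<longrightarrow> y = z)"
proof -
  let ?J = "jacobian f (at x)"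
  let ?A = "frechet_derivative f (at x)"
  have "linear ?A"
    by (rule linear_frechet_derivative[OF laurent_vec_differentiable[OF f assms(2)]])
  then have A: "?A v = ?J *v v" for v
    by (simp add: jacobian_def matrix_works)
  have "invertible ?J" using assms(4) by (simp add: invertible_det_nz)
  then obtain M where M: "M ** ?J = mat 1" "?J ** M = mat 1" unfolding invertible_def by blast
  have BA: "M *v (?J *v v) = v" and AB: "?J *v (M *v v) = v" for v
    by (simp_all add: matrix_vector_mul_assoc M)
  obtain \<beta> where \<beta>: "\<beta> > 0" "\<And>v. norm (M *v v) \<le> \<beta> * norm v"
    using bounded_linear.pos_bounded[OF matrix_vector_mul_bounded_linear[of M]] by (auto simp: mult.commute)
  \<comment> \<open>After applying M, the nonlinearity of f adds 1/4 to the contraction constant;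
    the perturbation g will add at most another 1/4.\<close>
  have "1 / (4 * \<beta>) > 0" using \<beta> by simp
  then obtain d0 where d0: "d0 > 0" "\<And>y z. y \<in> ball x d0 \<Longrightarrow> z \<in> ball x d0 \<Longrightarrow>
    norm (f y - f z - ?A (y - z)) \<le> 1 / (4 * \<beta>) * norm (y - z)"
    by (rule laurent_vec_strictly_differentiable[OF f assms(2)]) blast
  define d where "d = min r (d0 / 2)"
  have d: "0 < d" "d \<le> r" "d < d0" using assms(5) d0(1) by (auto simp: d_def)
  show ?thesis
  proof (rule that[OF d(1,2)])
    fix \<delta> :: real assume \<delta>: "0 < \<delta>" "\<delta> \<le> d"
    \<comment> \<open>The first bound limits the Lipschitz share of g to 1/4, the second limits the
      displacement of the centre x to \<delta> / 4.\<close>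
    define \<kappa> where "\<kappa> = min (1 / (4 * \<beta>)) (\<delta> / (4 * \<beta>))"
    have \<kappa>: "\<kappa> > 0" "\<beta> * \<kappa> \<le> 1 / 4" "\<beta> * \<kappa> \<le> \<delta> / 4"
    proof -
      have "\<beta> * \<kappa> \<le> \<beta> * (1 / (4 * \<beta>))" "\<beta> * \<kappa> \<le> \<beta> * (\<delta> / (4 * \<beta>))"
        using \<beta>(1) unfolding \<kappa>_def by (intro mult_left_mono min.cobounded1 min.cobounded2; simp)+
      then show "\<beta> * \<kappa> \<le> 1 / 4" "\<beta> * \<kappa> \<le> \<delta> / 4" using \<beta>(1) by auto
    qed (use \<beta> \<delta> in \<open>simp add: \<kappa>_def\<close>)
    show "\<exists>\<kappa>>0. \<forall>g. (\<forall>y\<in>cball x d. norm (g y) \<le> \<kappa>) \<and> (\<forall>y\<in>cball x d. \<forall>z\<in>cball x d. norm (g y - g z) \<le> \<kappa> * norm (y - z))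
      \<longrightarrow> (\<exists>y\<in>ball x \<delta>. f y + g y = 0) \<and>
        (\<forall>y\<in>cball x d. \<forall>z\<in>cball x d. f y + g y = 0 \<longrightarrow> f z + g z = 0 \<longrightarrow> y = z)"
    proof (intro exI[of _ \<kappa>] conjI \<kappa>(1) allI impI; elim conjE)
      fix g :: "real ^ 'd option \<Rightarrow> real ^ 'd option"
      assume g: "\<forall>y\<in>cball x d. norm (g y) \<le> \<kappa>"
        "\<forall>y\<in>cball x d. \<forall>z\<in>cball x d. norm (g y - g z) \<le> \<kappa> * norm (y - z)"
      define T where "T y = y - M *v (f y + g y)" for y
      have contr: "norm (T y - T z) \<le> 1 / 2 * norm (y - z)" if "y \<in> cball x d" "z \<in> cball x d" for y z
      proof -
        have in_ball: "y \<in> ball x d0" "z \<in> ball x d0" using that d(3) by auto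
        have "T y - T z = M *v (?A (y - z) - (f y - f z) - (g y - g z))"
          unfolding T_def A matrix_vector_mult_diff_distrib BA
          by (simp add: matrix_vector_mult_diff_distrib matrix_vector_right_distrib)
        then have "norm (T y - T z) \<le> \<beta> * norm (?A (y - z) - (f y - f z) - (g y - g z))"
          using \<beta>(2) by simp
        also have "\<dots> \<le> \<beta> * (1 / (4 * \<beta>) * norm (y - z) + \<kappa> * norm (y - z))"
        proof (rule mult_left_mono)
          have "norm (?A (y - z) - (f y - f z)) \<le> 1 / (4 * \<beta>) * norm (y - z)"
            using d0(2)[OF in_ball] by (metis norm_minus_commute)
          moreover have "norm (g y - g z) \<le> \<kappa> * norm (y - z)" using g(2) that by blast
          ultimately show "norm (?A (y - z) - (f y - f z) - (g y - g z)) \<le> 1 / (4 * \<beta>) * norm (y - z) + \<kappa> * norm (y - z)"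
            using norm_triangle_ineq4[of "?A (y - z) - (f y - f z)" "g y - g z"] by linarith
        qed (use \<beta> in simp)
        also have "\<dots> = (1 / 4 + \<beta> * \<kappa>) * norm (y - z)"
          using \<beta>(1) by (simp add: algebra_simps)
        also have "\<dots> \<le> 1 / 2 * norm (y - z)"
          by (rule mult_right_mono) (use \<kappa> in auto)
        finally show ?thesis .
      qed
      have zero_iff: "T y = y \<longleftrightarrow> f y + g y = 0" for y
      proof
        assume "T y = y"
        then have "M *v (f y + g y) = 0" by (simp add: T_def)
        then have "?J *v (M *v (f y + g y)) = ?J *v 0" by simp
        then show "f y + g y = 0" by (simp only: AB) simp
      qed (simp add: T_def)
      have sub: "cball x (\<delta> / 2) \<subseteq> cball x d" using \<delta> by auto
      have xd: "x \<in> cball x d" using d by simp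
      \<comment> \<open>On radius \<delta> / 2 the map stays inside, since \<delta> / 4 for the
        centre plus half of \<delta> / 2 gives \<delta> / 2. The closed ball lies in the open ball
        of radius \<delta>.\<close>
      have "\<exists>!y\<in>cball x (\<delta> / 2). T y = y"
      proof (rule Banach_fix)
        show "complete (cball x (\<delta> / 2))" by (simp add: complete_eq_closed)
        show "cball x (\<delta> / 2) \<noteq> {}" using \<delta> by simp
        show "T ` cball x (\<delta> / 2) \<subseteq> cball x (\<delta> / 2)"
        proof (rule image_subsetI)
          fix y assume y: "y \<in> cball x (\<delta> / 2)"
          have "norm (T x - x) \<le> \<beta> * norm (g x)"
            using \<beta>(2)[of "g x"] assms(3) by (simp add: T_def)
          also have "\<dots> \<le> \<beta> * \<kappa>" using g(1) xd \<beta> by (intro mult_left_mono) auto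
          finally have "norm (T x - x) \<le> \<delta> / 4" using \<kappa> by simp
          moreover have "norm (T y - T x) \<le> 1 / 2 * norm (y - x)" by (rule contr) (use y sub xd in auto)
          moreover have "norm (y - x) \<le> \<delta> / 2" using y by (simp add: dist_norm norm_minus_commute)
          moreover have "norm (T y - x) \<le> norm (T y - T x) + norm (T x - x)"
            using norm_triangle_ineq[of "T y - T x" "T x - x"] by simp
          ultimately have "norm (T y - x) \<le> \<delta> / 2" by linarith
          then show "T y \<in> cball x (\<delta> / 2)" by (simp add: dist_norm norm_minus_commute)
        qed
        show "dist (T y) (T z) \<le> 1 / 2 * dist y z" if "y \<in> cball x (\<delta> / 2)" "z \<in> cball x (\<delta> / 2)" for y z
          unfolding dist_norm by (rule contr) (use that sub in auto)
      qed auto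
      then obtain y where "y \<in> cball x (\<delta> / 2)" "T y = y" by blast
      then show "\<exists>y\<in>ball x \<delta>. f y + g y = 0"
        using \<delta> by (intro bexI[of _ y]) (auto simp: zero_iff)
      show "\<forall>y\<in>cball x d. \<forall>z\<in>cball x d. f y + g y = 0 \<longrightarrow> f z + g z = 0 \<longrightarrow> y = z"
      proof (intro ballI impI)
        fix y z assume "y \<in> cball x d" "z \<in> cball x d" "f y + g y = 0" "f z + g z = 0"
        with contr[of y z] zero_iff[of y] zero_iff[of z] have "norm (y - z) \<le> 1 / 2 * norm (y - z)" by simp
        then show "y = z" by simp
      qed
    qed
  qed
qed

section \<open>Existence, uniqueness and periodic continuation of solutions\<close>

text \<open>The integral operator acts on the unit ball of the bounded continuous functions: b M
  \<le> 1 keeps the ball invariant, and b L \<le> 1/2 makes the operator a contraction.\<close>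

lemma volterra_solution:
  fixes g :: "real \<Rightarrow> 'e::euclidean_space \<Rightarrow> 'e"
  assumes "b \<ge> 0"
    and cont: "continuous_on ({0..b} \<times> cball 0 1) (\<lambda>z. g (fst z) (snd z))"
    and M: "\<And>\<tau> v. \<tau> \<in> {0..b} \<Longrightarrow> v \<in> cball 0 1 \<Longrightarrow> norm (g \<tau> v) \<le> M" and "b * M \<le> 1"
    and L: "\<And>\<tau> v w. \<tau> \<in> {0..b} \<Longrightarrow> v \<in> cball 0 1 \<Longrightarrow> w \<in> cball 0 1 \<Longrightarrow> norm (g \<tau> v - g \<tau> w) \<le> L * norm (v - w)"
    and "b * L \<le> 1 / 2" and "L \<ge> 0"
  obtains v where "continuous_on {0..b} v"
    and "\<And>t. t \<in> {0..b} \<Longrightarrow> norm (v t) \<le> 1"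
    and "\<And>t. t \<in> {0..b} \<Longrightarrow> v t = integral {0..t} (\<lambda>\<tau>. g \<tau> (v \<tau>))"
proof -
  \<comment> \<open>Clamping time to [0, b] makes the integral a bounded continuous function on the
    whole line, so that the complete space of such functions can be used.\<close>
  define cl where "cl t = max 0 (min b t)" for t :: real
  have cl: "cl t \<in> {0..b}" for t using assms(1) by (auto simp: cl_def)
  have cl_id: "cl t = t" if "t \<in> {0..b}" for t using that by (auto simp: cl_def)
  have contcl: "continuous_on A cl" for A unfolding cl_def by (intro continuous_intros)
  define P where "P w t = integral {0..cl t} (\<lambda>\<tau>. g \<tau> (apply_bcontfun w \<tau>))" for w :: "real \<Rightarrow>\<^sub>C 'e" and t
  have inball: "apply_bcontfun w \<tau> \<in> cball 0 1" if "w \<in> cball 0 1" for w :: "real \<Rightarrow>\<^sub>C 'e" and \<tau>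
    using that norm_bounded[of w \<tau>] by simp
  have contg: "continuous_on {0..b} (\<lambda>\<tau>. g \<tau> (apply_bcontfun w \<tau>))" if "w \<in> cball 0 1" for w
  proof -
    have "continuous_on {0..b} (\<lambda>\<tau>. g (fst (\<tau>, apply_bcontfun w \<tau>)) (snd (\<tau>, apply_bcontfun w \<tau>)))"
      by (rule continuous_on_compose2[OF cont])
         (use inball[OF that] in \<open>auto intro!: continuous_on_Pair continuous_on_id\<close>)
    then show ?thesis by simp
  qed
  have intg: "(\<lambda>\<tau>. g \<tau> (apply_bcontfun w \<tau>)) integrable_on {0..cl t}" if "w \<in> cball 0 1" for w t
    by (rule integrable_continuous_interval, rule continuous_on_subset[OF contg[OF that]]) (use cl in auto)
  have contP: "continuous_on UNIV (P w)" if "w \<in> cball 0 1" for w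
  proof -
    have "continuous_on {0..b} (\<lambda>t. integral {0..t} (\<lambda>\<tau>. g \<tau> (apply_bcontfun w \<tau>)))"
      by (rule indefinite_integral_continuous_1[OF integrable_continuous_interval[OF contg[OF that]]])
    then show ?thesis unfolding P_def
      by (rule continuous_on_compose2[OF _ contcl]) (use cl in auto)
  qed
  have bound: "norm (integral {0..cl t} h) \<le> C" if "continuous_on {0..b} h" "\<And>\<tau>. \<tau> \<in> {0..b} \<Longrightarrow> norm (h \<tau>) \<le> c"
    "b * c \<le> C" for h :: "real \<Rightarrow> 'e" and c C t
  proof -
    have c0: "c \<ge> 0" using that(2)[of 0] assms(1) norm_ge_zero[of "h 0"] by (simp del: norm_ge_zero)
    have "norm (integral {0..cl t} h) \<le> c * (cl t - 0)"
      by (rule integral_bound) (use cl[of t] that in \<open>auto intro: continuous_on_subset\<close>)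
    also have "\<dots> \<le> c * b" using cl[of t] c0 by (intro mult_left_mono) auto
    finally show ?thesis using that(3) by (simp add: mult.commute)
  qed
  have normP: "norm (P w t) \<le> 1" if "w \<in> cball 0 1" for w t
    unfolding P_def by (rule bound[OF contg[OF that] _ assms(4)]) (use M inball[OF that] in auto)
  have Pb: "P w \<in> bcontfun" if "w \<in> cball 0 1" for w
    by (rule bcontfun_normI[OF contP[OF that] normP[OF that]])
  have app: "apply_bcontfun (Bcontfun (P w)) = P w" if "w \<in> cball 0 1" for w
    using Pb[OF that] by (simp add: Bcontfun_inverse)
  have "\<exists>!w\<in>cball 0 1. Bcontfun (P w) = w"
  proof (rule Banach_fix)
    show "complete (cball 0 1 :: (real \<Rightarrow>\<^sub>C 'e) set)" by (simp add: complete_eq_closed)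
    show "(\<lambda>w. Bcontfun (P w)) ` cball 0 1 \<subseteq> cball 0 1"
    proof (rule image_subsetI)
      fix w :: "real \<Rightarrow>\<^sub>C 'e" assume w: "w \<in> cball 0 1"
      have "norm (Bcontfun (P w)) \<le> 1" by (rule norm_bound) (simp add: app[OF w] normP[OF w])
      then show "Bcontfun (P w) \<in> cball 0 1" by simp
    qed
    fix w w' :: "real \<Rightarrow>\<^sub>C 'e" assume w: "w \<in> cball 0 1" "w' \<in> cball 0 1"
    show "dist (Bcontfun (P w)) (Bcontfun (P w')) \<le> 1 / 2 * dist w w'"
    proof (rule dist_bound)
      fix t
      have "P w t - P w' t = integral {0..cl t} (\<lambda>\<tau>. g \<tau> (apply_bcontfun w \<tau>) - g \<tau> (apply_bcontfun w' \<tau>))"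
        unfolding P_def by (rule integral_diff[symmetric]) (use intg w in auto)
      moreover have "norm \<dots> \<le> 1 / 2 * dist w w'"
      proof (rule bound[where c = "L * dist w w'"])
        show "norm (g \<tau> (apply_bcontfun w \<tau>) - g \<tau> (apply_bcontfun w' \<tau>)) \<le> L * dist w w'" if "\<tau> \<in> {0..b}" for \<tau>
        proof -
          have "norm (g \<tau> (apply_bcontfun w \<tau>) - g \<tau> (apply_bcontfun w' \<tau>))
            \<le> L * norm (apply_bcontfun w \<tau> - apply_bcontfun w' \<tau>)"
            by (rule L) (use that inball w in auto)
          also have "\<dots> \<le> L * dist w w'"
            using dist_bounded[of w \<tau> w'] assms(7) by (intro mult_left_mono) (auto simp: dist_norm)
          finally show ?thesis .
        qed
        show "b * (L * dist w w') \<le> 1 / 2 * dist w w'"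
          using mult_right_mono[OF assms(6), of "dist w w'"] by (simp add: mult.assoc)
      qed (intro continuous_on_diff contg w)
      ultimately show "dist (apply_bcontfun (Bcontfun (P w)) t) (apply_bcontfun (Bcontfun (P w')) t) \<le> 1 / 2 * dist w w'"
        by (simp only: app[OF w(1)] app[OF w(2)] dist_norm[of "P w t"])
    qed
  qed (auto intro: exI[of _ 0])
  then obtain w where w: "w \<in> cball 0 1" "Bcontfun (P w) = w" by blast
  show ?thesis
  proof (rule that[of "apply_bcontfun w"])
    fix t assume t: "t \<in> {0..b}"
    show "norm (apply_bcontfun w t) \<le> 1" using inball[OF w(1)] by simp
    have "apply_bcontfun w t = P w t" using app[OF w(1)] w(2) by simp
    then show "apply_bcontfun w t = integral {0..t} (\<lambda>\<tau>. g \<tau> (apply_bcontfun w \<tau>))"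
      by (simp add: P_def cl_id[OF t])
  qed simp
qed

text \<open>Only \<psi> is known to stay in U, where the Lipschitz bound holds. The set of agreement
  times is closed, and it is open because near such a time \<phi> is still close to \<psi> and hence
  in U; connectedness of the interval finishes.\<close>

lemma ode_unique:
  fixes \<phi> \<psi> :: "real \<Rightarrow> 'e::real_normed_vector"
  assumes \<phi>: "\<And>t. t \<in> {0..b} \<Longrightarrow> (\<phi> has_vector_derivative h t (\<phi> t)) (at t within {0..b})"
    and \<psi>: "\<And>t. t \<in> {0..b} \<Longrightarrow> (\<psi> has_vector_derivative h t (\<psi> t)) (at t within {0..b})"
    and "open U" and U: "\<And>t. t \<in> {0..b} \<Longrightarrow> \<psi> t \<in> U"
    and L: "\<And>t x y. t \<in> {0..b} \<Longrightarrow> x \<in> U \<Longrightarrow> y \<in> U \<Longrightarrow> norm (h t x - h t y) \<le> L * norm (x - y)"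
    and "L \<ge> 0" and "\<phi> 0 = \<psi> 0" and "t \<in> {0..b}"
  shows "\<phi> t = \<psi> t"
proof -
  let ?I = "{0..b}"
  let ?A = "{t\<in>?I. \<phi> t - \<psi> t = 0}"
  have cont: "continuous_on ?I \<phi>" "continuous_on ?I \<psi>"
    unfolding continuous_on_eq_continuous_within
    by (auto intro!: has_vector_derivative_continuous[OF \<phi>] has_vector_derivative_continuous[OF \<psi>])
  have "closedin (top_of_set ?I) ?A"
    by (intro continuous_closedin_preimage_constant continuous_on_diff cont)
  moreover have "openin (top_of_set ?I) ?A"
    unfolding openin_euclidean_subtopology_iff
  proof (intro conjI ballI)
    fix t0 assume "t0 \<in> ?A"
    then have t0: "t0 \<in> ?I" "\<phi> t0 = \<psi> t0" by auto
    obtain s1 where s1: "s1 > 0" "ball (\<psi> t0) s1 \<subseteq> U"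
      using \<open>open U\<close> U[OF t0(1)] openE by blast
    obtain s where s: "s > 0" "\<And>t. t \<in> ?I \<Longrightarrow> dist t t0 < s \<Longrightarrow> dist (\<phi> t) (\<phi> t0) < s1"
      using cont(1) t0(1) s1(1) unfolding continuous_on_iff by blast
    \<comment> \<open>On an interval of radius \<delta> the maximal difference M satisfies M \<le> L
      \<delta> M \<le> M / 2 and so vanishes. L + 1 avoids division by 0.\<close>
    define \<delta> where "\<delta> = min (s / 2) (1 / (2 * (L + 1)))"
    have \<delta>: "\<delta> > 0" "\<delta> < s" "L * \<delta> \<le> 1 / 2"
    proof -
      have "L * \<delta> \<le> L * (1 / (2 * (L + 1)))" unfolding \<delta>_def by (intro mult_left_mono min.cobounded2 \<open>L \<ge> 0\<close>)
      also have "\<dots> \<le> 1 / 2" using \<open>L \<ge> 0\<close> by (simp add: field_simps)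
      finally show "L * \<delta> \<le> 1 / 2" .
    qed (use s \<open>L \<ge> 0\<close> in \<open>auto simp: \<delta>_def\<close>)
    let ?K = "?I \<inter> cball t0 \<delta>"
    have K: "compact ?K" "convex ?K" "t0 \<in> ?K" using t0 \<delta>
      by (auto intro: convex_Int compact_Int)
    have "continuous_on ?K (\<lambda>t. norm (\<phi> t - \<psi> t))"
      by (intro continuous_intros continuous_on_subset[OF cont(1)] continuous_on_subset[OF cont(2)]) auto
    from continuous_attains_sup[OF K(1) _ this] K(3) obtain m where m: "m \<in> ?K"
      "\<And>t. t \<in> ?K \<Longrightarrow> norm (\<phi> t - \<psi> t) \<le> norm (\<phi> m - \<psi> m)" by blast
    let ?M = "norm (\<phi> m - \<psi> m)"
    have "norm ((\<phi> m - \<psi> m) - (\<phi> t0 - \<psi> t0)) \<le> (L * ?M) * norm (m - t0)"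
    proof (rule differentiable_bound[OF K(2) _ _ m(1) K(3)])
      fix t assume t: "t \<in> ?K"
      show "((\<lambda>t. \<phi> t - \<psi> t) has_derivative (\<lambda>c. c *\<^sub>R (h t (\<phi> t) - h t (\<psi> t)))) (at t within ?K)"
        using has_vector_derivative_within_subset[OF has_vector_derivative_diff[OF \<phi> \<psi>], of t ?K] t
        by (auto simp: has_vector_derivative_def)
      have "\<phi> t \<in> U" using s(2)[of t] t \<delta> s1(2) t0(2) by (auto simp: dist_commute)
      moreover have "\<psi> t \<in> U" using U t by blast
      ultimately have "norm (h t (\<phi> t) - h t (\<psi> t)) \<le> L * norm (\<phi> t - \<psi> t)" using L t by blast
      also have "\<dots> \<le> L * ?M" by (rule mult_left_mono[OF m(2)[OF t] \<open>L \<ge> 0\<close>])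
      finally have *: "norm (h t (\<phi> t) - h t (\<psi> t)) \<le> L * ?M" .
      show "onorm (\<lambda>c. c *\<^sub>R (h t (\<phi> t) - h t (\<psi> t))) \<le> L * ?M"
        by (rule onorm_le) (use mult_left_mono[OF *] in \<open>simp add: mult.commute\<close>)
    qed
    also have "\<dots> \<le> (L * ?M) * \<delta>"
      using m(1) \<open>L \<ge> 0\<close> by (intro mult_left_mono) (auto simp: dist_norm norm_minus_commute)
    also have "\<dots> = (L * \<delta>) * ?M" by simp
    also have "\<dots> \<le> 1 / 2 * ?M" by (rule mult_right_mono[OF \<delta>(3)]) simp
    finally have "?M = 0" using t0(2) by simp
    then have "\<phi> t - \<psi> t = 0" if "t \<in> ?K" for t using m(2)[OF that] by simp
    then show "\<exists>e>0. \<forall>t'\<in>?I. dist t' t0 < e \<longrightarrow> t' \<in> ?A"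
      using \<delta>(1) by (intro exI[of _ \<delta>]) (auto simp: dist_commute)
  qed auto
  moreover have "connected ?I" by (rule connected_Icc)
  moreover have "0 \<in> ?A" using assms(7,8) by auto
  ultimately have "?A = ?I" unfolding connected_clopen by blast
  with assms(8) have "t \<in> ?A" by (simp only:)
  then show ?thesis by simp
qed

lemma has_vector_derivative_within_union:
  "(f has_vector_derivative d) (at x within A) \<Longrightarrow> (f has_vector_derivative d) (at x within B) \<Longrightarrow>
    (f has_vector_derivative d) (at x within (A \<union> B))"
  unfolding has_vector_derivative_def has_derivative_within by (auto intro: Lim_Un)

text \<open>The copies on consecutive period intervals solve the equation because h is periodic. At
  a seam the one-sided derivatives from both sides have the same value, which gives a two-sided
  derivative.\<close>

lemma periodic_extension:
  fixes z :: "real \<Rightarrow> 'e::real_normed_vector"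
  assumes "T > 0" and "z 0 = z T"
    and z: "\<And>t. t \<in> {0..T} \<Longrightarrow> (z has_vector_derivative h t (z t)) (at t within {0..T})"
    and h: "\<And>t (n::int) x. h (t - of_int n * T) x = h t x"
  obtains \<phi> where "\<And>t. \<phi> (t + T) = \<phi> t" and "\<And>t. t \<in> {0..T} \<Longrightarrow> \<phi> t = z t"
    and "\<And>t. (\<phi> has_vector_derivative h t (\<phi> t)) (at t)"
proof -
  define \<phi> where "\<phi> t = z (t - of_int \<lfloor>t / T\<rfloor> * T)" for t
  \<comment> \<open>The right end of a period interval belongs by the floor function to the next
    interval; there \<open>z 0 = z T\<close> is used.\<close>
  have eq: "\<phi> t = z (t - of_int n * T)" if "t - of_int n * T \<in> {0..T}" for t n
  proof (cases "t - of_int n * T = T")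
    case True
    then have "t = of_int (n + 1) * T" by (simp add: algebra_simps)
    then have "\<lfloor>t / T\<rfloor> = n + 1" "t - of_int (n + 1) * T = 0" using assms(1) by simp_all
    then show ?thesis using True assms(2) by (simp add: \<phi>_def)
  next
    case False
    have "\<lfloor>t / T\<rfloor> = n"
      by (rule floor_unique) (use that False assms(1) in \<open>auto simp: field_simps\<close>)
    then show ?thesis by (simp add: \<phi>_def)
  qed
  have inI: "t - of_int \<lfloor>t / T\<rfloor> * T \<in> {0..<T}" for t
    using floor_divide_lower[OF assms(1), of t] floor_divide_upper[OF assms(1), of t]
    by (simp add: algebra_simps)
  have der: "(\<phi> has_vector_derivative h t (\<phi> t)) (at t within {of_int n * T..of_int n * T + T})"
    if t: "t - of_int n * T \<in> {0..T}" for t n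
  proof -
    let ?J = "{of_int n * T..of_int n * T + T}"
    have shift: "((\<lambda>t. t - of_int n * T) has_vector_derivative 1) (at t within ?J)"
      by (auto intro!: derivative_eq_intros)
    have "(\<lambda>t. t - of_int n * T) ` ?J \<subseteq> {0..T}" by auto
    from vector_diff_chain_within[OF shift has_vector_derivative_within_subset[OF z[OF t] this]]
    have "((\<lambda>t. z (t - of_int n * T)) has_vector_derivative h t (\<phi> t)) (at t within ?J)"
      using h[of t n] eq[OF t] by (simp add: o_def)
    then show ?thesis
      by (rule has_vector_derivative_transform[rotated 2]) (use t eq in auto)
  qed
  have der': "(\<phi> has_vector_derivative h t (\<phi> t)) (at t)" for t
  proof -
    define n where "n = \<lfloor>t / T\<rfloor>"
    have t: "t - of_int n * T \<in> {0..<T}" using inI[of t] by (simp add: n_def)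
    show ?thesis
    proof (cases "t - of_int n * T = 0")
      case False
      have "(\<phi> has_vector_derivative h t (\<phi> t)) (at t within {of_int n * T..of_int n * T + T})"
        by (rule der) (use t in auto)
      moreover have "at t within {of_int n * T..of_int n * T + T} = at t"
        by (rule at_within_interior) (use t False in auto)
      ultimately show ?thesis by (simp only:)
    next
      case True
      have "(\<phi> has_vector_derivative h t (\<phi> t)) (at t within {of_int n * T..of_int n * T + T})"
        by (rule der) (use t in auto)
      moreover have "(\<phi> has_vector_derivative h t (\<phi> t)) (at t within {of_int (n - 1) * T..of_int (n - 1) * T + T})"
        by (rule der) (use True assms(1) in \<open>auto simp: algebra_simps\<close>)
      ultimately have "(\<phi> has_vector_derivative h t (\<phi> t)) (at t within
         ({of_int n * T..of_int n * T + T} \<union> {of_int (n - 1) * T..of_int (n - 1) * T + T}))"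
        by (rule has_vector_derivative_within_union)
      moreover have "{of_int n * T..of_int n * T + T} \<union> {of_int (n - 1) * T..of_int (n - 1) * T + T} = {t - T..t + T}"
        using True assms(1) by (auto simp: algebra_simps)
      moreover have "at t within {t - T..t + T} = at t"
        by (rule at_within_interior) (use assms(1) in simp)
      ultimately show ?thesis by (simp only:)
    qed
  qed
  show ?thesis
  proof (rule that[OF _ _ der'])
    show "\<phi> (t + T) = \<phi> t" for t
    proof -
      have "(t + T) / T = t / T + 1" using assms(1) by (simp add: field_simps)
      then show ?thesis by (simp add: \<phi>_def algebra_simps)
    qed
    show "\<phi> t = z t" if "t \<in> {0..T}" for t using eq[of t 0] that by simp
  qed
qed

section \<open>Closed orbits of the perturbed system\<close>

lemma has_vector_derivative_vecI:
  fixes f :: "real \<Rightarrow> real ^ 'n"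
  assumes "\<And>i. ((\<lambda>x. f x $ i) has_real_derivative d $ i) (at x within A)"
  shows "(f has_vector_derivative d) (at x within A)"
  unfolding has_vector_derivative_def has_derivative_componentwise_within[of f]
  using assms by (auto simp: Basis_vec_def inner_axis has_field_derivative_def mult_commute_abs)

lemma has_vector_derivative_vecD:
  fixes f :: "real \<Rightarrow> real ^ 'n"
  assumes "(f has_vector_derivative d) (at x within A)"
  shows "((\<lambda>x. f x $ i) has_real_derivative d $ i) (at x within A)"
  using bounded_linear.has_vector_derivative[OF bounded_linear_vec_nth assms, of i]
  by (simp add: has_real_derivative_iff_has_vector_derivative)

text \<open>The velocity of \<open>polar \<theta> (\<phi> \<theta>)\<close> with respect to \<theta>
  when \<phi> has value \<eta> and velocity w.\<close>

definition dpolar :: "real \<Rightarrow> real ^ 'd::finite option \<Rightarrow> real ^ 'd option \<Rightarrow> real ^ 'd coord" where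
  "dpolar \<theta> \<eta> w = (\<chi> v. case v of
       C1 \<Rightarrow> w $ None * cos \<theta> - \<eta> $ None * sin \<theta>
     | C2 \<Rightarrow> w $ None * sin \<theta> + \<eta> $ None * cos \<theta>
     | CS s \<Rightarrow> w $ Some s)"

lemma polar_has_vector_derivative:
  assumes "(\<phi> has_vector_derivative w) (at \<theta>)"
  shows "((\<lambda>\<theta>. polar \<theta> (\<phi> \<theta>)) has_vector_derivative dpolar \<theta> (\<phi> \<theta>) w) (at \<theta>)"
proof (rule has_vector_derivative_vecI)
  note d = has_vector_derivative_vecD[OF assms]
  fix v :: "'a coord"
  show "((\<lambda>\<theta>. polar \<theta> (\<phi> \<theta>) $ v) has_real_derivative dpolar \<theta> (\<phi> \<theta>) w $ v) (at \<theta>)"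
    using d[of None] d
    by (cases v) (auto simp: polar_def dpolar_def intro!: derivative_eq_intros)
qed

text \<open>The shift j - 1 pairs the coefficient of \<epsilon>^(j-1) in the system with the term
  \<epsilon>^j of the rescaled equation.\<close>

definition homog :: "'d::finite perturbed \<Rightarrow> 'd coord \<Rightarrow> nat \<Rightarrow> real ^ 'd coord \<Rightarrow> real" where
  "homog S v j x = (\<Sum>\<alpha>\<in>multi_indices (par_m S). par_p S v \<alpha> (j - 1) * monomial \<alpha> x)"

lemma monomial_scaleR:
  "\<alpha> \<in> multi_indices m \<Longrightarrow> monomial \<alpha> (c *\<^sub>R x) = c ^ m * monomial \<alpha> x"
  by (auto simp: monomial_def multi_indices_def power_mult_distrib prod.distrib power_sum)

text \<open>This is where the exponent 1/(m - 1) comes from: degree m gives \<sigma>^m = \<sigma>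
  \<epsilon>, so the nonlinear terms start at order \<epsilon>, like the perturbation of the linear
  part.\<close>

lemma nonlin_scaleR:
  assumes "par_m S \<ge> 1" and "\<sigma> ^ (par_m S - 1) = \<epsilon>"
  shows "nonlin S \<epsilon> v (\<sigma> *\<^sub>R x) = \<sigma> * (\<Sum>j=1..par_k S. \<epsilon> ^ j * homog S v j x)"
proof -
  have \<sigma>: "\<sigma> ^ par_m S = \<sigma> * \<epsilon>"
    using assms by (metis power_minus_mult mult.commute less_le_trans zero_less_one)
  have "nonlin S \<epsilon> v (\<sigma> *\<^sub>R x) = (\<Sum>\<alpha>\<in>multi_indices (par_m S). \<Sum>j=1..par_k S.
      \<sigma> * (\<epsilon> ^ j * (par_p S v \<alpha> (j - 1) * monomial \<alpha> x)))"
    unfolding nonlin_def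
  proof (rule sum.cong[OF refl])
    fix \<alpha> :: "'a coord \<Rightarrow> nat" assume \<alpha>: "\<alpha> \<in> multi_indices (par_m S)"
    show "(\<Sum>j=1..par_k S. \<epsilon> ^ (j - 1) * par_p S v \<alpha> (j - 1)) * monomial \<alpha> (\<sigma> *\<^sub>R x) =
      (\<Sum>j=1..par_k S. \<sigma> * (\<epsilon> ^ j * (par_p S v \<alpha> (j - 1) * monomial \<alpha> x)))"
      unfolding sum_distrib_right monomial_scaleR[OF \<alpha>] \<sigma>
    proof (rule sum.cong[OF refl])
      fix j assume "j \<in> {1..par_k S}"
      then have "\<epsilon> ^ j = \<epsilon> ^ (j - 1) * \<epsilon>" by (cases j) auto
      then show "\<epsilon> ^ (j - 1) * par_p S v \<alpha> (j - 1) * (\<sigma> * \<epsilon> * monomial \<alpha> x) =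
         \<sigma> * (\<epsilon> ^ j * (par_p S v \<alpha> (j - 1) * monomial \<alpha> x))" by simp
    qed
  qed
  also have "\<dots> = \<sigma> * (\<Sum>j=1..par_k S. \<epsilon> ^ j * homog S v j x)"
    unfolding homog_def sum_distrib_left by (rule sum.swap)
  finally show ?thesis .
qed

lemma S_num_None: "S_num S i \<theta> \<eta> None = par_a S i * \<eta> $ None +
    cos \<theta> * homog S C1 i (polar \<theta> \<eta>) + sin \<theta> * homog S C2 i (polar \<theta> \<eta>)"
  by (simp add: S_num_def homog_def sum_distrib_left algebra_simps sum.distrib)

lemma S_num_Some: "S_num S i \<theta> \<eta> (Some s) = par_c S s i * \<eta> $ Some s + homog S (CS s) i (polar \<theta> \<eta>)"
  by (simp add: S_num_def homog_def)

lemma S_den_homog: "S_den S i \<theta> \<eta> = par_bj S i * \<eta> $ None +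
    cos \<theta> * homog S C2 i (polar \<theta> \<eta>) - sin \<theta> * homog S C1 i (polar \<theta> \<eta>)"
  by (simp add: S_den_def homog_def sum_distrib_left algebra_simps sum.distrib sum_subtractf)

text \<open>The factor \<open>std_den\<close> / R is the angular speed, and the remaining vector is
  the velocity with respect to \<theta>. The radial and angular combinations of the nonlinear terms
  recombine through sin^2 + cos^2 = 1.\<close>

lemma P_field_polar:
  assumes "par_m S \<ge> 1" and "\<sigma> ^ (par_m S - 1) = \<epsilon>" and "\<eta> $ None \<noteq> 0" and "std_den S \<epsilon> \<theta> \<eta> \<noteq> 0"
  shows "P_field S \<epsilon> (\<sigma> *\<^sub>R polar \<theta> \<eta>) =
    (std_den S \<epsilon> \<theta> \<eta> / \<eta> $ None) *\<^sub>R (\<sigma> *\<^sub>R dpolar \<theta> \<eta> (std_rhs S \<epsilon> \<theta> \<eta>))"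
proof -
  let ?R = "\<eta> $ None" and ?D = "std_den S \<epsilon> \<theta> \<eta>"
  let ?N = "\<lambda>j. \<Sum>i=1..par_k S. \<epsilon> ^ i * S_num S i \<theta> \<eta> j"
  let ?H = "\<lambda>v. \<Sum>i=1..par_k S. \<epsilon> ^ i * homog S v i (polar \<theta> \<eta>)"
  let ?E = "\<lambda>u. eps_sum S u \<epsilon>"
  have rhs: "?D / ?R * std_rhs S \<epsilon> \<theta> \<eta> $ j = ?N j" for j
    using assms(3,4) by (simp add: std_rhs_def)
  have NN: "?N None = ?E (par_a S) * ?R + cos \<theta> * ?H C1 + sin \<theta> * ?H C2"
    by (simp add: S_num_None eps_sum_def sum_distrib_left sum_distrib_right sum.distrib algebra_simps)
  have NS: "?N (Some s) = ?E (par_c S s) * \<eta> $ Some s + ?H (CS s)" for s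
    by (simp add: S_num_Some eps_sum_def sum_distrib_left sum_distrib_right sum.distrib algebra_simps)
  have DD: "?D = (par_b S + ?E (par_bj S)) * ?R + cos \<theta> * ?H C2 - sin \<theta> * ?H C1"
    by (simp add: std_den_def S_den_homog eps_sum_def sum_distrib_left sum_distrib_right sum.distrib
        sum_subtractf algebra_simps)
  have cs: "cos \<theta> * cos \<theta> + sin \<theta> * sin \<theta> = 1"
    using sin_cos_squared_add2[of \<theta>] by (simp add: power2_eq_square)
  note nl = nonlin_scaleR[OF assms(1,2)]
  show ?thesis
  proof (rule vec_eq_iff[THEN iffD2], rule allI)
    fix v :: "'a coord"
    show "P_field S \<epsilon> (\<sigma> *\<^sub>R polar \<theta> \<eta>) $ v =
       ((?D / ?R) *\<^sub>R (\<sigma> *\<^sub>R dpolar \<theta> \<eta> (std_rhs S \<epsilon> \<theta> \<eta>))) $ v"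
    proof (cases v)
      case C1
      have "((?D / ?R) *\<^sub>R (\<sigma> *\<^sub>R dpolar \<theta> \<eta> (std_rhs S \<epsilon> \<theta> \<eta>))) $ v =
         \<sigma> * ((?D / ?R * std_rhs S \<epsilon> \<theta> \<eta> $ None) * cos \<theta> - ?D * sin \<theta>)"
        using C1 assms(3) by (simp add: dpolar_def algebra_simps)
      also have "\<dots> = \<sigma> * (?E (par_a S) * ?R * cos \<theta> - (par_b S + ?E (par_bj S)) * ?R * sin \<theta> +
          (cos \<theta> * cos \<theta> + sin \<theta> * sin \<theta>) * ?H C1)"
        unfolding rhs NN by (subst DD) (simp add: algebra_simps del: sin_cos_squared_add3)
      also have "\<dots> = P_field S \<epsilon> (\<sigma> *\<^sub>R polar \<theta> \<eta>) $ v"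
        unfolding cs using C1 by (simp add: P_field_def nl) (simp add: polar_def algebra_simps)
      finally show ?thesis ..
    next
      case C2
      have "((?D / ?R) *\<^sub>R (\<sigma> *\<^sub>R dpolar \<theta> \<eta> (std_rhs S \<epsilon> \<theta> \<eta>))) $ v =
         \<sigma> * ((?D / ?R * std_rhs S \<epsilon> \<theta> \<eta> $ None) * sin \<theta> + ?D * cos \<theta>)"
        using C2 assms(3) by (simp add: dpolar_def algebra_simps)
      also have "\<dots> = \<sigma> * (?E (par_a S) * ?R * sin \<theta> + (par_b S + ?E (par_bj S)) * ?R * cos \<theta> +
          (cos \<theta> * cos \<theta> + sin \<theta> * sin \<theta>) * ?H C2)"
        unfolding rhs NN by (subst DD) (simp add: algebra_simps del: sin_cos_squared_add3)
      also have "\<dots> = P_field S \<epsilon> (\<sigma> *\<^sub>R polar \<theta> \<eta>) $ v"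
        unfolding cs using C2 by (simp add: P_field_def nl) (simp add: polar_def algebra_simps)
      finally show ?thesis ..
    next
      case (CS s)
      have "((?D / ?R) *\<^sub>R (\<sigma> *\<^sub>R dpolar \<theta> \<eta> (std_rhs S \<epsilon> \<theta> \<eta>))) $ v =
         \<sigma> * (?D / ?R * std_rhs S \<epsilon> \<theta> \<eta> $ Some s)"
        using CS by (simp add: dpolar_def)
      also have "\<dots> = P_field S \<epsilon> (\<sigma> *\<^sub>R polar \<theta> \<eta>) $ v"
        unfolding rhs NS using CS by (simp add: P_field_def nl) (simp add: polar_def algebra_simps)
      finally show ?thesis ..
    qed
  qed
qed

section \<open>Reparametrisation of periodic curves by time\<close>

lemma periodic_int:
  fixes f :: "real \<Rightarrow> 'a"
  assumes "\<And>x. f (x + T) = f x"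
  shows "f (x + of_int n * T) = f x"
proof (induction n rule: int_induct[of _ 0])
  case (step1 i)
  then show ?case using assms[of "x + of_int i * T"] by (simp add: algebra_simps)
next
  case (step2 i)
  then show ?case using assms[of "x + of_int (i - 1) * T"] by (simp add: algebra_simps)
qed simp

text \<open>The solution of g' = q(g) is the inverse of an antiderivative F of 1/q. The time a spent
  on one period is F P - F 0; it is negative when q is.\<close>

lemma time_change:
  fixes q :: "real \<Rightarrow> real"
  assumes q: "continuous_on UNIV q" "\<And>x. q x \<noteq> 0" "\<And>x. q (x + P) = q x" and "P > 0"
  obtains g a where "a \<noteq> 0" and "surj g" and "\<And>t. (g has_real_derivative q (g t)) (at t)"
    and "\<And>t. g (t + a) = g t + P"
proof -
  have "\<exists>F. \<forall>x::real. (-\<infinity>::ereal) < x \<longrightarrow> x < \<infinity> \<longrightarrow> (F has_vector_derivative 1 / q x) (at x)"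
    by (rule einterval_antiderivative)
       (use q(1,2) in \<open>auto intro!: continuous_intros simp: continuous_on_eq_continuous_at\<close>)
  then obtain F where F: "\<And>x. (F has_real_derivative 1 / q x) (at x)"
    by (auto simp: has_real_derivative_iff_has_vector_derivative)
  define a where "a = F P - F 0"
  have shift: "F (x + P) = F x + a" for x
  proof -
    have "((\<lambda>x. F (x + P) - F x) has_real_derivative 0) (at y)" for y
      using q(3)[of y] by (auto intro!: derivative_eq_intros DERIV_chain'[OF _ F, of _ 1 y UNIV, simplified] F)
    then have "F (x + P) - F x = F (0 + P) - F 0"
      by (rule DERIV_isconst_all[OF allI])
    then show ?thesis by (simp add: a_def)
  qed
  have contF: "continuous_on UNIV F" using F DERIV_isCont continuous_at_imp_continuous_on by blast
  \<comment> \<open>A continuous function without zeros on a connected domain keeps its sign; this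
    makes F strictly monotone.\<close>
  have sign: "(\<forall>x. q x > 0) \<or> (\<forall>x. q x < 0)"
  proof (rule ccontr)
    assume "\<not> ?thesis"
    then obtain x y where "q x < 0" "q y > 0" using q(2) by (metis linorder_neqE_linordered_idom)
    moreover have "connected (range q)" using q(1) by (intro connected_continuous_image) auto
    ultimately have "0 \<in> range q" using connectedD_interval[of "range q" "q x" "q y" 0] by auto
    then show False using q(2) by auto
  qed
  have mono: "inj F \<and> F 0 \<noteq> F P"
  proof (cases "\<forall>x. q x > 0")
    case True
    have "F x < F y" if "x < y" for x y
      by (rule DERIV_pos_imp_increasing[OF that]) (use F True in \<open>meson zero_less_divide_1_iff\<close>)
    then show ?thesis using \<open>P > 0\<close> by (metis injI linorder_neqE_linordered_idom less_irrefl)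
  next
    case False
    then have neg: "q x < 0" for x using sign by auto
    have "F y < F x" if "x < y" for x y
      by (rule DERIV_neg_imp_decreasing[OF that]) (use F neg in \<open>meson divide_less_0_1_iff\<close>)
    then show ?thesis using \<open>P > 0\<close> by (metis injI linorder_neqE_linordered_idom less_irrefl)
  qed
  have a: "a \<noteq> 0" using mono by (simp add: a_def)
  \<comment> \<open>Subtracting the linear function of slope a / P from F leaves a P-periodic
    function, which has equal values at all multiples of P.\<close>
  have Fint: "F (of_int n * P) = F 0 + of_int n * a" for n :: int
  proof -
    have "F (0 + of_int n * P) - of_int n * a = F 0"
    proof -
      let ?G = "\<lambda>x. F x - x / P * a"
      have "?G (x + P) = ?G x" for x using shift[of x] \<open>P > 0\<close> by (simp add: field_simps)
      from periodic_int[of ?G, OF this, of 0 n] show ?thesis using \<open>P > 0\<close> by simp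
    qed
    then show ?thesis by simp
  qed
  \<comment> \<open>Each t lies between two consecutive values F(n P), with order reversed if a < 0,
    so the intermediate value property applies.\<close>
  have surjF: "surj F"
  proof -
    have "t \<in> range F" for t
    proof -
      let ?x = "(t - F 0) / a"
      have "connected (range F)" using contF by (intro connected_continuous_image) auto
      moreover have lo: "of_int \<lfloor>?x\<rfloor> \<le> ?x" "?x \<le> of_int (\<lfloor>?x\<rfloor> + 1)" by linarith+
      have "(of_int \<lfloor>?x\<rfloor> * a \<le> t - F 0 \<and> t - F 0 \<le> of_int (\<lfloor>?x\<rfloor> + 1) * a) \<or>
            (of_int (\<lfloor>?x\<rfloor> + 1) * a \<le> t - F 0 \<and> t - F 0 \<le> of_int \<lfloor>?x\<rfloor> * a)"
      proof (cases "a > 0")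
        case True
        then show ?thesis using mult_right_mono[OF lo(1), of a] mult_right_mono[OF lo(2), of a] by simp
      next
        case False
        then show ?thesis using mult_right_mono_neg[OF lo(1), of a] mult_right_mono_neg[OF lo(2), of a] a by simp
      qed
      then have "(F (of_int \<lfloor>?x\<rfloor> * P) \<le> t \<and> t \<le> F (of_int (\<lfloor>?x\<rfloor> + 1) * P)) \<or>
          (F (of_int (\<lfloor>?x\<rfloor> + 1) * P) \<le> t \<and> t \<le> F (of_int \<lfloor>?x\<rfloor> * P))"
        unfolding Fint by linarith
      ultimately show ?thesis
        using connectedD_interval[of "range F" _ _ t] by blast
    qed
    then show ?thesis by auto
  qed
  define g where "g = inv F"
  have gF: "g (F x) = x" for x using mono by (simp add: g_def)
  have Fg: "F (g t) = t" for t using surjF by (simp add: g_def surj_f_inv_f)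
  show ?thesis
  proof (rule that[OF a])
    show "surj g" using gF by (metis surjI)
    show "g (t + a) = g t + P" for t
      using gF[of "g t + P"] shift[of "g t"] Fg[of t] by simp
    show "(g has_real_derivative q (g t)) (at t)" for t
    proof -
      have "(g has_derivative (\<lambda>h. q (g t) * h)) (at (F (g t)))"
      proof (rule has_derivative_inverse_strong[of UNIV "g t" F g "\<lambda>h. 1 / q (g t) * h"])
        show "(F has_derivative (\<lambda>h. 1 / q (g t) * h)) (at (g t))"
          using F[of "g t"] unfolding has_field_derivative_def .
        show "(\<lambda>h. 1 / q (g t) * h) \<circ> (\<lambda>h. q (g t) * h) = id"
          using q(2)[of "g t"] by auto
      qed (use contF gF in auto)
      then show ?thesis by (simp add: Fg has_field_derivative_def)
    qed
  qed
qed

lemma closed_orbit_time_change: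
  fixes c :: "real \<Rightarrow> 'e::real_normed_vector"
  assumes c: "\<And>x. (c has_vector_derivative c' x) (at x)" "\<And>x. V (c x) = q x *\<^sub>R c' x"
    and q: "continuous_on UNIV q" "\<And>x. q x \<noteq> 0" "\<And>x. q (x + P) = q x" and "P > 0"
    and per: "\<And>x. c (x + P) = c x" and "c x1 \<noteq> c x2"
  shows "closed_orbit V (range c)"
proof -
  obtain g a where g: "a \<noteq> 0" "surj g" "\<And>t. (g has_real_derivative q (g t)) (at t)"
    "\<And>t. g (t + a) = g t + P"
    using time_change[OF q \<open>P > 0\<close>] by metis
  let ?\<gamma> = "\<lambda>t. c (g t)"
  have per_a: "?\<gamma> (t + a) = ?\<gamma> t" for t by (simp add: g(4) per)
  show ?thesis
    unfolding closed_orbit_def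
  \<comment> \<open>The absolute value is the period, because the orbit may be traversed against
    increasing \<theta>.\<close>
  proof (rule exI[of _ ?\<gamma>], rule exI[of _ "\<bar>a\<bar>"], intro conjI allI)
    show "\<bar>a\<bar> > 0" using g(1) by simp
    show "(?\<gamma> has_vector_derivative V (?\<gamma> t)) (at t)" for t
    proof -
      have "(g has_vector_derivative q (g t)) (at t)"
        using g(3) by (simp add: has_real_derivative_iff_has_vector_derivative)
      from vector_diff_chain_at[OF this c(1)] show ?thesis by (simp add: c(2) o_def)
    qed
    show "?\<gamma> (t + \<bar>a\<bar>) = ?\<gamma> t" for t
      using per_a[of t] per_a[of "t - a"] by (cases "a > 0") auto
    obtain t1 t2 where "g t1 = x1" "g t2 = x2" using g(2) by (metis surjD)
    then have "?\<gamma> t1 \<noteq> ?\<gamma> t2" using assms(8) by simp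
    then show "\<exists>t. ?\<gamma> t \<noteq> ?\<gamma> 0" by metis
    show "range c = range ?\<gamma>" using g(2) by (metis image_image)
  qed
qed

lemma polar_cong: "cos \<theta>' = cos \<theta> \<Longrightarrow> sin \<theta>' = sin \<theta> \<Longrightarrow> polar \<theta>' \<eta> = polar \<theta> \<eta>"
  by (simp only: polar_def)

lemma std_cong:
  assumes "cos \<theta>' = cos \<theta>" and "sin \<theta>' = sin \<theta>"
  shows "std_den S \<epsilon> \<theta>' \<eta> = std_den S \<epsilon> \<theta> \<eta>" and "std_rhs S \<epsilon> \<theta>' \<eta> = std_rhs S \<epsilon> \<theta> \<eta>"
proof -
  have p: "polar \<theta>' \<eta> = polar \<theta> \<eta>" by (rule polar_cong[OF assms])
  show d: "std_den S \<epsilon> \<theta>' \<eta> = std_den S \<epsilon> \<theta> \<eta>"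
    by (simp add: std_den_def S_den_def p assms)
  have "S_num S i \<theta>' \<eta> j = S_num S i \<theta> \<eta> j" for i j
    by (cases j) (simp_all add: S_num_def p assms)
  then show "std_rhs S \<epsilon> \<theta>' \<eta> = std_rhs S \<epsilon> \<theta> \<eta>"
    by (simp add: std_rhs_def d)
qed

lemma cos_sin_shift:
  "cos (\<theta> - of_int n * (2 * pi)) = cos \<theta>" "sin (\<theta> - of_int n * (2 * pi)) = sin \<theta>"
  using cos_int_2pin[of n] sin_int_2pin[of n] by (simp_all add: cos_diff sin_diff mult.commute mult.left_commute)

lemma separable_std_den: "separable (\<lambda>\<theta> \<eta>. std_den S \<epsilon> \<theta> \<eta>)"
  unfolding std_den_def
  by (intro separable_add separable_sum separable_mult separable_const separable_S_den separable_of_laurent laurent_coord)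

lemma continuous_on_std_rhs:
  "continuous_on {z. snd z $ None > 0 \<and> std_den S \<epsilon> (fst z) (snd z) \<noteq> 0} (\<lambda>z. std_rhs S \<epsilon> (fst z) (snd z))"
proof -
  let ?D = "{z. snd z $ None > 0 \<and> std_den S \<epsilon> (fst z) (snd z) \<noteq> 0} :: (real \<times> (real ^ 'a option)) set"
  have "continuous_on ?D (\<lambda>z. std_rhs S \<epsilon> (fst z) (snd z) $ j)" for j
  proof -
    have num: "separable (\<lambda>\<theta> \<eta>. \<eta> $ None * (\<Sum>i=1..par_k S. \<epsilon> ^ i * S_num S i \<theta> \<eta> j))"
      by (intro separable_sum separable_mult separable_const separable_S_num separable_of_laurent laurent_coord)
    have "continuous_on ?D (\<lambda>z. snd z $ None * (\<Sum>i=1..par_k S. \<epsilon> ^ i * S_num S i (fst z) (snd z) j))"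
      by (rule continuous_on_subset[OF separable_continuous[OF num]]) auto
    moreover have "continuous_on ?D (\<lambda>z. std_den S \<epsilon> (fst z) (snd z))"
      by (rule continuous_on_subset[OF separable_continuous[OF separable_std_den]]) auto
    ultimately have "continuous_on ?D (\<lambda>z. snd z $ None *
        (\<Sum>i=1..par_k S. \<epsilon> ^ i * S_num S i (fst z) (snd z) j) / std_den S \<epsilon> (fst z) (snd z))"
      by (rule continuous_on_divide) auto
    then show ?thesis by (simp add: std_rhs_def)
  qed
  then have "continuous_on ?D (\<lambda>z. \<chi> j. std_rhs S \<epsilon> (fst z) (snd z) $ j)"
    by (rule continuous_on_vec_lambda)
  then show ?thesis by simp
qed

definition scale :: "'d::finite perturbed \<Rightarrow> real \<Rightarrow> real" where
  "scale S \<epsilon> = \<epsilon> powr (1 / (real (par_m S) - 1))"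

lemma curve_of_eq: "curve_of S \<epsilon> \<phi> = range (\<lambda>\<theta>. scale S \<epsilon> *\<^sub>R polar \<theta> (\<phi> \<theta>))"
  by (simp add: curve_of_def scale_def)

lemma scale_pos: "\<epsilon> > 0 \<Longrightarrow> scale S \<epsilon> > 0"
  by (simp add: scale_def)

lemma scale_power:
  assumes "par_m S \<ge> 2" and "\<epsilon> > 0"
  shows "scale S \<epsilon> ^ (par_m S - 1) = \<epsilon>"
proof -
  have "scale S \<epsilon> ^ (par_m S - 1) = scale S \<epsilon> powr real (par_m S - 1)"
    by (rule powr_realpow[symmetric]) (rule scale_pos[OF assms(2)])
  also have "\<dots> = \<epsilon> powr (1 / (real (par_m S) - 1) * real (par_m S - 1))"
    by (simp add: scale_def powr_powr)
  also have "1 / (real (par_m S) - 1) * real (par_m S - 1) = 1"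
    using assms(1) by (simp add: of_nat_diff)
  finally show ?thesis using assms(2) by simp
qed

lemma std_periodic_closed_orbit:
  assumes "par_m S \<ge> 2" and "\<epsilon> > 0" and "std_periodic S \<epsilon> \<phi>"
  shows "closed_orbit (P_field S \<epsilon>) (curve_of S \<epsilon> \<phi>)"
proof -
  let ?\<sigma> = "scale S \<epsilon>"
  have \<phi>: "\<phi> \<theta> $ None > 0" "std_den S \<epsilon> \<theta> (\<phi> \<theta>) \<noteq> 0"
    "(\<phi> has_vector_derivative std_rhs S \<epsilon> \<theta> (\<phi> \<theta>)) (at \<theta>)" "\<phi> (\<theta> + 2 * pi) = \<phi> \<theta>" for \<theta>
    using assms(3) by (auto simp: std_periodic_def)
  have cont: "continuous_on UNIV \<phi>"
    using \<phi>(3) has_vector_derivative_continuous by (intro continuous_at_imp_continuous_on ballI) blast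
  show ?thesis
    unfolding curve_of_eq
  proof (rule closed_orbit_time_change[where q = "\<lambda>\<theta>. std_den S \<epsilon> \<theta> (\<phi> \<theta>) / \<phi> \<theta> $ None" and P = "2 * pi"
      and c' = "\<lambda>\<theta>. ?\<sigma> *\<^sub>R dpolar \<theta> (\<phi> \<theta>) (std_rhs S \<epsilon> \<theta> (\<phi> \<theta>))" and ?x1.0 = 0 and ?x2.0 = pi])
    show "((\<lambda>\<theta>. ?\<sigma> *\<^sub>R polar \<theta> (\<phi> \<theta>)) has_vector_derivative
        ?\<sigma> *\<^sub>R dpolar \<theta> (\<phi> \<theta>) (std_rhs S \<epsilon> \<theta> (\<phi> \<theta>))) (at \<theta>)" for \<theta>
      by (rule bounded_linear.has_vector_derivative[OF bounded_linear_scaleR_right polar_has_vector_derivative[OF \<phi>(3)]])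
    show "P_field S \<epsilon> (?\<sigma> *\<^sub>R polar \<theta> (\<phi> \<theta>)) = (std_den S \<epsilon> \<theta> (\<phi> \<theta>) / \<phi> \<theta> $ None) *\<^sub>R
        (?\<sigma> *\<^sub>R dpolar \<theta> (\<phi> \<theta>) (std_rhs S \<epsilon> \<theta> (\<phi> \<theta>)))" for \<theta>
      by (rule P_field_polar[OF _ scale_power[OF assms(1,2)]]) (use assms(1) \<phi>[of \<theta>] in auto)
    show "continuous_on UNIV (\<lambda>\<theta>. std_den S \<epsilon> \<theta> (\<phi> \<theta>) / \<phi> \<theta> $ None)"
    proof (rule continuous_on_divide)
      have "continuous_on UNIV (\<lambda>\<theta>. std_den S \<epsilon> (fst (\<theta>, \<phi> \<theta>)) (snd (\<theta>, \<phi> \<theta>)))"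
        by (rule continuous_on_compose2[OF separable_continuous[OF separable_std_den]])
           (use \<phi>(1) cont in \<open>auto intro!: continuous_on_Pair continuous_on_id\<close>)
      then show "continuous_on UNIV (\<lambda>\<theta>. std_den S \<epsilon> \<theta> (\<phi> \<theta>))" by simp
      show "continuous_on UNIV (\<lambda>\<theta>. \<phi> \<theta> $ None)" by (intro continuous_intros cont)
      show "\<forall>\<theta>\<in>UNIV. \<phi> \<theta> $ None \<noteq> 0" using \<phi>(1) by (metis less_irrefl)
    qed
    show "std_den S \<epsilon> \<theta> (\<phi> \<theta>) / \<phi> \<theta> $ None \<noteq> 0" for \<theta> using \<phi>[of \<theta>] by simp
    show "std_den S \<epsilon> (\<theta> + 2 * pi) (\<phi> (\<theta> + 2 * pi)) / \<phi> (\<theta> + 2 * pi) $ None =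
        std_den S \<epsilon> \<theta> (\<phi> \<theta>) / \<phi> \<theta> $ None" for \<theta>
      by (simp add: \<phi>(4) std_cong(1)[of "\<theta> + 2 * pi" \<theta>])
    show "?\<sigma> *\<^sub>R polar (\<theta> + 2 * pi) (\<phi> (\<theta> + 2 * pi)) = ?\<sigma> *\<^sub>R polar \<theta> (\<phi> \<theta>)" for \<theta>
      by (simp add: \<phi>(4) polar_cong[of "\<theta> + 2 * pi" \<theta>])
    \<comment> \<open>The points at \<theta> = 0 and \<theta> = pi have first coordinates of
      opposite sign, so the curve is not constant.\<close>
    have "(?\<sigma> *\<^sub>R polar 0 (\<phi> 0)) $ C1 > 0" "(?\<sigma> *\<^sub>R polar pi (\<phi> pi)) $ C1 < 0"
      using \<phi>(1)[of 0] \<phi>(1)[of pi] scale_pos[OF assms(2), of S] by (simp_all add: polar_def)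
    then show "?\<sigma> *\<^sub>R polar 0 (\<phi> 0) \<noteq> ?\<sigma> *\<^sub>R polar pi (\<phi> pi)" by (metis less_asym)
  qed simp
qed

section \<open>Recovering the initial value from the curve\<close>

text \<open>A left inverse of \<open>\<sigma> *\<^sub>R polar 0\<close>, defined and continuous on
  the whole space, so that preimages of closed sets are closed.\<close>

definition unpolar :: "real \<Rightarrow> real ^ 'd::finite coord \<Rightarrow> real ^ 'd option" where
  "unpolar \<sigma> y = (\<chi> j. case j of None \<Rightarrow> y $ C1 / \<sigma> | Some s \<Rightarrow> y $ CS s / \<sigma>)"

lemma unpolar_polar_0: "\<sigma> \<noteq> 0 \<Longrightarrow> unpolar \<sigma> (\<sigma> *\<^sub>R polar 0 \<eta>) = \<eta>"
  by (simp add: unpolar_def polar_def vec_eq_iff split: option.split)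

lemma continuous_on_unpolar: "continuous_on A (unpolar \<sigma>)"
proof -
  have "continuous_on A (\<lambda>y. case j of None \<Rightarrow> y $ C1 / \<sigma> | Some s \<Rightarrow> y $ CS s / \<sigma>)"
    for j :: "'a option"
    by (cases j) (auto intro!: continuous_intros simp: divide_inverse)
  then show ?thesis unfolding unpolar_def by (intro continuous_intros)
qed

text \<open>As R > 0, the conditions on y force sin \<theta> = 0 and cos \<theta> = 1, so \<theta>
  is a multiple of 2 pi and periodicity returns to \<phi> 0. Thus the curve as a set determines its
  initial value.\<close>

lemma unpolar_curve_section:
  assumes "\<epsilon> > 0" and "std_periodic S \<epsilon> \<phi>" and "y \<in> curve_of S \<epsilon> \<phi>" and "y $ C2 = 0" and "y $ C1 \<ge> 0"
  shows "unpolar (scale S \<epsilon>) y = \<phi> 0"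
proof -
  have \<phi>: "\<phi> \<theta> $ None > 0" "\<phi> (\<theta> + 2 * pi) = \<phi> \<theta>" for \<theta>
    using assms(2) by (auto simp: std_periodic_def)
  have \<sigma>: "scale S \<epsilon> > 0" by (rule scale_pos[OF assms(1)])
  obtain \<theta> where y: "y = scale S \<epsilon> *\<^sub>R polar \<theta> (\<phi> \<theta>)" using assms(3) by (auto simp: curve_of_eq)
  have "sin \<theta> = 0" using assms(4) \<sigma> \<phi>(1)[of \<theta>] by (simp add: y polar_def)
  moreover have "cos \<theta> \<ge> 0" using assms(5) \<sigma> \<phi>(1)[of \<theta>] by (simp add: y polar_def zero_le_mult_iff)
  ultimately have "cos \<theta> = 1" using sin_cos_squared_add[of \<theta>] by (simp add: power2_eq_1_iff)
  then obtain n :: int where n: "\<theta> = of_int n * 2 * pi" using cos_one_2pi_int by blast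
  have "\<phi> \<theta> = \<phi> 0" using periodic_int[of \<phi> "2 * pi" 0 n] \<phi>(2) n by (simp add: mult.assoc)
  moreover have "polar \<theta> (\<phi> 0) = polar 0 (\<phi> 0)"
    using \<open>cos \<theta> = 1\<close> \<open>sin \<theta> = 0\<close> by (intro polar_cong) simp_all
  ultimately show ?thesis using y \<sigma> unpolar_polar_0[of "scale S \<epsilon>" "\<phi> 0"] by simp
qed

text \<open>For k \<ge> 1 the index k occurs in the sum, so v appears exactly once.\<close>

lemma approx_eq:
  assumes "par_k S \<ge> 1"
  shows "approx S \<epsilon> \<theta> (\<eta>, v) = \<eta> + (\<Sum>i=1..par_k S. (\<epsilon> ^ i / fact i) *\<^sub>R y_avg S i \<theta> \<eta>) + \<epsilon> ^ par_k S *\<^sub>R v"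
proof -
  have "(\<Sum>i=1..par_k S. \<epsilon> ^ i *\<^sub>R (if i = par_k S then v else 0)) = \<epsilon> ^ par_k S *\<^sub>R v"
    using assms by (simp add: if_distrib[of "\<lambda>x. _ *\<^sub>R x"] cong: if_cong)
  then show ?thesis
    by (simp add: approx_def correction_def scaleR_add_right sum.distrib flip: One_nat_def cong: if_cong)
qed

lemma f_avg_eq: "f_avg S i \<eta> = (1 / fact i) *\<^sub>R y_avg S i (2 * pi) \<eta>"
  by (simp add: f_avg_def divide_inverse)


section \<open>The displacement after one turn\<close>

text \<open>Everything the counting needs at one value of \<epsilon>. The constant C is a parameter,
  fixed for all small \<epsilon>, so that w is O(\<epsilon>) together with its Lipschitz modulus;
  the constant L, which serves only uniqueness, may depend on \<epsilon>.\<close>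

definition one_turn_flow ::
    "'d::finite perturbed \<Rightarrow> real ^ 'd option \<Rightarrow> real \<Rightarrow> real \<Rightarrow> real \<Rightarrow> real \<Rightarrow> bool" where
  "one_turn_flow S x r r' C \<epsilon> \<longleftrightarrow>
     (\<forall>\<theta>\<in>{0..2*pi}. \<forall>y\<in>ball x r'. std_den S \<epsilon> \<theta> y \<noteq> 0) \<and>
     (\<exists>L\<ge>0. \<forall>\<theta>\<in>{0..2*pi}. \<forall>y\<in>ball x r'. \<forall>z\<in>ball x r'.
        norm (std_rhs S \<epsilon> \<theta> y - std_rhs S \<epsilon> \<theta> z) \<le> L * norm (y - z)) \<and>
     (\<exists>w z. \<forall>\<eta>\<in>cball x r. norm (w \<eta>) \<le> \<epsilon> * C \<and>
        (\<forall>\<eta>'\<in>cball x r. norm (w \<eta> - w \<eta>') \<le> \<epsilon> * C * norm (\<eta> - \<eta>')) \<and>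
        z \<eta> 0 = \<eta> \<and> z \<eta> (2 * pi) = \<eta> + \<epsilon> ^ par_k S *\<^sub>R (f_avg S (par_k S) \<eta> + w \<eta>) \<and>
        (\<forall>\<theta>\<in>{0..2*pi}. z \<eta> \<theta> \<in> ball x r' \<and>
           (z \<eta> has_vector_derivative std_rhs S \<epsilon> \<theta> (z \<eta> \<theta>)) (at \<theta> within {0..2*pi})))"

lemma poincare_map_expansion:
  fixes S :: "'d::finite perturbed" and x :: "real ^ 'd option"
  assumes b: "par_b S \<noteq> 0" and k: "par_k S \<ge> 1"
    and zero: "\<And>i \<eta>. 1 \<le> i \<Longrightarrow> i < par_k S \<Longrightarrow> \<eta> $ None > 0 \<Longrightarrow> f_avg S i \<eta> = 0"
    and x: "x $ None > 0"
  obtains r r' C where "0 < r" and "r < r'" and "ball x r' \<subseteq> {x. x $ None > 0}" and "C \<ge> 0"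
    and "\<forall>\<^sub>F \<epsilon> in at_right 0. one_turn_flow S x r r' C \<epsilon>"
proof -
  let ?T = "{0..2*pi}" and ?V = "cball (0 :: real ^ 'd option) 1" and ?k = "par_k S"
  obtain r0 where r0: "r0 > 0" "cball x r0 \<subseteq> {x. x $ None > 0}"
    using open_contains_cball[of "{x. x $ None > 0}"] open_halfspace x by blast
  \<comment> \<open>The margin between r and r0 absorbs the deviation of the approximate solution
    from its initial value.\<close>
  define r where "r = r0 / 2"
  have r: "0 < r" "r < r0" using r0(1) by (auto simp: r_def)
  let ?K = "cball x r"
  have K0: "?K \<subseteq> {x. x $ None > 0}" using r0(2) r(2) by (meson order_trans less_imp_le subset_cball)
  have bV: "bounded ?V" by (rule bounded_cball)
  have cT: "compact ?T" by (rule compact_Icc)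
  have "\<forall>s. \<exists>\<rho>. unif_lip ?T (?K \<times> ?V) \<rho> \<and>
    (\<forall>\<^sub>F \<epsilon> in at_right 0. \<forall>\<theta>\<in>?T. \<forall>p\<in>?K \<times> ?V.
       std_rhs S \<epsilon> \<theta> (approx S \<epsilon> \<theta> p) $ s =
         (\<Sum>l=1..?k. \<epsilon> ^ l * y_integrand S l \<theta> (fst p) $ s) + \<epsilon> ^ Suc ?k * \<rho> \<epsilon> \<theta> p)"
    by (rule allI, rule averaging_expansion_component[OF b cT r(2) r0(2) bV])
  from choice[OF this] obtain \<rho> where \<rho>: "\<And>s. unif_lip ?T (?K \<times> ?V) (\<rho> s)"
    and eq\<rho>: "\<And>s. \<forall>\<^sub>F \<epsilon> in at_right 0. \<forall>\<theta>\<in>?T. \<forall>p\<in>?K \<times> ?V.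
       std_rhs S \<epsilon> \<theta> (approx S \<epsilon> \<theta> p) $ s =
         (\<Sum>l=1..?k. \<epsilon> ^ l * y_integrand S l \<theta> (fst p) $ s) + \<epsilon> ^ Suc ?k * \<rho> s \<epsilon> \<theta> p"
    by blast
  have ev_eq: "\<forall>\<^sub>F \<epsilon> in at_right 0. \<forall>s. \<forall>\<theta>\<in>?T. \<forall>p\<in>?K \<times> ?V.
       std_rhs S \<epsilon> \<theta> (approx S \<epsilon> \<theta> p) $ s =
         (\<Sum>l=1..?k. \<epsilon> ^ l * y_integrand S l \<theta> (fst p) $ s) + \<epsilon> ^ Suc ?k * \<rho> s \<epsilon> \<theta> p"
    by (rule eventually_all_finite) (rule eq\<rho>)
  define P where "P \<epsilon> \<theta> p = (\<chi> s. \<rho> s \<epsilon> \<theta> p)" for \<epsilon> \<theta> p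
  obtain B where B0: "B \<ge> 0" and ev_B: "\<forall>\<^sub>F \<epsilon> in at_right 0. \<forall>\<theta>\<in>?T. \<forall>p\<in>?K \<times> ?V. norm (P \<epsilon> \<theta> p) \<le> B \<and>
    (\<forall>q\<in>?K \<times> ?V. dist (P \<epsilon> \<theta> p) (P \<epsilon> \<theta> q) \<le> B * dist p q)"
    using unif_lip_vec[of ?T "?K \<times> ?V" P] \<rho> by (auto simp: P_def)
  have rhsBL: "unif_lip ?T (cball x r0) (\<lambda>\<epsilon> \<theta> \<eta>. std_rhs S \<epsilon> \<theta> \<eta> $ s)" for s
    by (rule expands_imp_unif_lip[OF expands_std_rhs[OF b cT compact_cball r0(2), of 0]])
  obtain L where L0: "L \<ge> 0" and ev_L: "\<forall>\<^sub>F \<epsilon> in at_right 0. \<forall>\<theta>\<in>?T. \<forall>p\<in>cball x r0.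
      norm (std_rhs S \<epsilon> \<theta> p) \<le> L \<and> (\<forall>q\<in>cball x r0. dist (std_rhs S \<epsilon> \<theta> p) (std_rhs S \<epsilon> \<theta> q) \<le> L * dist p q)"
    using unif_lip_vec[of ?T "cball x r0" "std_rhs S", OF rhsBL] by blast
  obtain c where "c > 0" and ev_den: "\<forall>\<^sub>F \<epsilon> in at_right 0. \<forall>\<theta>\<in>?T. \<forall>p\<in>cball x r0. c \<le> \<bar>std_den S \<epsilon> \<theta> p\<bar>"
    by (rule std_den_lower_bound[OF b cT compact_cball r0(2)]) blast
  have "r0 - r > 0" using r by simp
  note ev_close = approx_close[OF b cT compact_cball K0 bV this]
  \<comment> \<open>This gives 2 pi \<epsilon> B \<le> 1/2, which supplies both conditions of
    \<open>volterra_solution\<close> on the interval of length 2 pi.\<close>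
  have ev_\<epsilon>: "\<forall>\<^sub>F \<epsilon> in at_right 0. \<epsilon> \<in> {0<..<1 / (4 * pi * (B + 1))}"
    by (rule eventually_at_right_real) (use B0 in simp)
  \<comment> \<open>A length 2 pi times B, doubled because half of the supremum is absorbed in the
    Lipschitz estimate for V.\<close>
  define C where "C = 4 * pi * B"
  show ?thesis
  proof (rule that[OF r])
    show "ball x r0 \<subseteq> {x. x $ None > 0}" using r0(2) ball_subset_cball by blast
    show "C \<ge> 0" using B0 by (simp add: C_def)
    show "\<forall>\<^sub>F \<epsilon> in at_right 0. one_turn_flow S x r r0 C \<epsilon>"
      using ev_eq ev_B ev_L ev_den ev_close ev_\<epsilon>
    proof eventually_elim
      case (elim \<epsilon>)
      note E_eq = elim(1) and E_B = elim(2) and E_L = elim(3) and E_den = elim(4) and E_close = elim(5)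
      have \<epsilon>: "\<epsilon> > 0" "\<epsilon> * (4 * pi * (B + 1)) < 1"
        using elim(6) B0 pos_less_divide_eq[of "4 * pi * (B + 1)" \<epsilon> 1] by auto
      have small: "2 * pi * (\<epsilon> * B) \<le> 1 / 2"
      proof -
        have "\<epsilon> * (4 * pi * B) \<le> \<epsilon> * (4 * pi * (B + 1))" using \<epsilon>(1) by simp
        then show ?thesis using \<epsilon>(2) by (simp add: algebra_simps)
      qed
      have den: "std_den S \<epsilon> \<theta> y \<noteq> 0" if "\<theta> \<in> ?T" "y \<in> cball x r0" for \<theta> y
        using E_den that \<open>c > 0\<close> by fastforce
      have near: "approx S \<epsilon> \<theta> (\<eta>, v) \<in> ball x r0" if "\<theta> \<in> ?T" "\<eta> \<in> ?K" "v \<in> ?V" for \<theta> \<eta> v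
      proof -
        have "norm (approx S \<epsilon> \<theta> (\<eta>, v) - \<eta>) < r0 - r" using E_close that by force
        then have "dist \<eta> (approx S \<epsilon> \<theta> (\<eta>, v)) < r0 - r" by (simp add: dist_norm norm_minus_commute)
        moreover have "dist x \<eta> \<le> r" using that by simp
        ultimately show ?thesis using dist_triangle[of x "approx S \<epsilon> \<theta> (\<eta>, v)" \<eta>] by simp
      qed
      have rhs: "std_rhs S \<epsilon> \<theta> (approx S \<epsilon> \<theta> (\<eta>, v)) =
          (\<Sum>l=1..?k. \<epsilon> ^ l *\<^sub>R y_integrand S l \<theta> \<eta>) + \<epsilon> ^ Suc ?k *\<^sub>R P \<epsilon> \<theta> (\<eta>, v)"
        if "\<theta> \<in> ?T" "\<eta> \<in> ?K" "v \<in> ?V" for \<theta> \<eta> v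
        unfolding vec_eq_iff using E_eq that by (simp add: P_def)
      have pos: "\<eta> $ None > 0" if "\<eta> \<in> ?K" for \<eta> using K0 that by blast
      have y_cont: "continuous_on A (\<lambda>\<theta>. y_avg S i \<theta> \<eta>)" if "\<eta> \<in> ?K" for A i \<eta>
        by (rule continuous_on_separable_vec[OF separable_y_avg[OF b] pos[OF that]])
      have i_cont: "continuous_on A (\<lambda>\<theta>. y_integrand S i \<theta> \<eta>)" if "\<eta> \<in> ?K" for A i \<eta>
        by (rule continuous_on_separable_vec[OF separable_y_integrand[OF b] pos[OF that]])
      \<comment> \<open>The remainder P came only with bounds and a Lipschitz modulus in (\<eta>,
        v). Its joint continuity in \<theta> and v follows by solving the expansion identity for P,
        since all other terms are continuous and \<epsilon> is not 0.\<close>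
      have P_cont: "continuous_on (?T \<times> ?V) (\<lambda>z. \<epsilon> *\<^sub>R P \<epsilon> (fst z) (\<eta>, snd z))" if \<eta>: "\<eta> \<in> ?K" for \<eta>
      proof -
        have a: "continuous_on (?T \<times> ?V) (\<lambda>z. approx S \<epsilon> (fst z) (\<eta>, snd z))"
          unfolding approx_eq[OF k]
          by (intro continuous_intros continuous_on_compose2[OF y_cont[OF \<eta>, of UNIV]]) auto
        have "continuous_on (?T \<times> ?V) (\<lambda>z. std_rhs S \<epsilon> (fst (fst z, approx S \<epsilon> (fst z) (\<eta>, snd z)))
             (snd (fst z, approx S \<epsilon> (fst z) (\<eta>, snd z))))"
        proof (rule continuous_on_compose2[OF continuous_on_std_rhs[of S \<epsilon>]])
          show "continuous_on (?T \<times> ?V) (\<lambda>z. (fst z, approx S \<epsilon> (fst z) (\<eta>, snd z)))"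
            by (intro continuous_on_Pair a continuous_intros)
          show "(\<lambda>z. (fst z, approx S \<epsilon> (fst z) (\<eta>, snd z))) ` (?T \<times> ?V) \<subseteq>
              {z. snd z $ None > 0 \<and> std_den S \<epsilon> (fst z) (snd z) \<noteq> 0}"
          proof (rule image_subsetI)
            fix z assume "z \<in> ?T \<times> ?V"
            then have "fst z \<in> ?T" "snd z \<in> ?V" by auto
            from near[OF this(1) \<eta> this(2)] have a: "approx S \<epsilon> (fst z) (\<eta>, snd z) \<in> cball x r0"
              using ball_subset_cball by blast
            then show "(fst z, approx S \<epsilon> (fst z) (\<eta>, snd z)) \<in>
              {z. snd z $ None > 0 \<and> std_den S \<epsilon> (fst z) (snd z) \<noteq> 0}"
              using r0(2) den[OF \<open>fst z \<in> ?T\<close> a] by auto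
          qed
        qed
        then have "continuous_on (?T \<times> ?V) (\<lambda>z. \<epsilon> *\<^sub>R (1 / \<epsilon> ^ Suc ?k) *\<^sub>R (std_rhs S \<epsilon> (fst z) (approx S \<epsilon> (fst z) (\<eta>, snd z))
            - (\<Sum>l=1..?k. \<epsilon> ^ l *\<^sub>R y_integrand S l (fst z) \<eta>)))"
          by (intro continuous_intros continuous_on_compose2[OF i_cont[OF \<eta>, of UNIV]]) auto
        then show ?thesis
        proof (rule continuous_on_eq)
          fix z assume "z \<in> ?T \<times> ?V"
          then have "fst z \<in> ?T" "snd z \<in> ?V" by auto
          from rhs[OF this(1) \<eta> this(2)] \<epsilon>(1)
          show "\<epsilon> *\<^sub>R (1 / \<epsilon> ^ Suc ?k) *\<^sub>R (std_rhs S \<epsilon> (fst z) (approx S \<epsilon> (fst z) (\<eta>, snd z))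
            - (\<Sum>l=1..?k. \<epsilon> ^ l *\<^sub>R y_integrand S l (fst z) \<eta>)) = \<epsilon> *\<^sub>R P \<epsilon> (fst z) (\<eta>, snd z)"
            by simp
        qed
      qed
      have P_bound: "norm (\<epsilon> *\<^sub>R P \<epsilon> \<tau> (\<eta>, v)) \<le> \<epsilon> * B" if "\<tau> \<in> ?T" "\<eta> \<in> ?K" "v \<in> ?V" for \<tau> \<eta> v
        using E_B that \<epsilon>(1) by (auto intro!: mult_left_mono)
      have P_lip: "norm (\<epsilon> *\<^sub>R P \<epsilon> \<tau> (\<eta>, v) - \<epsilon> *\<^sub>R P \<epsilon> \<tau> (\<eta>', v')) \<le> \<epsilon> * B * (norm (\<eta> - \<eta>') + norm (v - v'))"
        if "\<tau> \<in> ?T" "\<eta> \<in> ?K" "v \<in> ?V" "\<eta>' \<in> ?K" "v' \<in> ?V" for \<tau> \<eta> v \<eta>' v'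
      proof -
        have "norm (P \<epsilon> \<tau> (\<eta>, v) - P \<epsilon> \<tau> (\<eta>', v')) \<le> B * dist (\<eta>, v) (\<eta>', v')"
          using E_B that unfolding dist_norm[of "P _ _ _"] by blast
        also have "\<dots> \<le> B * (norm (\<eta> - \<eta>') + norm (v - v'))"
          using norm_Pair_le[of "\<eta> - \<eta>'" "v - v'"] by (intro mult_left_mono B0) (simp add: dist_norm)
        finally show ?thesis using \<epsilon>(1) by (simp flip: scaleR_diff_right add: mult.assoc)
      qed
      have "\<forall>\<eta>\<in>?K. \<exists>v. continuous_on ?T v \<and> (\<forall>\<theta>\<in>?T. norm (v \<theta>) \<le> 1) \<and>
         (\<forall>\<theta>\<in>?T. v \<theta> = integral {0..\<theta>} (\<lambda>\<tau>. \<epsilon> *\<^sub>R P \<epsilon> \<tau> (\<eta>, v \<tau>)))"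
      proof
        fix \<eta> assume \<eta>: "\<eta> \<in> ?K"
        show "\<exists>v. continuous_on ?T v \<and> (\<forall>\<theta>\<in>?T. norm (v \<theta>) \<le> 1) \<and>
         (\<forall>\<theta>\<in>?T. v \<theta> = integral {0..\<theta>} (\<lambda>\<tau>. \<epsilon> *\<^sub>R P \<epsilon> \<tau> (\<eta>, v \<tau>)))"
        proof (rule volterra_solution[where g = "\<lambda>\<tau> v. \<epsilon> *\<^sub>R P \<epsilon> \<tau> (\<eta>, v)" and b = "2 * pi" and M = "\<epsilon> * B" and L = "\<epsilon> * B"])
          show "continuous_on (?T \<times> ?V) (\<lambda>z. \<epsilon> *\<^sub>R P \<epsilon> (fst z) (\<eta>, snd z))" by (rule P_cont[OF \<eta>])
          show "norm (\<epsilon> *\<^sub>R P \<epsilon> \<tau> (\<eta>, v)) \<le> \<epsilon> * B" if "\<tau> \<in> ?T" "v \<in> ?V" for \<tau> v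
            by (rule P_bound[OF that(1) \<eta> that(2)])
          show "norm (\<epsilon> *\<^sub>R P \<epsilon> \<tau> (\<eta>, v) - \<epsilon> *\<^sub>R P \<epsilon> \<tau> (\<eta>, w)) \<le> \<epsilon> * B * norm (v - w)"
            if "\<tau> \<in> ?T" "v \<in> ?V" "w \<in> ?V" for \<tau> v w
            using P_lip[OF that(1) \<eta> that(2) \<eta> that(3)] by simp
        qed (use small \<epsilon>(1) B0 in auto)
      qed
      from bchoice[OF this] obtain V where V_cont: "\<And>\<eta>. \<eta> \<in> ?K \<Longrightarrow> continuous_on ?T (V \<eta>)"
        and V_norm': "\<And>\<eta> \<theta>. \<eta> \<in> ?K \<Longrightarrow> \<theta> \<in> ?T \<Longrightarrow> norm (V \<eta> \<theta>) \<le> 1"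
        and V_eq: "\<And>\<eta> \<theta>. \<eta> \<in> ?K \<Longrightarrow> \<theta> \<in> ?T \<Longrightarrow> V \<eta> \<theta> = integral {0..\<theta>} (\<lambda>\<tau>. \<epsilon> *\<^sub>R P \<epsilon> \<tau> (\<eta>, V \<eta> \<tau>))"
        by blast
      have V_norm: "V \<eta> \<theta> \<in> ?V" if "\<eta> \<in> ?K" "\<theta> \<in> ?T" for \<eta> \<theta>
        using V_norm'[OF that] by simp
      have PV_cont: "continuous_on ?T (\<lambda>\<tau>. \<epsilon> *\<^sub>R P \<epsilon> \<tau> (\<eta>, V \<eta> \<tau>))" if \<eta>: "\<eta> \<in> ?K" for \<eta>
      proof -
        have "continuous_on ?T (\<lambda>\<tau>. \<epsilon> *\<^sub>R P \<epsilon> (fst (\<tau>, V \<eta> \<tau>)) (\<eta>, snd (\<tau>, V \<eta> \<tau>)))"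
          by (rule continuous_on_compose2[OF P_cont[OF \<eta>]])
             (use V_cont[OF \<eta>] V_norm[OF \<eta>] in \<open>auto intro!: continuous_on_Pair continuous_on_id\<close>)
        then show ?thesis by simp
      qed
      have int_bound: "norm (integral {0..\<theta>} h) \<le> 2 * pi * c" if "continuous_on ?T h" "\<And>\<tau>. \<tau> \<in> ?T \<Longrightarrow> norm (h \<tau>) \<le> c"
        "\<theta> \<in> ?T" for h :: "real \<Rightarrow> real ^ 'd option" and c \<theta>
      proof -
        have c0: "c \<ge> 0" using that(2)[of 0] order_trans[OF norm_ge_zero] by auto
        have "norm (integral {0..\<theta>} h) \<le> c * (\<theta> - 0)"
          by (rule integral_bound) (use that in \<open>auto intro: continuous_on_subset\<close>)
        also have "\<dots> \<le> c * (2 * pi)" using that(3) c0 by (intro mult_left_mono) auto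
        finally show ?thesis by (simp add: mult_ac)
      qed
      have two_pi: "2 * pi \<in> ?T" "0 \<in> ?T" by auto
      have V_small: "norm (V \<eta> (2 * pi)) \<le> \<epsilon> * C" if \<eta>: "\<eta> \<in> ?K" for \<eta>
      proof -
        have "norm (V \<eta> (2 * pi)) \<le> 2 * pi * (\<epsilon> * B)"
          unfolding V_eq[OF \<eta> two_pi(1)]
          by (rule int_bound[OF PV_cont[OF \<eta>] _ two_pi(1)]) (rule P_bound[OF _ \<eta> V_norm[OF \<eta>]])
        also have "\<dots> \<le> \<epsilon> * C" using \<epsilon>(1) B0 by (simp add: C_def)
        finally show ?thesis .
      qed
      have V_lip: "norm (V \<eta> (2 * pi) - V \<eta>' (2 * pi)) \<le> \<epsilon> * C * norm (\<eta> - \<eta>')"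
        if \<eta>: "\<eta> \<in> ?K" "\<eta>' \<in> ?K" for \<eta> \<eta>'
      proof -
        \<comment> \<open>At a time t of maximal difference ?m the integral equation gives ?m \<le>
          2 pi \<epsilon> B norm (\<eta> - \<eta>') + ?m / 2; this replaces a Gronwall
          estimate.\<close>
        have "continuous_on ?T (\<lambda>\<theta>. norm (V \<eta> \<theta> - V \<eta>' \<theta>))"
          by (intro continuous_intros V_cont \<eta>)
        from continuous_attains_sup[OF cT _ this] two_pi(1) obtain t where t: "t \<in> ?T"
          "\<And>\<theta>. \<theta> \<in> ?T \<Longrightarrow> norm (V \<eta> \<theta> - V \<eta>' \<theta>) \<le> norm (V \<eta> t - V \<eta>' t)" by blast
        let ?m = "norm (V \<eta> t - V \<eta>' t)"
        have int: "(\<lambda>\<tau>. \<epsilon> *\<^sub>R P \<epsilon> \<tau> (\<eta>, V \<eta> \<tau>)) integrable_on {0..t}" if "\<eta> \<in> ?K" for \<eta>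
          by (rule integrable_continuous_interval, rule continuous_on_subset[OF PV_cont[OF that]]) (use t(1) in auto)
        have "V \<eta> t - V \<eta>' t = integral {0..t} (\<lambda>\<tau>. \<epsilon> *\<^sub>R P \<epsilon> \<tau> (\<eta>, V \<eta> \<tau>) - \<epsilon> *\<^sub>R P \<epsilon> \<tau> (\<eta>', V \<eta>' \<tau>))"
          unfolding V_eq[OF \<eta>(1) t(1)] V_eq[OF \<eta>(2) t(1)]
          by (rule integral_diff[symmetric]) (rule int[OF \<eta>(1)], rule int[OF \<eta>(2)])
        also have "norm \<dots> \<le> 2 * pi * (\<epsilon> * B * (norm (\<eta> - \<eta>') + ?m))"
        proof (rule int_bound[OF _ _ t(1)])
          fix \<tau> assume \<tau>: "\<tau> \<in> ?T"
          have "norm (\<epsilon> *\<^sub>R P \<epsilon> \<tau> (\<eta>, V \<eta> \<tau>) - \<epsilon> *\<^sub>R P \<epsilon> \<tau> (\<eta>', V \<eta>' \<tau>)) \<le>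
              \<epsilon> * B * (norm (\<eta> - \<eta>') + norm (V \<eta> \<tau> - V \<eta>' \<tau>))"
            by (intro P_lip \<tau> \<eta> V_norm)
          also have "\<dots> \<le> \<epsilon> * B * (norm (\<eta> - \<eta>') + ?m)"
            using t(2)[OF \<tau>] \<epsilon>(1) B0 by (intro mult_left_mono add_left_mono) auto
          finally show "norm (\<epsilon> *\<^sub>R P \<epsilon> \<tau> (\<eta>, V \<eta> \<tau>) - \<epsilon> *\<^sub>R P \<epsilon> \<tau> (\<eta>', V \<eta>' \<tau>)) \<le>
            \<epsilon> * B * (norm (\<eta> - \<eta>') + ?m)" .
        qed (intro continuous_on_diff PV_cont \<eta>)
        also have "\<dots> = 2 * pi * (\<epsilon> * B) * norm (\<eta> - \<eta>') + 2 * pi * (\<epsilon> * B) * ?m"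
          by (simp add: algebra_simps)
        also have "\<dots> \<le> 2 * pi * (\<epsilon> * B) * norm (\<eta> - \<eta>') + 1 / 2 * ?m"
          by (intro add_left_mono mult_right_mono small) simp
        finally have "?m \<le> 2 * (2 * pi * (\<epsilon> * B) * norm (\<eta> - \<eta>'))" by linarith
        also have "\<dots> = \<epsilon> * C * norm (\<eta> - \<eta>')" by (simp add: C_def)
        finally show ?thesis using t(2)[OF two_pi(1)] by linarith
      qed
      define z where "z \<eta> \<theta> = approx S \<epsilon> \<theta> (\<eta>, V \<eta> \<theta>)" for \<eta> \<theta>
      have z0: "z \<eta> 0 = \<eta>" if \<eta>: "\<eta> \<in> ?K" for \<eta>
        using V_eq[OF \<eta> two_pi(2)] by (simp add: z_def approx_eq[OF k] y_avg_0)
      have z2pi: "z \<eta> (2 * pi) = \<eta> + \<epsilon> ^ ?k *\<^sub>R (f_avg S ?k \<eta> + V \<eta> (2 * pi))" if \<eta>: "\<eta> \<in> ?K" for \<eta>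
      proof -
        have "(\<Sum>i=1..?k. (\<epsilon> ^ i / fact i) *\<^sub>R y_avg S i (2 * pi) \<eta>) = (\<Sum>i=1..?k. \<epsilon> ^ i *\<^sub>R f_avg S i \<eta>)"
          by (simp add: f_avg_eq)
        \<comment> \<open>After a full turn the terms of order below k are averaged functions, which
          vanish by hypothesis.\<close>
        also have "\<dots> = (\<Sum>i\<in>{?k}. \<epsilon> ^ i *\<^sub>R f_avg S i \<eta>)"
        proof (rule sum.mono_neutral_right)
          show "\<forall>i\<in>{1..?k} - {?k}. \<epsilon> ^ i *\<^sub>R f_avg S i \<eta> = 0"
            using zero[OF _ _ pos[OF \<eta>]] by auto
        qed (use k in auto)
        finally show ?thesis
          unfolding z_def approx_eq[OF k] by (simp add: scaleR_add_right)
      qed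
      have zder: "(z \<eta> has_vector_derivative std_rhs S \<epsilon> \<theta> (z \<eta> \<theta>)) (at \<theta> within ?T)"
        if \<eta>: "\<eta> \<in> ?K" and \<theta>: "\<theta> \<in> ?T" for \<eta> \<theta>
      proof -
        have "(V \<eta> has_vector_derivative \<epsilon> *\<^sub>R P \<epsilon> \<theta> (\<eta>, V \<eta> \<theta>)) (at \<theta> within ?T)"
          by (rule has_vector_derivative_transform[OF \<theta> _ integral_has_vector_derivative[OF PV_cont[OF \<eta>] \<theta>]])
             (rule V_eq[OF \<eta>])
        then have "((\<lambda>\<theta>. \<eta> + (\<Sum>i=1..?k. (\<epsilon> ^ i / fact i) *\<^sub>R y_avg S i \<theta> \<eta>) + \<epsilon> ^ ?k *\<^sub>R V \<eta> \<theta>)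
           has_vector_derivative 0 + (\<Sum>i=1..?k. (\<epsilon> ^ i / fact i) *\<^sub>R (fact i *\<^sub>R y_integrand S i \<theta> \<eta>)) +
             \<epsilon> ^ ?k *\<^sub>R (\<epsilon> *\<^sub>R P \<epsilon> \<theta> (\<eta>, V \<eta> \<theta>))) (at \<theta> within ?T)"
          by (intro has_vector_derivative_add has_vector_derivative_const has_vector_derivative_sum
                bounded_linear.has_vector_derivative[OF bounded_linear_scaleR_right]
                y_avg_has_vector_derivative[OF b pos[OF \<eta>] \<theta>])
        \<comment> \<open>The factorials cancel, and the derivative is exactly the expansion of the
          right-hand side at the point \<open>z \<eta> \<theta>\<close>.\<close>
        moreover have "0 + (\<Sum>i=1..?k. (\<epsilon> ^ i / fact i) *\<^sub>R (fact i *\<^sub>R y_integrand S i \<theta> \<eta>)) +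
             \<epsilon> ^ ?k *\<^sub>R (\<epsilon> *\<^sub>R P \<epsilon> \<theta> (\<eta>, V \<eta> \<theta>)) = std_rhs S \<epsilon> \<theta> (z \<eta> \<theta>)"
          unfolding z_def rhs[OF \<theta> \<eta> V_norm[OF \<eta> \<theta>]] by (simp add: mult.commute)
        ultimately show ?thesis
          unfolding z_def[abs_def] approx_eq[OF k] by simp
      qed
      have znear: "z \<eta> \<theta> \<in> ball x r0" if "\<eta> \<in> ?K" "\<theta> \<in> ?T" for \<eta> \<theta>
        unfolding z_def by (rule near[OF that(2,1) V_norm[OF that]])
      have lip: "norm (std_rhs S \<epsilon> \<theta> y - std_rhs S \<epsilon> \<theta> z) \<le> L * norm (y - z)"
        if "\<theta> \<in> ?T" "y \<in> ball x r0" "z \<in> ball x r0" for \<theta> y z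
        using E_L that ball_subset_cball[of x r0] by (auto simp: dist_norm)
      show ?case
        unfolding one_turn_flow_def
      proof (intro conjI)
        show "\<forall>\<theta>\<in>?T. \<forall>y\<in>ball x r0. std_den S \<epsilon> \<theta> y \<noteq> 0"
          using den ball_subset_cball by blast
      next
        show "\<exists>L\<ge>0. \<forall>\<theta>\<in>?T. \<forall>y\<in>ball x r0. \<forall>z\<in>ball x r0.
         norm (std_rhs S \<epsilon> \<theta> y - std_rhs S \<epsilon> \<theta> z) \<le> L * norm (y - z)"
          using L0 lip by blast
      qed (intro exI[of _ "\<lambda>\<eta>. V \<eta> (2 * pi)"] exI[of _ z] ballI conjI V_small V_lip z0 z2pi znear zder)
    qed
  qed
qed

lemma angle_reduction:
  obtains t and n :: int where "t \<in> {0..2*pi}" and "\<theta> = t + of_int n * (2 * pi)"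
proof
  show "\<theta> - of_int \<lfloor>\<theta> / (2 * pi)\<rfloor> * (2 * pi) \<in> {0..2*pi}"
    using floor_divide_lower[of "2 * pi" \<theta>] floor_divide_upper[of "2 * pi" \<theta>] by (simp add: algebra_simps)
qed simp

lemma laurent_f_avg:
  assumes "par_b S \<noteq> 0"
  shows "laurent (\<lambda>\<eta>. f_avg S i \<eta> $ j)"
proof -
  have "laurent (\<lambda>\<eta>. 1 / fact i * y_avg S i (2 * pi) \<eta> $ j)"
    by (intro laurent_mult laurent_const separable_imp_laurent[OF separable_y_avg[OF assms]])
  then show ?thesis by (simp add: f_avg_eq)
qed

text \<open>Existence refers to the small radius \<delta>, uniqueness to the fixed radius d. The
  bound M on whole solutions lets the rescaled curves enter any ball around the origin.\<close>

definition unique_continuation ::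
    "'d::finite perturbed \<Rightarrow> real ^ 'd option \<Rightarrow> real \<Rightarrow> real \<Rightarrow> real \<Rightarrow> real \<Rightarrow> bool" where
  "unique_continuation S x d M \<delta> \<epsilon> \<longleftrightarrow>
     (\<exists>\<phi>. std_periodic S \<epsilon> \<phi> \<and> \<phi> 0 \<in> ball x \<delta>) \<and>
     (\<forall>\<phi> \<psi>. std_periodic S \<epsilon> \<phi> \<longrightarrow> std_periodic S \<epsilon> \<psi> \<longrightarrow> \<phi> 0 \<in> cball x d \<longrightarrow> \<psi> 0 \<in> cball x d \<longrightarrow> \<phi> = \<psi>) \<and>
     (\<forall>\<phi> \<theta>. std_periodic S \<epsilon> \<phi> \<longrightarrow> \<phi> 0 \<in> cball x d \<longrightarrow> norm (\<phi> \<theta>) \<le> M)"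

lemma simple_zero_continuation:
  fixes S :: "'d::finite perturbed"
  assumes b: "par_b S \<noteq> 0" and k: "par_k S \<ge> 1"
    and zero: "\<And>i \<eta>. 1 \<le> i \<Longrightarrow> i < par_k S \<Longrightarrow> \<eta> $ None > 0 \<Longrightarrow> f_avg S i \<eta> = 0"
    and x: "x \<in> simple_zeros S"
  obtains d M where "0 < d"
    and "\<forall>\<delta>. 0 < \<delta> \<longrightarrow> \<delta> \<le> d \<longrightarrow> (\<forall>\<^sub>F \<epsilon> in at_right 0. unique_continuation S x d M \<delta> \<epsilon>)"
proof -
  let ?T = "{0..2*pi}" and ?k = "par_k S" and ?f = "f_avg S (par_k S)"
  have x0: "x $ None > 0" and fx: "?f x = 0" and Dx: "det (jacobian ?f (at x)) \<noteq> 0"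
    using x by (auto simp: simple_zeros_def D_avg_def)
  obtain r r' C where r: "0 < r" "r < r'" and half: "ball x r' \<subseteq> {x. x $ None > 0}" and C: "C \<ge> 0"
    and ev: "\<forall>\<^sub>F \<epsilon> in at_right 0. one_turn_flow S x r r' C \<epsilon>"
    using poincare_map_expansion[OF b k zero x0] by blast
  obtain d where d: "0 < d" "d \<le> r" and pert: "\<And>\<delta>. 0 < \<delta> \<Longrightarrow> \<delta> \<le> d \<Longrightarrow> \<exists>\<kappa>>0. \<forall>g.
    (\<forall>y\<in>cball x d. norm (g y) \<le> \<kappa>) \<and> (\<forall>y\<in>cball x d. \<forall>z\<in>cball x d. norm (g y - g z) \<le> \<kappa> * norm (y - z))
    \<longrightarrow> (\<exists>y\<in>ball x \<delta>. ?f y + g y = 0) \<and>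
        (\<forall>y\<in>cball x d. \<forall>z\<in>cball x d. ?f y + g y = 0 \<longrightarrow> ?f z + g z = 0 \<longrightarrow> y = z)"
    using perturbed_simple_zero[OF laurent_f_avg[OF b, of ?k] x0 fx Dx r(1)] by blast
  have sub: "cball x d \<subseteq> cball x r" using d(2) by auto
  show ?thesis
  proof (rule that[of d "norm x + r'", OF d(1)], intro allI impI)
    fix \<delta> :: real assume \<delta>: "0 < \<delta>" "\<delta> \<le> d"
    obtain \<kappa> where \<kappa>: "\<kappa> > 0" and pert\<kappa>: "\<And>g.
      \<forall>y\<in>cball x d. norm (g y) \<le> \<kappa> \<Longrightarrow> \<forall>y\<in>cball x d. \<forall>z\<in>cball x d. norm (g y - g z) \<le> \<kappa> * norm (y - z)
      \<Longrightarrow> (\<exists>y\<in>ball x \<delta>. ?f y + g y = 0) \<and>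
        (\<forall>y\<in>cball x d. \<forall>z\<in>cball x d. ?f y + g y = 0 \<longrightarrow> ?f z + g z = 0 \<longrightarrow> y = z)"
      using pert[OF \<delta>] by blast
    \<comment> \<open>This makes both bounds on w, which are \<epsilon> C, at most \<kappa>.\<close>
    have "\<forall>\<^sub>F \<epsilon> in at_right 0. \<epsilon> \<in> {0<..<\<kappa> / (C + 1)}"
      by (rule eventually_at_right_real) (use \<kappa> C in simp)
    with ev show "\<forall>\<^sub>F \<epsilon> in at_right 0. unique_continuation S x d (norm x + r') \<delta> \<epsilon>"
    proof eventually_elim
      case (elim \<epsilon>)
      have \<epsilon>: "\<epsilon> > 0" "\<epsilon> * C \<le> \<kappa>"
      proof -
        show "\<epsilon> > 0" using elim(2) by simp
        have "\<epsilon> * (C + 1) < \<kappa>" using elim(2) pos_less_divide_eq[of "C + 1" \<epsilon> \<kappa>] C by simp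
        then show "\<epsilon> * C \<le> \<kappa>" using \<open>\<epsilon> > 0\<close> by (simp add: algebra_simps)
      qed
      note flow = elim(1)[unfolded one_turn_flow_def]
      from flow have den: "\<And>\<theta> y. \<theta> \<in> ?T \<Longrightarrow> y \<in> ball x r' \<Longrightarrow> std_den S \<epsilon> \<theta> y \<noteq> 0" by blast
      from flow obtain L where L: "L \<ge> 0" "\<And>\<theta> y z. \<theta> \<in> ?T \<Longrightarrow> y \<in> ball x r' \<Longrightarrow> z \<in> ball x r' \<Longrightarrow>
         norm (std_rhs S \<epsilon> \<theta> y - std_rhs S \<epsilon> \<theta> z) \<le> L * norm (y - z)" by blast
      from flow obtain w z where w: "\<And>\<eta>. \<eta> \<in> cball x r \<Longrightarrow> norm (w \<eta>) \<le> \<epsilon> * C"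
        "\<And>\<eta> \<eta>'. \<eta> \<in> cball x r \<Longrightarrow> \<eta>' \<in> cball x r \<Longrightarrow> norm (w \<eta> - w \<eta>') \<le> \<epsilon> * C * norm (\<eta> - \<eta>')"
        and z0: "\<And>\<eta>. \<eta> \<in> cball x r \<Longrightarrow> z \<eta> 0 = \<eta>"
        and z2pi: "\<And>\<eta>. \<eta> \<in> cball x r \<Longrightarrow> z \<eta> (2 * pi) = \<eta> + \<epsilon> ^ ?k *\<^sub>R (?f \<eta> + w \<eta>)"
        and zin: "\<And>\<eta> \<theta>. \<eta> \<in> cball x r \<Longrightarrow> \<theta> \<in> ?T \<Longrightarrow> z \<eta> \<theta> \<in> ball x r'"
        and zder: "\<And>\<eta> \<theta>. \<eta> \<in> cball x r \<Longrightarrow> \<theta> \<in> ?T \<Longrightarrow>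
          (z \<eta> has_vector_derivative std_rhs S \<epsilon> \<theta> (z \<eta> \<theta>)) (at \<theta> within ?T)"
        by blast
      have main: "(\<exists>y\<in>ball x \<delta>. ?f y + w y = 0) \<and>
        (\<forall>y\<in>cball x d. \<forall>z\<in>cball x d. ?f y + w y = 0 \<longrightarrow> ?f z + w z = 0 \<longrightarrow> y = z)"
      proof (rule pert\<kappa>)
        show "\<forall>y\<in>cball x d. norm (w y) \<le> \<kappa>" using w(1) \<epsilon>(2) sub by (meson order_trans subsetD)
        have "\<epsilon> * C * norm (y - z) \<le> \<kappa> * norm (y - z)" for y z :: "real ^ 'd option"
          by (rule mult_right_mono[OF \<epsilon>(2)]) simp
        then show "\<forall>y\<in>cball x d. \<forall>z\<in>cball x d. norm (w y - w z) \<le> \<kappa> * norm (y - z)"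
          using w(2) sub by (meson order_trans subsetD)
      qed
      \<comment> \<open>The given periodic solution is not known to stay near x;
        \<open>ode_unique\<close> only needs the constructed solution z to do so.\<close>
      have on_T: "\<phi> \<theta> = z (\<phi> 0) \<theta>" if \<phi>: "std_periodic S \<epsilon> \<phi>" "\<phi> 0 \<in> cball x r" and "\<theta> \<in> ?T" for \<phi> \<theta>
      proof (rule ode_unique[where h = "std_rhs S \<epsilon>" and U = "ball x r'" and b = "2 * pi" and L = L])
        show "(\<phi> has_vector_derivative std_rhs S \<epsilon> \<theta> (\<phi> \<theta>)) (at \<theta> within ?T)" for \<theta>
          using \<phi>(1) by (auto simp: std_periodic_def intro: has_vector_derivative_at_within)
      qed (use zder[OF \<phi>(2)] zin[OF \<phi>(2)] z0[OF \<phi>(2)] L that in auto)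
      have per: "\<phi> (\<theta> + of_int n * (2 * pi)) = \<phi> \<theta>" if "std_periodic S \<epsilon> \<phi>" for \<phi> \<theta> n
        by (rule periodic_int) (use that in \<open>auto simp: std_periodic_def\<close>)
      \<comment> \<open>Returning to the initial value after one turn means zero displacement, and
        \<epsilon>^k can be cancelled.\<close>
      have zero_at: "?f (\<phi> 0) + w (\<phi> 0) = 0" if \<phi>: "std_periodic S \<epsilon> \<phi>" "\<phi> 0 \<in> cball x r" for \<phi>
      proof -
        have "\<phi> (2 * pi) = \<phi> 0" using per[OF \<phi>(1), of 0 1] by simp
        then have "\<phi> 0 + \<epsilon> ^ ?k *\<^sub>R (?f (\<phi> 0) + w (\<phi> 0)) = \<phi> 0"
          using on_T[OF \<phi>, of "2 * pi"] z2pi[OF \<phi>(2)] by simp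
        then show ?thesis using \<epsilon>(1) by simp
      qed
      show ?case
        unfolding unique_continuation_def
      proof (intro conjI allI impI)
        obtain y where y: "y \<in> ball x \<delta>" "?f y + w y = 0" using main by blast
        then have yr: "y \<in> cball x r" using \<delta> sub ball_subset_cball[of x \<delta>] by (meson order_trans subsetD subset_cball)
        obtain \<phi> where \<phi>: "\<And>\<theta>. \<phi> (\<theta> + 2 * pi) = \<phi> \<theta>" "\<And>\<theta>. \<theta> \<in> ?T \<Longrightarrow> \<phi> \<theta> = z y \<theta>"
          "\<And>\<theta>. (\<phi> has_vector_derivative std_rhs S \<epsilon> \<theta> (\<phi> \<theta>)) (at \<theta>)"
        proof (rule periodic_extension[where z = "z y" and T = "2 * pi" and h = "std_rhs S \<epsilon>"])
          show "z y 0 = z y (2 * pi)" using z0[OF yr] z2pi[OF yr] y(2) by simp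
          show "std_rhs S \<epsilon> (\<theta> - of_int n * (2 * pi)) \<eta> = std_rhs S \<epsilon> \<theta> \<eta>" for \<theta> \<eta> and n :: int
            by (rule std_cong(2)) (rule cos_sin_shift)+
        qed (use zder[OF yr] in auto)
        have "\<phi> \<theta> $ None > 0 \<and> std_den S \<epsilon> \<theta> (\<phi> \<theta>) \<noteq> 0" for \<theta>
        proof -
          obtain t and n :: int where t: "t \<in> ?T" "\<theta> = t + of_int n * (2 * pi)" by (rule angle_reduction)
          have eq: "\<phi> \<theta> = z y t" using periodic_int[of \<phi> "2 * pi" t n] \<phi>(1) \<phi>(2)[OF t(1)] t(2) by simp
          have "std_den S \<epsilon> \<theta> (z y t) = std_den S \<epsilon> t (z y t)"
            using std_cong(1)[OF cos_sin_shift, of S \<epsilon> \<theta> n "z y t"] t(2) by simp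
          then show ?thesis using zin[OF yr t(1)] half den[OF t(1)] by (auto simp: eq)
        qed
        with \<phi> have "std_periodic S \<epsilon> \<phi>" by (simp add: std_periodic_def)
        moreover have "\<phi> 0 = y" using \<phi>(2)[of 0] z0[OF yr] by simp
        ultimately show "\<exists>\<phi>. std_periodic S \<epsilon> \<phi> \<and> \<phi> 0 \<in> ball x \<delta>" using y(1) by blast
      next
        fix \<phi> \<psi> assume p: "std_periodic S \<epsilon> \<phi>" "std_periodic S \<epsilon> \<psi>" and "\<phi> 0 \<in> cball x d" "\<psi> 0 \<in> cball x d"
        then have r: "\<phi> 0 \<in> cball x r" "\<psi> 0 \<in> cball x r" using sub by blast+
        have eq0: "\<phi> 0 = \<psi> 0"
          using main zero_at[OF p(1) r(1)] zero_at[OF p(2) r(2)] \<open>\<phi> 0 \<in> cball x d\<close> \<open>\<psi> 0 \<in> cball x d\<close> by blast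
        show "\<phi> = \<psi>"
        proof
          fix \<theta>
          obtain t and n :: int where t: "t \<in> ?T" "\<theta> = t + of_int n * (2 * pi)" by (rule angle_reduction)
          then show "\<phi> \<theta> = \<psi> \<theta>"
            using per[OF p(1), of t n] per[OF p(2), of t n] on_T[OF p(1) r(1) t(1)] on_T[OF p(2) r(2) t(1)] eq0 by simp
        qed
      next
        fix \<phi> \<theta> assume p: "std_periodic S \<epsilon> \<phi>" and "\<phi> 0 \<in> cball x d"
        then have r: "\<phi> 0 \<in> cball x r" using sub by blast
        obtain t and n :: int where t: "t \<in> ?T" "\<theta> = t + of_int n * (2 * pi)" by (rule angle_reduction)
        have "\<phi> \<theta> \<in> ball x r'" using per[OF p, of t n] on_T[OF p r t(1)] zin[OF r t(1)] t(2) by simp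
        then have "norm (\<phi> \<theta> - x) < r'" by (simp add: dist_norm norm_minus_commute)
        then show "norm (\<phi> \<theta>) \<le> norm x + r'" using norm_triangle_ineq[of "\<phi> \<theta> - x" x] by simp
      qed
    qed
  qed
qed

section \<open>Counting the detected cycles\<close>

lemma norm_polar_le: "norm (polar \<theta> \<eta> :: real ^ 'd::finite coord) \<le> real CARD('d coord) * norm \<eta>"
proof (rule norm_le_card_bound)
  fix v :: "'d coord"
  have c: "\<bar>\<eta> $ j\<bar> \<le> norm \<eta>" for j by (rule component_le_norm_cart)
  have "\<bar>\<eta> $ None\<bar> * \<bar>cos \<theta>\<bar> \<le> norm \<eta> * 1" "\<bar>\<eta> $ None\<bar> * \<bar>sin \<theta>\<bar> \<le> norm \<eta> * 1"
    by (intro mult_mono c abs_cos_le_one abs_sin_le_one; simp)+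
  then show "\<bar>polar \<theta> \<eta> $ v\<bar> \<le> norm \<eta>"
    using c by (cases v) (simp_all add: polar_def abs_mult)
qed

lemma scale_tendsto_0:
  assumes "par_m S \<ge> 2"
  shows "((\<lambda>\<epsilon>. scale S \<epsilon>) \<longlongrightarrow> 0) (at_right 0)"
proof -
  have "((\<lambda>\<epsilon>::real. \<epsilon> powr (1 / (real (par_m S) - 1))) \<longlongrightarrow> 0 powr (1 / (real (par_m S) - 1))) (at_right 0)"
    by (rule tendsto_powr') (use assms in \<open>auto intro: tendsto_ident_at simp: eventually_at_filter\<close>)
  then show ?thesis by (simp add: scale_def)
qed

text \<open>
  The isolating neighbourhood removes from the half-hyperplane \<open>x\<^sub>2 = 0 \<le> x\<^sub>1\<close>, which every orbit of one-turn type
  meets exactly at \<open>\<theta> = 0\<close>, all points that do not come from the given ball.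
\<close>

lemma limit_cycle_curve_of:
  fixes S :: "'d::finite perturbed"
  assumes "par_m S \<ge> 2" and "\<epsilon> > 0" and "std_periodic S \<epsilon> \<phi>" and "\<phi> 0 \<in> ball x \<delta>"
    and uniq: "\<And>\<psi>. std_periodic S \<epsilon> \<psi> \<Longrightarrow> \<psi> 0 \<in> ball x \<delta> \<Longrightarrow> \<psi> = \<phi>"
  shows "limit_cycle S \<epsilon> (curve_of S \<epsilon> \<phi>)"
proof -
  let ?u = "unpolar (scale S \<epsilon>) :: real ^ 'd coord \<Rightarrow> _"
  have \<sigma>: "scale S \<epsilon> > 0" by (rule scale_pos[OF assms(2)])
  define W where "W = {y :: real ^ 'd coord. y $ C2 = 0} \<inter> {y. 0 \<le> y $ C1} \<inter> ?u -` (- ball x \<delta>)"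
  have "closed {y :: real ^ 'd coord. y $ C2 = 0}" "closed {y :: real ^ 'd coord. 0 \<le> y $ C1}"
    by (intro closed_Collect_eq closed_Collect_le continuous_intros)+
  moreover have "closed (?u -` (- ball x \<delta>))"
    by (intro closed_vimage) (auto intro: continuous_on_unpolar)
  ultimately have "closed W" unfolding W_def by (intro closed_Int)
  moreover have "curve_of S \<epsilon> \<phi> \<subseteq> - W"
    using unpolar_curve_section[OF assms(2,3)] assms(4) by (auto simp: W_def)
  moreover have "\<Gamma>' = curve_of S \<epsilon> \<phi>" if "\<Gamma>' \<in> one_turn_orbits S \<epsilon>" "\<Gamma>' \<subseteq> - W" for \<Gamma>'
  proof -
    obtain \<psi> where \<psi>: "std_periodic S \<epsilon> \<psi>" "\<Gamma>' = curve_of S \<epsilon> \<psi>"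
      using \<open>\<Gamma>' \<in> one_turn_orbits S \<epsilon>\<close> by (auto simp: one_turn_orbits_def)
    let ?y = "scale S \<epsilon> *\<^sub>R polar 0 (\<psi> 0)"
    have "?y \<in> \<Gamma>'" unfolding \<psi>(2) curve_of_eq by blast
    then have "?y \<notin> W" using \<open>\<Gamma>' \<subseteq> - W\<close> by blast
    moreover have "\<psi> 0 $ None > 0" using \<psi>(1) by (auto simp: std_periodic_def)
    then have "?y $ C2 = 0" "?y $ C1 \<ge> 0" using \<sigma> by (simp_all add: polar_def)
    ultimately have "\<psi> 0 \<in> ball x \<delta>"
      using \<sigma> unpolar_polar_0[of "scale S \<epsilon>" "\<psi> 0"] by (simp add: W_def)
    then show ?thesis using uniq[OF \<psi>(1)] \<psi>(2) by simp
  qed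
  ultimately show ?thesis
    unfolding limit_cycle_def
    using std_periodic_closed_orbit[OF assms(1-3)] assms(3)
    by (intro conjI exI[of _ "- W"]) (auto simp: one_turn_orbits_def open_Compl)
qed

text \<open>The map from a simple zero to the curve of its unique nearby periodic solution is a
  bijection onto the detected cycles. It is injective because equal curves have equal initial
  values, while balls of radius \<delta> around zeros at distance at least 2 \<delta> are
  disjoint.\<close>

lemma detected_cycles_card:
  fixes S :: "'d::finite perturbed"
  assumes m: "par_m S \<ge> 2" and "\<epsilon> > 0" and fin: "finite (simple_zeros S)" and \<delta>: "0 < \<delta>"
    and ex: "\<And>x. x \<in> simple_zeros S \<Longrightarrow> \<exists>\<phi>. std_periodic S \<epsilon> \<phi> \<and> \<phi> 0 \<in> ball x \<delta>"
    and uniq: "\<And>x \<phi> \<psi>. x \<in> simple_zeros S \<Longrightarrow> std_periodic S \<epsilon> \<phi> \<Longrightarrow> std_periodic S \<epsilon> \<psi> \<Longrightarrow>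
       \<phi> 0 \<in> ball x \<delta> \<Longrightarrow> \<psi> 0 \<in> ball x \<delta> \<Longrightarrow> \<phi> = \<psi>"
    and small: "\<And>x \<phi>. x \<in> simple_zeros S \<Longrightarrow> std_periodic S \<epsilon> \<phi> \<Longrightarrow> \<phi> 0 \<in> ball x \<delta> \<Longrightarrow> curve_of S \<epsilon> \<phi> \<subseteq> ball 0 \<rho>"
    and separable: "\<And>x y. x \<in> simple_zeros S \<Longrightarrow> y \<in> simple_zeros S \<Longrightarrow> x \<noteq> y \<Longrightarrow> 2 * \<delta> \<le> dist x y"
  shows "finite (detected_cycles S \<delta> \<rho> \<epsilon>) \<and> card (detected_cycles S \<delta> \<rho> \<epsilon>) = card (simple_zeros S)"
proof -
  let ?Z = "simple_zeros S"
  have "\<forall>x\<in>?Z. \<exists>\<phi>. std_periodic S \<epsilon> \<phi> \<and> \<phi> 0 \<in> ball x \<delta>" using ex by blast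
  from bchoice[OF this] obtain \<Phi> where \<Phi>: "\<And>x. x \<in> ?Z \<Longrightarrow> std_periodic S \<epsilon> (\<Phi> x)"
    "\<And>x. x \<in> ?Z \<Longrightarrow> \<Phi> x 0 \<in> ball x \<delta>" by blast
  let ?\<Gamma> = "\<lambda>x. curve_of S \<epsilon> (\<Phi> x)"
  have "detected_cycles S \<delta> \<rho> \<epsilon> = ?\<Gamma> ` ?Z"
  proof (intro equalityI subsetI)
    fix \<Gamma> assume "\<Gamma> \<in> detected_cycles S \<delta> \<rho> \<epsilon>"
    then obtain \<phi> x where \<phi>: "std_periodic S \<epsilon> \<phi>" "\<Gamma> = curve_of S \<epsilon> \<phi>" and x: "x \<in> ?Z" "dist (\<phi> 0) x < \<delta>"
      by (auto simp: detected_cycles_def)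
    have "\<phi> 0 \<in> ball x \<delta>" using x(2) by (simp add: dist_commute)
    then have "\<phi> = \<Phi> x" using uniq[OF x(1) \<phi>(1) \<Phi>(1)[OF x(1)]] \<Phi>(2)[OF x(1)] by blast
    then show "\<Gamma> \<in> ?\<Gamma> ` ?Z" using \<phi>(2) x(1) by blast
  next
    fix \<Gamma> assume "\<Gamma> \<in> ?\<Gamma> ` ?Z"
    then obtain x where x: "x \<in> ?Z" "\<Gamma> = ?\<Gamma> x" by blast
    have "limit_cycle S \<epsilon> \<Gamma>"
      unfolding x(2)
      by (rule limit_cycle_curve_of[OF m \<open>\<epsilon> > 0\<close> \<Phi>[OF x(1)]]) (use uniq[OF x(1)] \<Phi>[OF x(1)] in blast)
    moreover have "\<Gamma> \<subseteq> ball 0 \<rho>" using small[OF x(1) \<Phi>[OF x(1)]] x(2) by simp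
    moreover have "dist (\<Phi> x 0) x < \<delta>" using \<Phi>(2)[OF x(1)] by (simp add: dist_commute)
    ultimately show "\<Gamma> \<in> detected_cycles S \<delta> \<rho> \<epsilon>"
      using \<Phi>(1)[OF x(1)] x unfolding detected_cycles_def by blast
  qed
  moreover have "inj_on ?\<Gamma> ?Z"
  proof (rule inj_onI, rule ccontr)
    fix x y assume xy: "x \<in> ?Z" "y \<in> ?Z" "?\<Gamma> x = ?\<Gamma> y" "x \<noteq> y"
    let ?p = "scale S \<epsilon> *\<^sub>R polar 0 (\<Phi> x 0)"
    have "?p \<in> ?\<Gamma> x" unfolding curve_of_eq by blast
    then have p: "?p \<in> ?\<Gamma> y" using xy(3) by simp
    have "\<Phi> x 0 $ None > 0" using \<Phi>(1)[OF xy(1)] by (auto simp: std_periodic_def)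
    then have "unpolar (scale S \<epsilon>) ?p = \<Phi> y 0"
      using scale_pos[OF \<open>\<epsilon> > 0\<close>, of S]
      by (intro unpolar_curve_section[OF \<open>\<epsilon> > 0\<close> \<Phi>(1)[OF xy(2)] p]) (simp_all add: polar_def)
    then have "\<Phi> x 0 = \<Phi> y 0" using scale_pos[OF \<open>\<epsilon> > 0\<close>, of S] by (simp add: unpolar_polar_0)
    then have "dist x y < 2 * \<delta>"
      using \<Phi>(2)[OF xy(1)] \<Phi>(2)[OF xy(2)] dist_triangle_less_add[of x "\<Phi> x 0" \<delta> y \<delta>]
      by (simp add: dist_commute)
    then show False using separable[OF xy(1,2,4)] by simp
  qed
  ultimately show ?thesis using fin by (simp add: card_image)
qed

lemma finite_separated:
  fixes Z :: "'a::metric_space set"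
  assumes "finite Z"
  obtains s where "s > 0" and "\<And>x y. x \<in> Z \<Longrightarrow> y \<in> Z \<Longrightarrow> x \<noteq> y \<Longrightarrow> s \<le> dist x y"
proof -
  \<comment> \<open>The element 1 covers the case of fewer than two points.\<close>
  let ?D = "insert 1 ((\<lambda>(x, y). dist x y) ` {(x, y) \<in> Z \<times> Z. x \<noteq> y})"
  have fin: "finite ?D" using assms by (auto intro: finite_subset[of _ "Z \<times> Z"])
  show ?thesis
  proof (rule that[of "Min ?D"])
    show "Min ?D > 0" by (subst Min_gr_iff[OF fin]) auto
    show "Min ?D \<le> dist x y" if "x \<in> Z" "y \<in> Z" "x \<noteq> y" for x y
      by (rule Min_le[OF fin]) (use that in force)
  qed
qed

text \<open>Both descriptions are confined to R > 0, where R^\<mu> and the denominator Q are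
  nonzero; clearing denominators thus neither adds nor removes zeros.\<close>

lemma semialg_solutions_eq_simple_zeros:
  assumes "par_b S \<noteq> 0"
    and "\<And>j. least_poly_multiple (\<mu> j) (fbar j) (\<lambda>\<eta>. f_avg S (par_k S) \<eta> $ j)"
    and "is_numerator Dbar (D_avg S)"
  shows "semialg_solutions S fbar Dbar = simple_zeros S"
proof -
  have f: "fbar j \<eta> = (\<eta> $ None) ^ \<mu> j * f_avg S (par_k S) \<eta> $ j" if "\<eta> $ None > 0" for j \<eta>
    using assms(2)[of j] that by (auto simp: least_poly_multiple_def poly_multiple_def)
  obtain Q where Q: "\<And>\<eta>. \<eta> $ None > 0 \<Longrightarrow> Q \<eta> \<noteq> 0 \<and> D_avg S \<eta> = Dbar \<eta> / Q \<eta>"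
    using assms(3) by (auto simp: is_numerator_def)
  have "(\<forall>j. fbar j \<eta> = 0) \<longleftrightarrow> f_avg S (par_k S) \<eta> = 0" if "\<eta> $ None > 0" for \<eta>
    using that by (auto simp: f vec_eq_iff)
  moreover have "Dbar \<eta> \<noteq> 0 \<longleftrightarrow> D_avg S \<eta> \<noteq> 0" if "\<eta> $ None > 0" for \<eta>
    using Q[OF that] by simp
  ultimately show ?thesis
    using assms(1) by (auto simp: semialg_solutions_def simple_zeros_def)
qed

theorem theorem9:
  fixes S :: "'d::finite perturbed"
    and N :: nat
    and \<mu> :: "'d option \<Rightarrow> nat"
    and fbar :: "'d option \<Rightarrow> real ^ 'd option \<Rightarrow> real"
    and Dbar :: "real ^ 'd option \<Rightarrow> real"
  assumes "par_m S \<ge> 2" and "par_k S \<ge> 1" and "par_b S \<noteq> 0"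
    and "\<And>i \<eta>. 1 \<le> i \<Longrightarrow> i < par_k S \<Longrightarrow> \<eta> $ None > 0 \<Longrightarrow> f_avg S i \<eta> = 0"
    and "\<exists>\<eta>. \<eta> $ None > 0 \<and> f_avg S (par_k S) \<eta> \<noteq> 0"
    and "\<And>j. least_poly_multiple (\<mu> j) (fbar j) (\<lambda>\<eta>. f_avg S (par_k S) \<eta> $ j)"
    and "is_numerator Dbar (D_avg S)"
    and "finite (semialg_solutions S fbar Dbar)" and "card (semialg_solutions S fbar Dbar) = N"
  shows "exactly_bifurcating S N"
proof -
  let ?Z = "simple_zeros S"
  note Z_eq = semialg_solutions_eq_simple_zeros[OF assms(3,6,7)]
  have fin: "finite ?Z" and card: "card ?Z = N" using assms(8,9) by (simp_all add: Z_eq)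
  obtain s where s: "s > 0" "\<And>x y. x \<in> ?Z \<Longrightarrow> y \<in> ?Z \<Longrightarrow> x \<noteq> y \<Longrightarrow> s \<le> dist x y"
    using finite_separated[OF fin] by blast
  have "\<forall>x\<in>?Z. \<exists>dM. 0 < fst dM \<and>
     (\<forall>\<delta>. 0 < \<delta> \<longrightarrow> \<delta> \<le> fst dM \<longrightarrow> (\<forall>\<^sub>F \<epsilon> in at_right 0. unique_continuation S x (fst dM) (snd dM) \<delta> \<epsilon>))"
  proof
    fix x assume x: "x \<in> ?Z"
    obtain d M where "0 < d"
      "\<forall>\<delta>. 0 < \<delta> \<longrightarrow> \<delta> \<le> d \<longrightarrow> (\<forall>\<^sub>F \<epsilon> in at_right 0. unique_continuation S x d M \<delta> \<epsilon>)"
      by (rule simple_zero_continuation[OF assms(3,2,4) x])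
    then show "\<exists>dM. 0 < fst dM \<and>
     (\<forall>\<delta>. 0 < \<delta> \<longrightarrow> \<delta> \<le> fst dM \<longrightarrow> (\<forall>\<^sub>F \<epsilon> in at_right 0. unique_continuation S x (fst dM) (snd dM) \<delta> \<epsilon>))"
      by (intro exI[of _ "(d, M)"]) simp
  qed
  from bchoice[OF this] obtain dM where dM: "\<And>x. x \<in> ?Z \<Longrightarrow> 0 < fst (dM x)"
    "\<And>x \<delta>. x \<in> ?Z \<Longrightarrow> 0 < \<delta> \<Longrightarrow> \<delta> \<le> fst (dM x) \<Longrightarrow>
      \<forall>\<^sub>F \<epsilon> in at_right 0. unique_continuation S x (fst (dM x)) (snd (dM x)) \<delta> \<epsilon>" by blast
  \<comment> \<open>Any \<delta> \<le> d lies within every radius of uniqueness, and 2 \<delta>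
    \<le> s separates distinct zeros.\<close>
  define d where "d = Min (insert (s / 2) ((fst \<circ> dM) ` ?Z))"
  have d: "d > 0" "\<And>x. x \<in> ?Z \<Longrightarrow> d \<le> fst (dM x)"
    using fin s(1) dM(1) by (auto simp: d_def)
  have "d \<le> s / 2" unfolding d_def using fin by (intro Min_le) auto
  show ?thesis
    unfolding exactly_bifurcating_def
  proof (rule exI[of _ d], intro conjI allI impI d(1))
    fix \<delta> \<rho> :: real assume \<delta>: "0 < \<delta> \<and> \<delta> \<le> d" and "\<rho> > 0"
    \<comment> \<open>A strict common bound for the solutions continuing all simple zeros, positive
      even if there are none.\<close>
    define M where "M = 1 + (\<Sum>x\<in>?Z. \<bar>snd (dM x)\<bar>)"
    have M: "snd (dM x) < M" if "x \<in> ?Z" for x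
    proof -
      have "\<bar>snd (dM x)\<bar> \<le> (\<Sum>x\<in>?Z. \<bar>snd (dM x)\<bar>)" by (rule member_le_sum) (use that fin in auto)
      then show ?thesis by (simp add: M_def)
    qed
    have M0: "M > 0" by (simp add: M_def add_pos_nonneg sum_nonneg)
    let ?c = "real CARD('d coord)"
    have c: "?c > 0" by (simp add: card_gt_0_iff)
    have ev1: "\<forall>\<^sub>F \<epsilon> in at_right 0. \<forall>x\<in>?Z. unique_continuation S x (fst (dM x)) (snd (dM x)) \<delta> \<epsilon>"
      by (rule eventually_ball_finite[OF fin]) (use dM(2) \<delta> d(2) in \<open>meson order_trans\<close>)
    \<comment> \<open>The points of a curve have norm at most the scale times ?c M, so this puts
      every curve inside the ball of radius \<rho>.\<close>
    have ev2: "\<forall>\<^sub>F \<epsilon> in at_right 0. scale S \<epsilon> < \<rho> / (?c * M)"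
      using order_tendstoD(2)[OF scale_tendsto_0[OF assms(1)], of "\<rho> / (?c * M)"] \<open>\<rho> > 0\<close> c M0 by simp
    have ev3: "\<forall>\<^sub>F \<epsilon> in at_right 0. (0::real) < \<epsilon>" by (simp add: eventually_at_filter)
    from ev1 ev2 ev3 have "\<forall>\<^sub>F \<epsilon> in at_right 0.
      finite (detected_cycles S \<delta> \<rho> \<epsilon>) \<and> card (detected_cycles S \<delta> \<rho> \<epsilon>) = N"
    proof eventually_elim
      case (elim \<epsilon>)
      have sub: "y \<in> cball x (fst (dM x))" if "x \<in> ?Z" "y \<in> ball x \<delta>" for x y
        using that(2) \<delta> d(2)[OF that(1)] by auto
      have "finite (detected_cycles S \<delta> \<rho> \<epsilon>) \<and> card (detected_cycles S \<delta> \<rho> \<epsilon>) = card ?Z"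
      proof (rule detected_cycles_card[OF assms(1) elim(3) fin])
        show "0 < \<delta>" using \<delta> by simp
        show "\<exists>\<phi>. std_periodic S \<epsilon> \<phi> \<and> \<phi> 0 \<in> ball x \<delta>" if "x \<in> ?Z" for x using elim(1) that unfolding unique_continuation_def by blast
        show "\<phi> = \<psi>" if "x \<in> ?Z" "std_periodic S \<epsilon> \<phi>" "std_periodic S \<epsilon> \<psi>" "\<phi> 0 \<in> ball x \<delta>" "\<psi> 0 \<in> ball x \<delta>"
          for x \<phi> \<psi> using elim(1) that sub unfolding unique_continuation_def by blast
        show "2 * \<delta> \<le> dist x y" if "x \<in> ?Z" "y \<in> ?Z" "x \<noteq> y" for x y
          using s(2)[OF that] \<delta> \<open>d \<le> s / 2\<close> by linarith
        show "curve_of S \<epsilon> \<phi> \<subseteq> ball 0 \<rho>" if x: "x \<in> ?Z" "std_periodic S \<epsilon> \<phi>" "\<phi> 0 \<in> ball x \<delta>" for x \<phi>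
        proof -
          have "norm (scale S \<epsilon> *\<^sub>R polar \<theta> (\<phi> \<theta>)) < \<rho>" for \<theta>
          proof -
            have "norm (\<phi> \<theta>) \<le> snd (dM x)" using elim(1) x sub[OF x(1,3)] unfolding unique_continuation_def by blast
            then have "?c * norm (\<phi> \<theta>) \<le> ?c * M" using M[OF x(1)] c by (intro mult_left_mono) auto
            then have "norm (polar \<theta> (\<phi> \<theta>)) \<le> ?c * M" using norm_polar_le order_trans by blast
            then have "norm (scale S \<epsilon> *\<^sub>R polar \<theta> (\<phi> \<theta>)) \<le> scale S \<epsilon> * (?c * M)"
              using scale_pos[OF elim(3), of S] by simp
            also have "\<dots> < \<rho>" using elim(2) pos_less_divide_eq[of "?c * M" "scale S \<epsilon>" \<rho>] c M0 by simp
            finally show ?thesis .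
          qed
          then show ?thesis by (auto simp: curve_of_eq)
        qed
      qed
      then show ?case by (simp add: card)
    qed
    then show "\<exists>\<epsilon>\<^sub>0>0. \<forall>\<epsilon>. 0 < \<epsilon> \<and> \<epsilon> < \<epsilon>\<^sub>0 \<longrightarrow>
        finite (detected_cycles S \<delta> \<rho> \<epsilon>) \<and> card (detected_cycles S \<delta> \<rho> \<epsilon>) = N"
      unfolding eventually_at_right_field by blast
  qed
qed

end
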